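(* Let $\mu_k\Rightarrow\mu$ weakly on $\mathbb R^n$ (as $k\to\infty$), where each probability measure $\mu_k$ is centered and has finite second moments. Let $Y_k\sim\mu_k$, and suppose that $\mu_k$ admits a symmetric positive-semidefinite Stein kernel $\tau_k$ such that $$\sup_k\mathbb E\|\tau_k(Y_k)\|_{\mathrm{HS}}^2<\infty.$$ Then $\mu$ is centered, $\mu_k\to\mu$ in $W_2$, and, with $Y\sim\mu$, $\mu$ admits a symmetric positive-semidefinite Stein kernel $\tau$ satisfying $$\mathbb E\tau(Y)=\operatorname{Cov}(Y),\qquad \mathbb E\|\tau(Y)\|_{\mathrm{HS}}^2\le\liminf_{k\to\infty}\mathbb E\|\tau_k(Y_k)\|_{\mathrm{HS}}^2 .$$ The same kernel $\tau$ may be chosen so that, in addition, all of the following hold. (i) If $F:\mathsf S_n\to[0,\infty]$ is convex and lower semicontinuous and $\sup_k\mathbb E F(\tau_k(Y_k))\le C_F$, then $\mathbb E F(\tau(Y))\le C_F$. (ii) If a constant $C_{\rm tr}$ satisfies $\operatorname{Var}(\operatorname{Tr}(A\tau_k(Y_k)))\le C_{\rm tr}\operatorname{Tr}(A^2)$ for every $k$ and every $A\in\mathsf S_n$, then $\operatorname{Var}(\operatorname{Tr}(A\tau(Y)))\le C_{\rm tr}\operatorname{Tr}(A^2)$ for every $A\in\mathsf S_n$. (iii) If a constant $C_{\rm en}$ satisfies $\mathbb E\operatorname{Tr}(A\tau_k(Y_k)A\tau_k(Y_k))\le C_{\rm en}\operatorname{Tr}(A^2)$ for every $k$ and every $A\in\mathsf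 S_n$, then $\mathbb E\operatorname{Tr}(A\tau(Y)A\tau(Y))\le C_{\rm en}\operatorname{Tr}(A^2)$ for every $A\in\mathsf S_n$. (iv) If a constant $C_{\rm wp}$ satisfies $$\operatorname{Var}_{\mu_k}g\le C_{\rm wp}\,\mathbb E\langle\tau_k(Y_k)\nabla g(Y_k),\nabla g(Y_k)\rangle$$ for every $k$ and every $g\in C_c^\infty(\mathbb R^n)$, then $$\operatorname{Var}_{\mu}g\le C_{\rm wp}\,\mathbb E\langle\tau(Y)\nabla g(Y),\nabla g(Y)\rangle\qquad\text{for every }g\in C_c^\infty(\mathbb R^n).$$
   Context: $\mathsf S_n$ is the space of real symmetric $n\times n$ matrices; $\langle B,C\rangle_{\mathrm{HS}}=\operatorname{Tr}(B^{\mathsf T}C)$ and $\|\cdot\|_{\mathrm{HS}}$ is the associated norm. $W_2$ is the quadratic Wasserstein distance. Stein kernel: a measurable matrix field $\tau:\mathbb R^n\to\mathbb R^{n\times n}$ is a Stein kernel for a centered law $\mu$ if, for $Y\sim\mu$, $$\mathbb E\langle Y,\Phi(Y)\rangle=\mathbb E\langle\tau(Y),\nabla\Phi(Y)\rangle_{\mathrm{HS}}$$ for every smooth compactly supported vector field $\Phi:\mathbb R^n\to\mathbb R^n$, where $\nabla\Phi=(\partial_j\Phi_i)_{i,j}$ is the Jacobian matrix. It is symmetric positive-semidefinite if its values are symmetric positive-semidefinite matrices. *)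

theory Defs
  imports "HOL-Probability.Probability"
begin

section \<open>Smooth functions with compact support\<close>

text \<open>\<open>C_k k f\<close>: \<open>f\<close> is \<open>k\<close> times continuously differentiable on the whole space. In finite dimension
  it suffices that every directional derivative is of class \<open>k - 1\<close>.\<close>

primrec C_k :: "nat \<Rightarrow> ('a::euclidean_space \<Rightarrow> 'b::real_normed_vector) \<Rightarrow> bool" where
  "C_k 0 f \<longleftrightarrow> continuous_on UNIV f"
| "C_k (Suc k) f \<longleftrightarrow> (\<forall>x. f differentiable (at x)) \<and>
     (\<forall>v. C_k k (\<lambda>x. frechet_derivative f (at x) v))"

definition smooth :: "('a::euclidean_space \<Rightarrow> 'b::real_normed_vector) \<Rightarrow> bool" where
  "smooth f \<longleftrightarrow> (\<forall>k. C_k k f)"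

definition test_function :: "('a::euclidean_space \<Rightarrow> 'b::real_normed_vector) \<Rightarrow> bool" where
  "test_function f \<longleftrightarrow> smooth f \<and> compact (closure {x. f x \<noteq> 0})"

definition grad :: "(real^'n \<Rightarrow> real) \<Rightarrow> real^'n \<Rightarrow> real^'n" where
  "grad g x = (\<chi> j. frechet_derivative g (at x) (axis j 1))"


section \<open>Symmetric matrices and the Hilbert--Schmidt inner product\<close>

definition sym_matrices :: "(real^'n^'n) set" where
  "sym_matrices = {A. transpose A = A}"

definition sym_psd :: "real^'n^'n \<Rightarrow> bool" where
  "sym_psd A \<longleftrightarrow> A \<in> sym_matrices \<and> (\<forall>v. 0 \<le> v \<bullet> (A *v v))"

definition hs_inner :: "real^'n^'n \<Rightarrow> real^'n^'n \<Rightarrow> real" where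
  "hs_inner B C = trace (transpose B ** C)"

definition hs_norm :: "real^'n^'n \<Rightarrow> real" where
  "hs_norm B = sqrt (hs_inner B B)"

lemma hs_inner_eq_inner: "hs_inner B C = B \<bullet> C"
  unfolding hs_inner_def trace_def transpose_def matrix_matrix_mult_def inner_vec_def
  by (simp, rule sum.swap)

lemma hs_norm_eq_norm: "hs_norm B = norm B"
  by (simp add: hs_norm_def hs_inner_eq_inner norm_eq_sqrt_inner)


section \<open>Probability laws on Euclidean space\<close>

definition borel_prob :: "'a::euclidean_space measure \<Rightarrow> bool" where
  "borel_prob M \<longleftrightarrow> prob_space M \<and> sets M = sets borel"

definition centered :: "'a::euclidean_space measure \<Rightarrow> bool" where
  "centered M \<longleftrightarrow> integrable M (\<lambda>y. y) \<and> (\<integral>y. y \<partial>M) = 0"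

definition finite_second_moment :: "'a::euclidean_space measure \<Rightarrow> bool" where
  "finite_second_moment M \<longleftrightarrow> integrable M (\<lambda>y. (norm y)\<^sup>2)"

definition cov_matrix :: "(real^'n) measure \<Rightarrow> real^'n^'n" where
  "cov_matrix M = (\<chi> i j. \<integral>y. (y $ i - (\<integral>z. z $ i \<partial>M)) * (y $ j - (\<integral>z. z $ j \<partial>M)) \<partial>M)"

text \<open>The library notion \<^const>\<open>weak_conv_m\<close> is restricted to laws on the real line.\<close>

definition weakly_converges ::
  "(nat \<Rightarrow> 'a::euclidean_space measure) \<Rightarrow> 'a measure \<Rightarrow> bool" where
  "weakly_converges M N \<longleftrightarrow>
     (\<forall>f::'a \<Rightarrow> real. continuous_on UNIV f \<and> bounded (range f) \<longrightarrow>
        (\<lambda>k. \<integral>y. f y \<partial>M k) \<longlonglongrightarrow> (\<integral>y. f y \<partial>N))"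

definition couplings ::
  "'a::euclidean_space measure \<Rightarrow> 'a measure \<Rightarrow> ('a \<times> 'a) measure set" where
  "couplings M N = {P. sets P = sets borel \<and> distr P borel fst = M \<and> distr P borel snd = N}"

text \<open>\<open>W2\<close> is meaningful only for Borel probability measures with finite second moments, for which
  the infimum is finite; \<open>enn2real\<close> would send an infinite cost to \<open>0\<close>. Hence the moment conditions
  in the definition of convergence below.\<close>

definition W2 :: "'a::euclidean_space measure \<Rightarrow> 'a measure \<Rightarrow> real" where
  "W2 M N =
     sqrt (enn2real (INF P\<in>couplings M N. \<integral>\<^sup>+ z. ennreal ((norm (fst z - snd z))\<^sup>2) \<partial>P))"

definition W2_converges ::
  "(nat \<Rightarrow> 'a::euclidean_space measure) \<Rightarrow> 'a measure \<Rightarrow> bool" where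
  "W2_converges M N \<longleftrightarrow>
     (\<forall>k. borel_prob (M k) \<and> finite_second_moment (M k)) \<and>
     borel_prob N \<and> finite_second_moment N \<and> (\<lambda>k. W2 (M k) N) \<longlonglongrightarrow> 0"


section \<open>Stein kernels\<close>

text \<open>Integrability is demanded explicitly, since the Bochner integral of a non-integrable function
  is \<open>0\<close> by convention. The matrix \<open>jacobian \<Phi> (at y)\<close> has the entries \<open>\<partial>\<^sub>j \<Phi>\<^sub>i\<close>.\<close>

definition stein_kernel :: "(real^'n) measure \<Rightarrow> (real^'n \<Rightarrow> real^'n^'n) \<Rightarrow> bool" where
  "stein_kernel M \<tau> \<longleftrightarrow>
     \<tau> \<in> borel_measurable borel \<and>
     (\<forall>\<Phi>::real^'n \<Rightarrow> real^'n. test_function \<Phi> \<longrightarrow>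
        integrable M (\<lambda>y. y \<bullet> \<Phi> y) \<and>
        integrable M (\<lambda>y. hs_inner (\<tau> y) (jacobian \<Phi> (at y))) \<and>
        (\<integral>y. y \<bullet> \<Phi> y \<partial>M) = (\<integral>y. hs_inner (\<tau> y) (jacobian \<Phi> (at y)) \<partial>M))"

definition sym_psd_stein_kernel :: "(real^'n) measure \<Rightarrow> (real^'n \<Rightarrow> real^'n^'n) \<Rightarrow> bool" where
  "sym_psd_stein_kernel M \<tau> \<longleftrightarrow> stein_kernel M \<tau> \<and> (\<forall>y. sym_psd (\<tau> y))"


section \<open>Extended-valued convex lower semicontinuous functions\<close>

text \<open>The library's \<^const>\<open>convex_on\<close> covers only real-valued functions. The convention
  \<open>0 * \<infinity> = 0\<close> in \<open>ennreal\<close> makes the end points of the segment unproblematic.\<close>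

definition convex_ennreal_on :: "'a::real_vector set \<Rightarrow> ('a \<Rightarrow> ennreal) \<Rightarrow> bool" where
  "convex_ennreal_on S F \<longleftrightarrow> convex S \<and>
     (\<forall>x\<in>S. \<forall>y\<in>S. \<forall>t\<in>{0..1}.
        F ((1 - t) *\<^sub>R x + t *\<^sub>R y) \<le> ennreal (1 - t) * F x + ennreal t * F y)"

definition lower_semicontinuous_on :: "'a::topological_space set \<Rightarrow> ('a \<Rightarrow> ennreal) \<Rightarrow> bool" where
  "lower_semicontinuous_on S F \<longleftrightarrow> (\<forall>x\<in>S. F x \<le> Liminf (at x within S) F)"

end

theory Submission
  imports Defs
begin

text \<open>Testing the Stein identity with a cut off version of \<open>|y|\<^sup>2 y\<close> bounds the fourth moments of the
  \<open>\<mu>\<^sub>k\<close> by \<open>E |\<tau>\<^sub>k|\<^sup>2\<close>; together with weak convergence this gives couplings \<open>(X\<^sub>k, Y)\<close> of \<open>\<mu>\<^sub>k\<close> and \<open>\<mu>\<close> with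
  \<open>E |X\<^sub>k - Y|\<^sup>2 \<rightarrow> 0\<close>. The conditional expectations \<open>\<sigma>\<^sub>k(Y) = E[\<tau>\<^sub>k(X\<^sub>k) | Y]\<close> all live in \<open>L\<^sup>2(\<mu>)\<close> and are
  bounded there. Convex combinations of their tails converge in \<open>L\<^sup>1(\<mu>)\<close> and almost everywhere,
  and the limit is \<open>\<tau>\<close>. Linear functionals of \<open>\<tau>\<^sub>k\<close> pass to the limit because the couplings concentrate
  on the diagonal, convex ones by Jensen's inequality and Fatou's lemma.\<close>

section \<open>Cutoff functions\<close>

text \<open>Three constraints shape the argument. The couplings carry a bounded density with respect
  to the product law, so conditional expectations are plain integrals defined at every point, and
  membership in a closed convex set holds everywhere without any disintegration. Optimal couplings
  in general have no density; it is enough that the cost tends to zero. Next, one and the same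
  \<tau> has to inherit all the properties, so each of them is brought into a form, linear or convex
  in the kernel, that survives averaging. Two resist. A variance is a convex term minus a squared
  mean, so the means must genuinely converge; by the Stein identity they are second moments, and the
  fourth moment bound makes these converge. The functional in (iii) is in general not convex when A
  is indefinite, which forces a detour through the absolute value of A and the positive
  semidefiniteness of the kernels. Finally, the liminf bound requires a subsequence to be fixed
  before \<tau> is chosen.\<close>

lemma C_k_SucI:
  assumes "\<And>x. (f has_derivative f' x) (at x)" and "\<And>v. C_k k (\<lambda>x. f' x v)"
  shows "C_k (Suc k) f"
proof -
  have "frechet_derivative f (at x) = f' x" for x
    using frechet_derivative_at[OF assms(1)] by simp
  with assms show ?thesis
    by (auto simp: differentiable_def)
qed

lemma C_k_has_derivative:
  assumes "C_k (Suc k) f"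
  shows "(f has_derivative frechet_derivative f (at x)) (at x)"
    and "C_k k (\<lambda>x. frechet_derivative f (at x) v)"
  using assms by (auto simp: frechet_derivative_works)

lemma C_k_SucD: "C_k (Suc k) f \<Longrightarrow> C_k k f"
proof (induction k arbitrary: f)
  case 0
  then show ?case
    by (auto intro!: continuous_at_imp_continuous_on differentiable_imp_continuous_within)
next
  case (Suc k)
  then show ?case
    by (metis C_k.simps(2))
qed

lemma C_k_const: "C_k k (\<lambda>x. c)"
proof (induction k arbitrary: c)
  case (Suc k)
  show ?case
    by (rule C_k_SucI[OF has_derivative_const]) (rule Suc)
qed simp

lemma C_k_bounded_linear:
  assumes "bounded_linear f"
  shows "C_k k f"
proof (cases k)
  case 0
  then show ?thesis
    using assms by (simp add: linear_continuous_on)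
next
  case (Suc l)
  show ?thesis
    unfolding Suc by (rule C_k_SucI[OF bounded_linear_imp_has_derivative[OF assms] C_k_const])
qed

lemma C_k_add:
  assumes "C_k k f" "C_k k g"
  shows "C_k k (\<lambda>x. f x + g x)"
  using assms
proof (induction k arbitrary: f g)
  case 0
  then show ?case by (simp add: continuous_on_add)
next
  case (Suc k)
  show ?case
    by (rule C_k_SucI[OF has_derivative_add[OF C_k_has_derivative(1)[OF Suc.prems(1)]
          C_k_has_derivative(1)[OF Suc.prems(2)]]])
      (intro Suc.IH C_k_has_derivative(2) Suc.prems)
qed

lemma (in bounded_bilinear) C_k:
  assumes "C_k k f" "C_k k g"
  shows "C_k k (\<lambda>x. prod (f x) (g x))"
  using assms
proof (induction k arbitrary: f g)
  case 0
  then show ?case by (simp add: continuous_on)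
next
  case (Suc k)
  show ?case
    by (rule C_k_SucI[OF FDERIV[OF C_k_has_derivative(1)[OF Suc.prems(1)]
          C_k_has_derivative(1)[OF Suc.prems(2)]]])
      (intro C_k_add Suc.IH C_k_has_derivative(2) Suc.prems C_k_SucD[OF Suc.prems(1)]
        C_k_SucD[OF Suc.prems(2)])
qed

text \<open>The family t^(-m) exp(-1/t), extended by zero to t \<le> 0, is closed under
  differentiation up to linear combinations; carrying the exponent m makes smoothness a plain
  induction.\<close>

definition flat_exp :: "nat \<Rightarrow> real \<Rightarrow> real" where
  "flat_exp m t = (if t > 0 then (1 / t) ^ m * exp (- (1 / t)) else 0)"

lemma power_exp_minus_le:
  fixes u :: real
  assumes "0 \<le> u"
  shows "u ^ n * exp (- u) \<le> fact n"
proof -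
  have "(\<Sum>i\<in>{n}. u ^ i /\<^sub>R fact i) \<le> (\<Sum>i. u ^ i /\<^sub>R fact i)"
    by (rule sum_le_suminf[OF summable_exp_generic]) (use assms in auto)
  then have "u ^ n / fact n \<le> exp u"
    by (simp add: exp_def divide_inverse mult.commute)
  then show ?thesis
    by (simp add: exp_minus field_simps)
qed

lemma flat_exp_nonneg: "0 \<le> flat_exp m t"
  by (simp add: flat_exp_def)

lemma flat_exp_le_fact: "flat_exp m t \<le> fact m"
  using power_exp_minus_le[of "1 / t" m] by (auto simp: flat_exp_def)

text \<open>Two of the m + 2 inverse powers that the exponential controls are traded for t^2.
  Quadratic decay makes the difference quotient at the gluing point 0 vanish.\<close>

lemma flat_exp_le_square: "flat_exp m t \<le> fact (m + 2) * t\<^sup>2"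
proof (cases "t > 0")
  case True
  have "(1 / t) ^ (m + 2) * exp (- (1 / t)) \<le> fact (m + 2)"
    using True by (intro power_exp_minus_le) auto
  then have "t\<^sup>2 * ((1 / t) ^ (m + 2) * exp (- (1 / t))) \<le> t\<^sup>2 * fact (m + 2)"
    by (rule mult_left_mono) simp
  also have "t\<^sup>2 * ((1 / t) ^ (m + 2) * exp (- (1 / t))) = flat_exp m t"
    using True by (simp add: flat_exp_def power_add power2_eq_square)
  finally show ?thesis by (simp add: mult.commute)
qed (simp add: flat_exp_def)

lemma flat_exp_has_derivative:
  "(flat_exp m has_real_derivative flat_exp (m + 2) t - m * flat_exp (m + 1) t) (at t)"
proof -
  consider "t > 0" | "t < 0" | "t = 0" by linarith
  then show ?thesis
  proof cases
    case 1
    define u where "u = 1 / t"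
    have inv: "((\<lambda>s. 1 / s) has_real_derivative - (u\<^sup>2)) (at t)"
      using 1 by (auto intro!: derivative_eq_intros simp: u_def power2_eq_square)
    \<comment> \<open>The exponent \<open>m - Suc 0\<close> is truncated for m = 0, where the factor
      m kills the term.\<close>
    have u: "real m * (u\<^sup>2 * u ^ (m - Suc 0)) = real m * u ^ (m + 1)"
      by (cases m) (simp_all add: power2_eq_square)
    have "((\<lambda>s. (1 / s) ^ m * exp (- (1 / s))) has_real_derivative
        (- (real m * (u\<^sup>2 * u ^ (m - Suc 0))) * exp (- u) + exp (- u) * u\<^sup>2 * u ^ m)) (at t)"
      using DERIV_mult[OF DERIV_power[OF inv, of m] DERIV_chain2[OF DERIV_exp DERIV_minus[OF inv]]]
      by (simp add: u_def)
    then have "((\<lambda>s. (1 / s) ^ m * exp (- (1 / s))) has_real_derivative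
        (flat_exp (m + 2) t - m * flat_exp (m + 1) t)) (at t)"
      unfolding u using 1 by (simp add: flat_exp_def power_add flip: u_def)
        (simp add: algebra_simps power2_eq_square)
    then show ?thesis
      by (rule has_field_derivative_transform_within_open[of _ _ _ "{0<..}"])
        (use 1 in \<open>auto simp: flat_exp_def\<close>)
  next
    case 2
    have "((\<lambda>s. 0) has_real_derivative (flat_exp (m + 2) t - m * flat_exp (m + 1) t)) (at t)"
      using 2 by (simp add: flat_exp_def)
    then show ?thesis
      by (rule has_field_derivative_transform_within_open[of _ _ _ "{..<0}"])
        (use 2 in \<open>auto simp: flat_exp_def\<close>)
  next
    case 3
    have "((\<lambda>h. (flat_exp m h - flat_exp m 0) / h) \<longlongrightarrow> 0) (at 0)"
    proof (rule Lim_null_comparison)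
      show "((\<lambda>h::real. fact (m + 2) * \<bar>h\<bar>) \<longlongrightarrow> 0) (at 0)"
        by (auto intro!: tendsto_eq_intros)
      show "\<forall>\<^sub>F h in at 0. norm ((flat_exp m h - flat_exp m 0) / h) \<le> fact (m + 2) * \<bar>h\<bar>"
      proof (rule always_eventually, rule allI)
        fix h :: real
        have "flat_exp m h / \<bar>h\<bar> \<le> fact (m + 2) * h\<^sup>2 / \<bar>h\<bar>"
          by (intro divide_right_mono flat_exp_le_square) auto
        also have "\<dots> = fact (m + 2) * \<bar>h\<bar>"
          by (auto simp: power2_eq_square abs_if)
        finally show "norm ((flat_exp m h - flat_exp m 0) / h) \<le> fact (m + 2) * \<bar>h\<bar>"
          by (simp add: flat_exp_def[of m 0] flat_exp_nonneg)
      qed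
    qed
    then have "(flat_exp m has_real_derivative 0) (at 0)"
      by (simp add: has_field_derivative_iff)
    with 3 show ?thesis
      by (simp add: flat_exp_def)
  qed
qed

text \<open>Each derivative raises the exponent, so the induction runs over all m at once.\<close>

lemma C_k_flat_exp:
  assumes "C_k k g"
  shows "C_k k (\<lambda>x. flat_exp m (g x))"
  using assms
proof (induction k arbitrary: m)
  case 0
  have "continuous_on UNIV (flat_exp m)"
    by (meson DERIV_isCont continuous_at_imp_continuous_on flat_exp_has_derivative)
  with 0 show ?case
    by (auto intro: continuous_on_compose2)
next
  case (Suc k)
  have d: "((\<lambda>x. flat_exp m (g x)) has_derivative
      (\<lambda>v. (flat_exp (m + 2) (g x) + (- real m) * flat_exp (m + 1) (g x)) * frechet_derivative g (at x) v))
      (at x)" for x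
    using has_derivative_compose[OF C_k_has_derivative(1)[OF Suc.prems, of x]
        flat_exp_has_derivative[unfolded has_field_derivative_def]]
    by simp
  show ?case
    by (rule C_k_SucI[OF d])
      (intro bounded_bilinear.C_k[OF bounded_bilinear_mult] C_k_add C_k_const Suc.IH
        C_k_SucD[OF Suc.prems] C_k_has_derivative(2)[OF Suc.prems])
qed

text \<open>The argument stands for |y|^2, which keeps the cutoff smooth at the origin; for R > 0 it
  vanishes outside the ball of radius sqrt R. The factor exp 1 normalises the value at 0 to
  1.\<close>

definition cutoff :: "real \<Rightarrow> real \<Rightarrow> real" where
  "cutoff R s = exp 1 * flat_exp 0 (1 - s / R)"

definition cutoff' :: "real \<Rightarrow> real \<Rightarrow> real" where
  "cutoff' R s = - (exp 1 * flat_exp 2 (1 - s / R) / R)"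

lemma cutoff_has_derivative: "(cutoff R has_real_derivative cutoff' R s) (at s)"
proof -
  have "((\<lambda>s. 1 - s / R) has_real_derivative - (1 / R)) (at s)"
    unfolding divide_inverse by (auto intro!: derivative_eq_intros)
  from DERIV_chain2[OF flat_exp_has_derivative[of 0] this]
  have "((\<lambda>s. flat_exp 0 (1 - s / R)) has_real_derivative flat_exp 2 (1 - s / R) * - (1 / R)) (at s)"
    by (simp add: numeral_2_eq_2)
  from DERIV_cmult[OF this, of "exp 1"] show ?thesis
    unfolding cutoff_def[abs_def] cutoff'_def by simp
qed

lemma cutoff_bounds:
  assumes "R > 0"
  shows "0 \<le> cutoff R s" "0 \<le> s \<Longrightarrow> cutoff R s \<le> 1" "cutoff' R s \<le> 0"
    "\<bar>cutoff' R s\<bar> \<le> 2 * exp 1 / R" "s \<ge> R \<Longrightarrow> cutoff R s = 0"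
proof -
  show "cutoff R s \<le> 1" if "0 \<le> s"
  proof (cases "1 - s / R > 0")
    case True
    have "1 - s / R \<le> 1" using that assms by simp
    then have "1 \<le> 1 / (1 - s / R)" using True by (simp add: field_simps)
    then have "exp 1 * exp (- (1 / (1 - s / R))) \<le> exp 0"
      unfolding exp_add[symmetric] exp_le_cancel_iff by simp
    then show ?thesis using True by (simp add: cutoff_def flat_exp_def)
  qed (simp add: cutoff_def flat_exp_def)
  \<comment> \<open>The constant 2 is 2!, the bound on \<open>flat_exp 2\<close>.\<close>
  show "\<bar>cutoff' R s\<bar> \<le> 2 * exp 1 / R"
    using flat_exp_le_fact[of 2 "1 - s / R"] flat_exp_nonneg[of 2 "1 - s / R"] assms
    by (simp add: cutoff'_def abs_mult abs_divide divide_right_mono mult.commute numeral_2_eq_2)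
  show "cutoff R s = 0" if "s \<ge> R"
    using that assms by (simp add: cutoff_def flat_exp_def)
qed (use assms in \<open>auto simp: cutoff_def cutoff'_def flat_exp_nonneg\<close>)

lemma cutoff_tendsto_1: "(\<lambda>n. cutoff (real (Suc n)) s) \<longlonglongrightarrow> 1"
proof -
  have "(\<lambda>n. 1 - s / real (Suc n)) \<longlonglongrightarrow> 1 - 0"
    by (intro tendsto_diff tendsto_const) (rule LIMSEQ_Suc[OF lim_const_over_n])
  then have "(\<lambda>n. flat_exp 0 (1 - s / real (Suc n))) \<longlonglongrightarrow> flat_exp 0 1"
    using isCont_tendsto_compose[OF DERIV_isCont[OF flat_exp_has_derivative]] by auto
  then have "(\<lambda>n. exp 1 * flat_exp 0 (1 - s / real (Suc n))) \<longlonglongrightarrow> exp 1 * flat_exp 0 1"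
    by (intro tendsto_intros)
  then show ?thesis
    by (simp add: cutoff_def flat_exp_def flip: exp_add)
qed

text \<open>The factor p will be |y|^2 for the fourth moment and 1 for the mean of the
  kernel.\<close>

lemma test_function_cutoff:
  fixes p :: "real^'n \<Rightarrow> real"
  assumes "\<And>k. C_k k p" and "R > 0"
  shows "test_function (\<lambda>y. (p y * cutoff R (y \<bullet> y)) *\<^sub>R (A *v y) :: real^'m)"
proof -
  have y: "C_k k (\<lambda>y::real^'n. y)" for k
    by (rule C_k_bounded_linear[OF bounded_linear_ident])
  have "C_k k (\<lambda>y::real^'n. 1 + (- (1 / R)) * (y \<bullet> y))" for k
    by (intro C_k_add C_k_const bounded_bilinear.C_k[OF bounded_bilinear_mult]
        bounded_bilinear.C_k[OF bounded_bilinear_inner] y)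
  then have "C_k k (\<lambda>y::real^'n. exp 1 * flat_exp 0 (1 + (- (1 / R)) * (y \<bullet> y)))" for k
    by (intro bounded_bilinear.C_k[OF bounded_bilinear_mult] C_k_const C_k_flat_exp)
  then have "C_k k (\<lambda>y::real^'n. cutoff R (y \<bullet> y))" for k
    by (simp add: cutoff_def)
  then have "smooth (\<lambda>y. (p y * cutoff R (y \<bullet> y)) *\<^sub>R (A *v y))"
    unfolding smooth_def
    by (intro allI bounded_bilinear.C_k[OF bounded_bilinear_scaleR]
        bounded_bilinear.C_k[OF bounded_bilinear_mult] assms(1)
        C_k_bounded_linear[OF matrix_vector_mul_bounded_linear])
  moreover have "{y. (p y * cutoff R (y \<bullet> y)) *\<^sub>R (A *v y) \<noteq> 0} \<subseteq> cball 0 (sqrt R)"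
    using cutoff_bounds(5)[OF assms(2)]
    by (auto simp: norm_eq_sqrt_inner) (meson linorder_le_cases)
  then have "compact (closure {y. (p y * cutoff R (y \<bullet> y)) *\<^sub>R (A *v y) \<noteq> 0})"
    using bounded_cball bounded_subset compact_closure by blast
  ultimately show ?thesis
    by (simp add: test_function_def)
qed

section \<open>Moments of Stein kernels\<close>

lemma inner_matrix_rank_one:
  fixes T :: "real^'n^'n" and u v :: "real^'n"
  shows "T \<bullet> (\<chi> i j. u $ i * v $ j) = u \<bullet> (T *v v)"
  by (simp add: inner_vec_def matrix_vector_mult_def sum_distrib_left mult.assoc mult.left_commute)

lemma norm_rank_one:
  fixes u v :: "real^'n"
  shows "norm (\<chi> i j. u $ i * v $ j) = norm u * norm v"
proof -
  have "(norm (\<chi> i j. u $ i * v $ j))\<^sup>2 = (norm u)\<^sup>2 * (norm v)\<^sup>2"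
    by (simp add: power2_norm_eq_inner inner_vec_def sum_product mult_ac)
  then show ?thesis
    by (metis norm_ge_zero power_mult_distrib power2_eq_imp_eq zero_le_mult_iff)
qed

lemma abs_inner_matrix_vector_le:
  fixes T :: "real^'n^'n" and u v :: "real^'n"
  shows "\<bar>u \<bullet> (T *v v)\<bar> \<le> norm T * (norm u * norm v)"
  using Cauchy_Schwarz_ineq2[of T "\<chi> i j. u $ i * v $ j"]
  by (simp add: inner_matrix_rank_one norm_rank_one)

lemma norm_matrix_vector_mult_le:
  fixes A :: "real^'n^'n"
  shows "norm (A *v v) \<le> norm A * norm v"
proof (cases "A *v v = 0")
  case False
  have "norm (A *v v) * norm (A *v v) \<le> norm A * (norm (A *v v) * norm v)"
    using abs_inner_matrix_vector_le[of "A *v v" A v] by (simp flip: power2_eq_square power2_norm_eq_inner)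
  then show ?thesis using False by (simp add: mult.left_commute)
qed simp

text \<open>The chain rule gives a multiple of A plus a rank one matrix. For A = 1 the rank one part
  pairs with T to the quadratic form of T at y, whose sign is known for semidefinite T.\<close>

lemma inner_jacobian_radial:
  fixes A :: "real^'n^'n"
  assumes "(h has_real_derivative h') (at (y \<bullet> y))"
  shows "T \<bullet> jacobian (\<lambda>y. h (y \<bullet> y) *\<^sub>R (A *v y)) (at y)
    = h (y \<bullet> y) * (T \<bullet> A) + 2 * h' * ((A *v y) \<bullet> (T *v y))"
proof -
  let ?D = "\<lambda>v. h (y \<bullet> y) *\<^sub>R (A *v v) + (h' * (2 * (y \<bullet> v))) *\<^sub>R (A *v y)"
  have "((\<lambda>y. y \<bullet> y) has_derivative (\<lambda>v. 2 * (y \<bullet> v))) (at y)"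
    by (auto intro!: derivative_eq_intros simp: inner_commute)
  from has_derivative_compose[OF this assms[unfolded has_field_derivative_def]]
  have "((\<lambda>y. h (y \<bullet> y)) has_derivative (\<lambda>v. h' * (2 * (y \<bullet> v)))) (at y)"
    by simp
  moreover have "((\<lambda>y. A *v y) has_derivative (\<lambda>v. A *v v)) (at y)"
    by (rule bounded_linear_imp_has_derivative[OF matrix_vector_mul_bounded_linear])
  ultimately have "((\<lambda>y. h (y \<bullet> y) *\<^sub>R (A *v y)) has_derivative ?D) (at y)"
    by (rule has_derivative_scaleR)
  then have "jacobian (\<lambda>y. h (y \<bullet> y) *\<^sub>R (A *v y)) (at y) = matrix ?D"
    by (simp add: jacobian_def frechet_derivative_at[symmetric])
  also have "\<dots> = h (y \<bullet> y) *\<^sub>R A + (2 * h') *\<^sub>R (\<chi> i j. (A *v y) $ i * y $ j)"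
    by (simp add: matrix_def vec_eq_iff matrix_vector_mul_component inner_axis)
  finally show ?thesis
    by (simp add: inner_add_right inner_matrix_rank_one)
qed

lemma borel_measurable_cutoff [measurable]: "cutoff R \<in> borel_measurable borel"
  by (intro borel_measurable_continuous_onI continuous_at_imp_continuous_on ballI
      DERIV_isCont[OF cutoff_has_derivative])

text \<open>Testing against \<open>|y|\<^sup>2 y\<close>: the derivative of the cutoff has the favourable sign because the
  kernel is positive semidefinite, and the remaining terms are absorbed by Young's inequality.\<close>

lemma stein_fourth_moment:
  fixes M :: "(real^'n) measure"
  assumes "borel_prob M" and K: "sym_psd_stein_kernel M \<tau>"
    and C: "(\<integral>\<^sup>+ y. ennreal ((norm (\<tau> y))\<^sup>2) \<partial>M) \<le> ennreal C" "0 \<le> C"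
  shows "(\<integral>\<^sup>+ y. ennreal (norm y ^ 4) \<partial>M) \<le> ennreal ((norm (mat 1 :: real^'n^'n) + 2)\<^sup>2 * C)"
proof -
  interpret prob_space M using assms by (simp add: borel_prob_def)
  have sets[measurable_cong]: "sets M = sets borel" using assms by (simp add: borel_prob_def)
  have m[measurable]: "\<tau> \<in> borel_measurable M"
    using K by (simp add: sym_psd_stein_kernel_def stein_kernel_def measurable_cong_sets[OF sets refl])
  \<comment> \<open>The norm of the identity bounds the trace of \<tau>; the summand 2 comes from
    differentiating |y|^2.\<close>
  define c where "c = norm (mat 1 :: real^'n^'n) + 2"
  have c: "c > 0" by (simp add: c_def add_nonneg_pos)
  have int2: "integrable M (\<lambda>y. (norm (\<tau> y))\<^sup>2)"
    using C(1) by (intro integrableI_bounded) (auto simp: order_le_less_trans)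
  have int2_le: "(\<integral>y. (norm (\<tau> y))\<^sup>2 \<partial>M) \<le> C"
    using C by (simp add: nn_integral_eq_integral[OF int2])
  have bound: "(\<integral>\<^sup>+ y. ennreal (norm y ^ 4 * cutoff R (y \<bullet> y)) \<partial>M) \<le> ennreal (c\<^sup>2 * C)"
    if R: "R > 0" for R
  proof -
    let ?\<chi> = "\<lambda>y::real^'n. cutoff R (y \<bullet> y)"
    define \<Phi> where "\<Phi> = (\<lambda>y::real^'n. ((y \<bullet> y) * ?\<chi> y) *\<^sub>R (mat 1 *v y))"
    have "C_k k (\<lambda>y::real^'n. y \<bullet> y)" for k
      by (intro bounded_bilinear.C_k[OF bounded_bilinear_inner]
          C_k_bounded_linear[OF bounded_linear_ident])
    then have "test_function \<Phi>"
      unfolding \<Phi>_def by (rule test_function_cutoff[OF _ R])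
    then have st: "integrable M (\<lambda>y. y \<bullet> \<Phi> y)"
      "integrable M (\<lambda>y. \<tau> y \<bullet> jacobian \<Phi> (at y))"
      "(\<integral>y. y \<bullet> \<Phi> y \<partial>M) = (\<integral>y. \<tau> y \<bullet> jacobian \<Phi> (at y) \<partial>M)"
      using K by (auto simp: sym_psd_stein_kernel_def stein_kernel_def hs_inner_eq_inner)
    have y\<Phi>: "y \<bullet> \<Phi> y = norm y ^ 4 * ?\<chi> y" for y
      by (simp add: \<Phi>_def flip: power2_norm_eq_inner)
    have le: "\<tau> y \<bullet> jacobian \<Phi> (at y) \<le> norm y ^ 4 * ?\<chi> y / 2 + c\<^sup>2 * (norm (\<tau> y))\<^sup>2 / 2" for y
    proof -
      let ?s = "y \<bullet> y"
      have s: "?s = (norm y)\<^sup>2" by (simp add: power2_norm_eq_inner)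
      have \<chi>: "0 \<le> ?\<chi> y" "?\<chi> y \<le> 1" using cutoff_bounds[OF R] by auto
      have psd: "0 \<le> y \<bullet> (\<tau> y *v y)"
        using K by (simp add: sym_psd_stein_kernel_def sym_psd_def)
      have "((\<lambda>s. s * cutoff R s) has_real_derivative (?\<chi> y + ?s * cutoff' R ?s)) (at ?s)"
        by (auto intro!: derivative_eq_intros cutoff_has_derivative)
      from inner_jacobian_radial[OF this, of "\<tau> y" "mat 1"]
      have "\<tau> y \<bullet> jacobian \<Phi> (at y)
        = ?s * ?\<chi> y * (\<tau> y \<bullet> mat 1) + 2 * (?\<chi> y + ?s * cutoff' R ?s) * (y \<bullet> (\<tau> y *v y))"
        by (simp add: \<Phi>_def)
      also have "\<dots> \<le> ?s * ?\<chi> y * (norm (\<tau> y) * norm (mat 1 :: real^'n^'n))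
          + 2 * ?\<chi> y * (norm (\<tau> y) * ?s)"
      proof (intro add_mono)
        show "?s * ?\<chi> y * (\<tau> y \<bullet> mat 1) \<le> ?s * ?\<chi> y * (norm (\<tau> y) * norm (mat 1 :: real^'n^'n))"
          using \<chi> by (intro mult_left_mono norm_cauchy_schwarz) auto
        have "?s * cutoff' R ?s \<le> 0"
          using cutoff_bounds(3)[OF R] by (simp add: mult_nonneg_nonpos)
        then have "2 * (?\<chi> y + ?s * cutoff' R ?s) * (y \<bullet> (\<tau> y *v y))
            \<le> 2 * ?\<chi> y * (y \<bullet> (\<tau> y *v y))"
          using psd by (intro mult_right_mono) auto
        also have "\<dots> \<le> 2 * ?\<chi> y * (norm (\<tau> y) * ?s)"
          using abs_inner_matrix_vector_le[of y "\<tau> y" y] \<chi>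
          by (intro mult_left_mono) (auto simp: s power2_eq_square)
        finally show "2 * (?\<chi> y + ?s * cutoff' R ?s) * (y \<bullet> (\<tau> y *v y))
            \<le> 2 * ?\<chi> y * (norm (\<tau> y) * ?s)" .
      qed
      also have "\<dots> = ?\<chi> y * (?s * (c * norm (\<tau> y)))"
        by (simp add: c_def algebra_simps)
      also have "\<dots> \<le> ?\<chi> y * (?s\<^sup>2 / 2 + (c * norm (\<tau> y))\<^sup>2 / 2)"
        using \<chi> sum_squares_bound[of ?s "c * norm (\<tau> y)"] by (intro mult_left_mono) auto
      also have "\<dots> = norm y ^ 4 * ?\<chi> y / 2 + ?\<chi> y * (c\<^sup>2 * (norm (\<tau> y))\<^sup>2 / 2)"
        by (simp add: s algebra_simps power_mult_distrib)
      also have "\<dots> \<le> norm y ^ 4 * ?\<chi> y / 2 + c\<^sup>2 * (norm (\<tau> y))\<^sup>2 / 2"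
        using \<chi> mult_right_mono[OF \<chi>(2), of "c\<^sup>2 * (norm (\<tau> y))\<^sup>2 / 2"] by simp
      finally show ?thesis .
    qed
    \<comment> \<open>The compact support of the cutoff makes this integral finite before any moment
      bound is known, which allows half of it to be subtracted from both sides.\<close>
    have i4: "integrable M (\<lambda>y. norm y ^ 4 * ?\<chi> y)"
      using st(1) by (simp add: y\<Phi>)
    have "(\<integral>y. norm y ^ 4 * ?\<chi> y \<partial>M)
        \<le> (\<integral>y. norm y ^ 4 * ?\<chi> y / 2 + c\<^sup>2 * (norm (\<tau> y))\<^sup>2 / 2 \<partial>M)"
      using st(2,3) le i4 int2 unfolding y\<Phi>
      by (simp only: ) (intro integral_mono, auto)
    also have "\<dots> = (\<integral>y. norm y ^ 4 * ?\<chi> y \<partial>M) / 2 + c\<^sup>2 * (\<integral>y. (norm (\<tau> y))\<^sup>2 \<partial>M) / 2"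
      using i4 int2 by simp
    finally have "(\<integral>y. norm y ^ 4 * ?\<chi> y \<partial>M) \<le> c\<^sup>2 * (\<integral>y. (norm (\<tau> y))\<^sup>2 \<partial>M)"
      by simp
    also have "\<dots> \<le> c\<^sup>2 * C" by (intro mult_left_mono int2_le) auto
    finally show ?thesis
      using i4 cutoff_bounds(1)[OF R] by (subst nn_integral_eq_integral) (auto intro!: ennreal_leI)
  qed
  \<comment> \<open>The bound is uniform in R, so Fatou's lemma removes the cutoff.\<close>
  have "(\<lambda>n. norm y ^ 4 * cutoff (real (Suc n)) (y \<bullet> y)) \<longlonglongrightarrow> norm y ^ 4 * 1" for y :: "real^'n"
    by (intro tendsto_intros cutoff_tendsto_1)
  then have "(\<lambda>n. ennreal (norm y ^ 4 * cutoff (real (Suc n)) (y \<bullet> y))) \<longlonglongrightarrow> ennreal (norm y ^ 4)"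
    for y :: "real^'n"
    by (intro tendsto_ennrealI) simp
  then have "(\<integral>\<^sup>+ y. ennreal (norm y ^ 4) \<partial>M)
      = (\<integral>\<^sup>+ y. liminf (\<lambda>n. ennreal (norm y ^ 4 * cutoff (real (Suc n)) (y \<bullet> y))) \<partial>M)"
    by (intro nn_integral_cong lim_imp_Liminf[symmetric]) auto
  also have "\<dots> \<le> liminf (\<lambda>n. \<integral>\<^sup>+ y. ennreal (norm y ^ 4 * cutoff (real (Suc n)) (y \<bullet> y)) \<partial>M)"
    by (rule nn_integral_liminf) measurable
  also have "\<dots> \<le> ennreal (c\<^sup>2 * C)"
    by (intro Liminf_le always_eventually allI bound) auto
  finally show ?thesis by (simp add: c_def)
qed


lemma le_one_plus_square: "t \<le> 1 + t\<^sup>2" for t :: real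
  using zero_le_power2[of "t - 1 / 2"] by (simp add: power2_eq_square algebra_simps)

text \<open>The square (s a - b)^2 is nonnegative. The weight is used to make the factor with
  bounded moments cost little, while 1/s falls on the factor that is going to vanish.\<close>

lemma young_weighted:
  fixes a b s :: real
  assumes "0 < s" "0 \<le> a" "0 \<le> b"
  shows "a * b \<le> s * a\<^sup>2 + b\<^sup>2 / s"
proof -
  have "0 \<le> (s * a - b)\<^sup>2 / s + a * b" using assms by simp
  also have "\<dots> = s * a\<^sup>2 + b\<^sup>2 / s - a * b"
    using assms by (simp add: power2_eq_square field_simps)
  finally show ?thesis by simp
qed

lemma integrable_of_moments:
  fixes M :: "'a::euclidean_space measure" and \<tau> :: "'a \<Rightarrow> 'b::euclidean_space"
  assumes "borel_prob M"
  shows "(\<integral>\<^sup>+ y. ennreal (norm y ^ 4) \<partial>M) \<le> ennreal C \<Longrightarrow> integrable M (\<lambda>y. norm y ^ 4)"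
    and "(\<integral>\<^sup>+ y. ennreal (norm y ^ 4) \<partial>M) \<le> ennreal C \<Longrightarrow> integrable M (\<lambda>y. (norm y)\<^sup>2)"
    and "\<tau> \<in> borel_measurable borel \<Longrightarrow> (\<integral>\<^sup>+ y. ennreal ((norm (\<tau> y))\<^sup>2) \<partial>M) \<le> ennreal C
      \<Longrightarrow> integrable M (\<lambda>y. (norm (\<tau> y))\<^sup>2)"
    and "\<tau> \<in> borel_measurable borel \<Longrightarrow> (\<integral>\<^sup>+ y. ennreal ((norm (\<tau> y))\<^sup>2) \<partial>M) \<le> ennreal C
      \<Longrightarrow> integrable M \<tau>"
proof -
  interpret prob_space M using assms by (simp add: borel_prob_def)
  have sets[measurable_cong]: "sets M = sets borel" using assms by (simp add: borel_prob_def)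
  show i4: "integrable M (\<lambda>y. norm y ^ 4)" if "(\<integral>\<^sup>+ y. ennreal (norm y ^ 4) \<partial>M) \<le> ennreal C"
    using that by (intro integrableI_bounded) (auto simp: order_le_less_trans)
  show "integrable M (\<lambda>y. (norm y)\<^sup>2)" if "(\<integral>\<^sup>+ y. ennreal (norm y ^ 4) \<partial>M) \<le> ennreal C"
    by (rule Bochner_Integration.integrable_bound[of _ "\<lambda>y. 1 + norm y ^ 4"])
      (use i4[OF that] le_one_plus_square[of "(norm _)\<^sup>2"] in auto)
  show i2: "integrable M (\<lambda>y. (norm (\<tau> y))\<^sup>2)" if [measurable]: "\<tau> \<in> borel_measurable borel"
    and "(\<integral>\<^sup>+ y. ennreal ((norm (\<tau> y))\<^sup>2) \<partial>M) \<le> ennreal C"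
    using that(2) by (intro integrableI_bounded) (auto simp: order_le_less_trans)
  show "integrable M \<tau>" if [measurable]: "\<tau> \<in> borel_measurable borel"
    and "(\<integral>\<^sup>+ y. ennreal ((norm (\<tau> y))\<^sup>2) \<partial>M) \<le> ennreal C"
    by (rule Bochner_Integration.integrable_bound[of _ "\<lambda>y. 1 + (norm (\<tau> y))\<^sup>2"])
      (use i2[OF that] le_one_plus_square[of "norm (\<tau> _)"] in auto)
qed

text \<open>The linear field y \<mapsto> A y, cut off, is the test field. The derivative of the
  cutoff is O(1/R) and multiplies at most |A| |\<tau>| |y|^2, which is integrable because |\<tau>|^2
  and |y|^4 are; hence this term disappears by dominated convergence.\<close>

lemma stein_kernel_mean:
  fixes M :: "(real^'n) measure"
  assumes M: "borel_prob M" and K: "stein_kernel M \<tau>"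
    and C: "(\<integral>\<^sup>+ y. ennreal ((norm (\<tau> y))\<^sup>2) \<partial>M) \<le> ennreal C"
    and D: "(\<integral>\<^sup>+ y. ennreal (norm y ^ 4) \<partial>M) \<le> ennreal D"
  shows "(\<integral>y. \<tau> y \<bullet> A \<partial>M) = (\<integral>y. y \<bullet> (A *v y) \<partial>M)"
proof -
  interpret prob_space M using assms by (simp add: borel_prob_def)
  have sets[measurable_cong]: "sets M = sets borel" using assms by (simp add: borel_prob_def)
  have m[measurable]: "\<tau> \<in> borel_measurable borel"
    using K by (simp add: stein_kernel_def)
  have i4: "integrable M (\<lambda>y. norm y ^ 4)" and iy: "integrable M (\<lambda>y. (norm y)\<^sup>2)"
    using integrable_of_moments(1,2)[OF M D] by auto
  have i2: "integrable M (\<lambda>y. (norm (\<tau> y))\<^sup>2)" and i1: "integrable M \<tau>"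
    using integrable_of_moments(3,4)[OF M m C] by auto
  define R where "R n = real (Suc n)" for n
  have R: "R n > 0" "R n \<ge> 1" for n by (auto simp: R_def)
  define \<Phi> where "\<Phi> n = (\<lambda>y::real^'n. (1 * cutoff (R n) (y \<bullet> y)) *\<^sub>R (A *v y))" for n
  have "test_function (\<Phi> n)" for n
    unfolding \<Phi>_def by (rule test_function_cutoff[OF C_k_const R(1)])
  then have st: "integrable M (\<lambda>y. y \<bullet> \<Phi> n y)"
      "integrable M (\<lambda>y. \<tau> y \<bullet> jacobian (\<Phi> n) (at y))"
      "(\<integral>y. y \<bullet> \<Phi> n y \<partial>M) = (\<integral>y. \<tau> y \<bullet> jacobian (\<Phi> n) (at y) \<partial>M)" for n
    using K by (auto simp: stein_kernel_def hs_inner_eq_inner)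
  have J: "\<tau> y \<bullet> jacobian (\<Phi> n) (at y)
      = cutoff (R n) (y \<bullet> y) * (\<tau> y \<bullet> A) + 2 * cutoff' (R n) (y \<bullet> y) * ((A *v y) \<bullet> (\<tau> y *v y))" for n y
    using inner_jacobian_radial[OF cutoff_has_derivative, of "\<tau> y" "R n" A y]
    by (simp add: \<Phi>_def)
  have \<chi>: "0 \<le> cutoff (R n) (y \<bullet> y)" "cutoff (R n) (y \<bullet> y) \<le> 1" for n and y :: "real^'n"
    using cutoff_bounds(1,2)[OF R(1)[of n]] by auto
  have lim: "(\<lambda>n. cutoff (R n) (y \<bullet> y)) \<longlonglongrightarrow> 1" for y :: "real^'n"
    unfolding R_def by (rule cutoff_tendsto_1)
  have b: "\<bar>(A *v y) \<bullet> (\<tau> y *v y)\<bar> \<le> norm A * (norm y ^ 4 + (norm (\<tau> y))\<^sup>2)" for y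
  proof -
    have "\<bar>(A *v y) \<bullet> (\<tau> y *v y)\<bar> \<le> norm (\<tau> y) * (norm (A *v y) * norm y)"
      by (rule abs_inner_matrix_vector_le)
    also have "\<dots> \<le> norm (\<tau> y) * ((norm A * norm y) * norm y)"
      by (intro mult_left_mono mult_right_mono norm_matrix_vector_mult_le) auto
    also have "\<dots> = norm A * (norm (\<tau> y) * (norm y)\<^sup>2)"
      by (simp add: power2_eq_square)
    also have "\<dots> \<le> norm A * (norm y ^ 4 + (norm (\<tau> y))\<^sup>2)"
    proof (intro mult_left_mono)
      have "2 * norm (\<tau> y) * (norm y)\<^sup>2 \<le> (norm (\<tau> y))\<^sup>2 + ((norm y)\<^sup>2)\<^sup>2"
        by (rule sum_squares_bound)
      moreover have "0 \<le> norm (\<tau> y) * (norm y)\<^sup>2" "((norm y)\<^sup>2)\<^sup>2 = norm y ^ 4" by simp_all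
      ultimately show "norm (\<tau> y) * (norm y)\<^sup>2 \<le> norm y ^ 4 + (norm (\<tau> y))\<^sup>2"
        by linarith
    qed simp
    finally show ?thesis .
  qed
  have lim_J: "(\<lambda>n. \<tau> y \<bullet> jacobian (\<Phi> n) (at y)) \<longlonglongrightarrow> \<tau> y \<bullet> A" for y
  proof -
    have "(\<lambda>n. 2 * exp 1 / R n) \<longlonglongrightarrow> 0"
      unfolding R_def by (intro LIMSEQ_Suc lim_const_over_n)
    then have "(\<lambda>n. cutoff' (R n) (y \<bullet> y)) \<longlonglongrightarrow> 0"
      by (rule Lim_null_comparison[rotated])
        (use cutoff_bounds(4)[OF R(1)] in \<open>auto intro!: always_eventually\<close>)
    from tendsto_add[OF tendsto_mult_right[OF lim[of y], of "\<tau> y \<bullet> A"]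
        tendsto_mult_right[OF tendsto_mult_left[OF this, of 2], of "(A *v y) \<bullet> (\<tau> y *v y)"]]
    show ?thesis by (simp add: J)
  qed
  have bound_J: "\<bar>\<tau> y \<bullet> jacobian (\<Phi> n) (at y)\<bar>
      \<le> norm (\<tau> y) * norm A + 4 * exp 1 * (norm A * (norm y ^ 4 + (norm (\<tau> y))\<^sup>2))" for n y
  proof -
    have "\<bar>cutoff (R n) (y \<bullet> y) * (\<tau> y \<bullet> A)\<bar> \<le> 1 * (norm (\<tau> y) * norm A)"
      unfolding abs_mult using \<chi>[of n y] by (intro mult_mono Cauchy_Schwarz_ineq2) auto
    moreover have "\<bar>cutoff' (R n) (y \<bullet> y)\<bar> \<le> 2 * exp 1"
    proof -
      have "\<bar>cutoff' (R n) (y \<bullet> y)\<bar> \<le> 2 * exp 1 / R n" by (rule cutoff_bounds(4)[OF R(1)])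
      also have "\<dots> \<le> 2 * exp 1" using R(2)[of n] by (simp add: field_simps)
      finally show ?thesis .
    qed
    then have "\<bar>2 * cutoff' (R n) (y \<bullet> y) * ((A *v y) \<bullet> (\<tau> y *v y))\<bar>
        \<le> (4 * exp 1) * (norm A * (norm y ^ 4 + (norm (\<tau> y))\<^sup>2))"
      unfolding abs_mult[of "2 * _"] by (intro mult_mono b) (auto simp: abs_mult)
    ultimately show ?thesis unfolding J by linarith
  qed
  have "(\<lambda>n. \<integral>y. \<tau> y \<bullet> jacobian (\<Phi> n) (at y) \<partial>M) \<longlonglongrightarrow> (\<integral>y. \<tau> y \<bullet> A \<partial>M)"
    by (rule integral_dominated_convergence[where
          w = "\<lambda>y. norm (\<tau> y) * norm A + 4 * exp 1 * (norm A * (norm y ^ 4 + (norm (\<tau> y))\<^sup>2))"])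
      (use i1 i2 i4 lim_J bound_J borel_measurable_integrable[OF st(2)] in auto)
  moreover have "(\<lambda>n. \<integral>y. y \<bullet> \<Phi> n y \<partial>M) \<longlonglongrightarrow> (\<integral>y. y \<bullet> (A *v y) \<partial>M)"
  proof (rule integral_dominated_convergence[where w = "\<lambda>y. norm A * (norm y)\<^sup>2"])
    have "(\<lambda>n. cutoff (R n) (y \<bullet> y) * (y \<bullet> (A *v y))) \<longlonglongrightarrow> 1 * (y \<bullet> (A *v y))" for y
      by (intro tendsto_mult_right lim)
    then show "AE y in M. (\<lambda>n. y \<bullet> \<Phi> n y) \<longlonglongrightarrow> y \<bullet> (A *v y)"
      by (simp add: \<Phi>_def)
    have "\<bar>cutoff (R n) (y \<bullet> y) * (y \<bullet> (A *v y))\<bar> \<le> 1 * (norm A * (norm y * norm y))" for n y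
      unfolding abs_mult using \<chi>[of n y] by (intro mult_mono abs_inner_matrix_vector_le) auto
    then show "AE y in M. norm (y \<bullet> \<Phi> n y) \<le> norm A * (norm y)\<^sup>2" for n
      by (simp add: \<Phi>_def power2_eq_square)
    have "(\<lambda>y. A *v y) \<in> borel_measurable borel"
      by (intro borel_measurable_continuous_onI linear_continuous_on matrix_vector_mul_bounded_linear)
    then show "(\<lambda>y. y \<bullet> (A *v y)) \<in> borel_measurable M" by measurable
  qed (use iy borel_measurable_integrable[OF st(1)] in auto)
  ultimately show ?thesis
    using st(3) LIMSEQ_unique by simp
qed

section \<open>Couplings with a density\<close>

text \<open>A density with respect to \<open>M \<Otimes>\<^sub>M N\<close>. The marginal conditions
  hold at every point and not only almost everywhere, so fixing either variable leaves a genuine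
  probability density; boundedness makes every integrable function integrable against each of these
  densities.\<close>

definition coupling_density ::
  "'a::euclidean_space measure \<Rightarrow> 'a measure \<Rightarrow> ('a \<Rightarrow> 'a \<Rightarrow> real) \<Rightarrow> bool" where
  "coupling_density M N w \<longleftrightarrow>
     (\<lambda>z. w (fst z) (snd z)) \<in> borel_measurable borel \<and>
     (\<forall>x y. 0 \<le> w x y) \<and> (\<exists>B. \<forall>x y. w x y \<le> B) \<and>
     (\<forall>x. (\<integral>\<^sup>+ y. ennreal (w x y) \<partial>N) = 1) \<and> (\<forall>y. (\<integral>\<^sup>+ x. ennreal (w x y) \<partial>M) = 1)"

definition coupling_measure ::
  "'a::euclidean_space measure \<Rightarrow> 'a measure \<Rightarrow> ('a \<Rightarrow> 'a \<Rightarrow> real) \<Rightarrow> ('a \<times> 'a) measure" where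
  "coupling_measure M N w = density (M \<Otimes>\<^sub>M N) (\<lambda>z. ennreal (w (fst z) (snd z)))"

definition transport_cost ::
  "'a::euclidean_space measure \<Rightarrow> 'a measure \<Rightarrow> ('a \<Rightarrow> 'a \<Rightarrow> real) \<Rightarrow> ennreal" where
  "transport_cost M N w = (\<integral>\<^sup>+ z. ennreal ((norm (fst z - snd z))\<^sup>2) \<partial>coupling_measure M N w)"

locale coupling =
  fixes M N :: "'a::euclidean_space measure" and w :: "'a \<Rightarrow> 'a \<Rightarrow> real"
  assumes M: "borel_prob M" and N: "borel_prob N" and w: "coupling_density M N w"
begin

sublocale M: prob_space M using M by (simp add: borel_prob_def)
sublocale N: prob_space N using N by (simp add: borel_prob_def)
sublocale MN: pair_prob_space M N ..

lemma sets_M [measurable_cong]: "sets M = sets borel" using M by (simp add: borel_prob_def)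
lemma sets_N [measurable_cong]: "sets N = sets borel" using N by (simp add: borel_prob_def)

lemma space_M [simp]: "space M = UNIV" using sets_eq_imp_space_eq[OF sets_M] by simp
lemma space_N [simp]: "space N = UNIV" using sets_eq_imp_space_eq[OF sets_N] by simp

lemma sets_MN: "sets (M \<Otimes>\<^sub>M N) = sets borel"
  by (simp add: borel_prod[symmetric] sets_M sets_N cong: sets_pair_measure_cong)

abbreviation "P \<equiv> coupling_measure M N w"

lemma sets_coupling_measure [measurable_cong]: "sets (P) = sets borel"
  by (simp add: coupling_measure_def sets_MN)

lemma w_measurable [measurable]: "(\<lambda>z. w (fst z) (snd z)) \<in> borel_measurable borel"
  using w by (simp add: coupling_density_def)

lemma w_measurable_fst [measurable]: "(\<lambda>x. w x y) \<in> borel_measurable borel"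
  using measurable_compose[OF _ w_measurable, of "\<lambda>x. (x, y)" borel] by (simp add: borel_prod[symmetric])

lemma w_measurable_snd [measurable]: "w x \<in> borel_measurable borel"
  using measurable_compose[OF _ w_measurable, of "\<lambda>y. (x, y)" borel] by (simp add: borel_prod[symmetric])

lemma w_nonneg: "0 \<le> w x y" using w by (simp add: coupling_density_def)
lemma w_fst: "(\<integral>\<^sup>+ x. ennreal (w x y) \<partial>M) = 1" using w by (simp add: coupling_density_def)
lemma w_snd: "(\<integral>\<^sup>+ y. ennreal (w x y) \<partial>N) = 1" using w by (simp add: coupling_density_def)

lemma nn_integral_coupling_measure:
  assumes [measurable]: "f \<in> borel_measurable borel"
  shows "(\<integral>\<^sup>+ z. f z \<partial>P) = (\<integral>\<^sup>+ x. \<integral>\<^sup>+ y. ennreal (w x y) * f (x, y) \<partial>N \<partial>M)"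
    and "(\<integral>\<^sup>+ z. f z \<partial>P) = (\<integral>\<^sup>+ y. \<integral>\<^sup>+ x. ennreal (w x y) * f (x, y) \<partial>M \<partial>N)"
proof -
  have [measurable]: "f \<in> borel_measurable (M \<Otimes>\<^sub>M N)"
    "(\<lambda>z. w (fst z) (snd z)) \<in> borel_measurable (M \<Otimes>\<^sub>M N)"
    unfolding measurable_cong_sets[OF sets_MN refl] by measurable
  have "(\<integral>\<^sup>+ z. f z \<partial>P)
      = (\<integral>\<^sup>+ z. ennreal (w (fst z) (snd z)) * f z \<partial>(M \<Otimes>\<^sub>M N))"
    unfolding coupling_measure_def by (rule nn_integral_density) measurable
  then show "(\<integral>\<^sup>+ z. f z \<partial>P)
        = (\<integral>\<^sup>+ x. \<integral>\<^sup>+ y. ennreal (w x y) * f (x, y) \<partial>N \<partial>M)"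
    and "(\<integral>\<^sup>+ z. f z \<partial>P)
        = (\<integral>\<^sup>+ y. \<integral>\<^sup>+ x. ennreal (w x y) * f (x, y) \<partial>M \<partial>N)"
    using N.nn_integral_fst[of "\<lambda>z. ennreal (w (fst z) (snd z)) * f z" M]
      MN.nn_integral_snd[of "\<lambda>z. ennreal (w (fst z) (snd z)) * f z"]
    by simp_all
qed

lemma distr_fst: "distr (P) borel fst = M"
proof (rule measure_eqI)
  fix A assume "A \<in> sets (distr (P) borel fst)"
  then have A[measurable]: "A \<in> sets borel" by simp
  have [measurable]: "fst \<in> borel_measurable (borel :: ('a \<times> 'a) measure)"
    by (simp add: borel_prod[symmetric])
  have "emeasure (distr (P) borel fst) A
      = (\<integral>\<^sup>+ z. indicator A (fst z) \<partial>P)"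
    by (subst nn_integral_distr[symmetric, of fst _ borel "indicator A"]) auto
  also have "\<dots> = (\<integral>\<^sup>+ x. (\<integral>\<^sup>+ y. ennreal (w x y) \<partial>N) * indicator A x \<partial>M)"
    by (subst nn_integral_coupling_measure(1)) (auto intro!: nn_integral_cong nn_integral_multc)
  also have "\<dots> = emeasure M A"
    by (simp add: w_snd)
  finally show "emeasure (distr (P) borel fst) A = emeasure M A" .
qed (simp add: sets_M)

lemma distr_snd: "distr (P) borel snd = N"
proof (rule measure_eqI)
  fix A assume "A \<in> sets (distr (P) borel snd)"
  then have A[measurable]: "A \<in> sets borel" by simp
  have [measurable]: "snd \<in> borel_measurable (borel :: ('a \<times> 'a) measure)"
    by (simp add: borel_prod[symmetric])
  have "emeasure (distr (P) borel snd) A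
      = (\<integral>\<^sup>+ z. indicator A (snd z) \<partial>P)"
    by (subst nn_integral_distr[symmetric, of snd _ borel "indicator A"]) auto
  also have "\<dots> = (\<integral>\<^sup>+ y. (\<integral>\<^sup>+ x. ennreal (w x y) \<partial>M) * indicator A y \<partial>N)"
    by (subst nn_integral_coupling_measure(2)) (auto intro!: nn_integral_cong nn_integral_multc)
  also have "\<dots> = emeasure N A"
    by (simp add: w_fst)
  finally show "emeasure (distr (P) borel snd) A = emeasure N A" .
qed (simp add: sets_N)

lemma measurable_fst_coupling [measurable]: "fst \<in> borel_measurable (P)"
  and measurable_snd_coupling [measurable]: "snd \<in> borel_measurable (P)"
  unfolding measurable_cong_sets[OF sets_coupling_measure refl] by (simp_all add: borel_prod[symmetric])

lemma nn_integral_coupling_fst: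
  "f \<in> borel_measurable borel \<Longrightarrow> (\<integral>\<^sup>+ z. f (fst z) \<partial>P) = (\<integral>\<^sup>+ x. f x \<partial>M)"
  by (subst (2) distr_fst[symmetric], subst nn_integral_distr) auto

lemma nn_integral_coupling_snd:
  "f \<in> borel_measurable borel \<Longrightarrow> (\<integral>\<^sup>+ z. f (snd z) \<partial>P) = (\<integral>\<^sup>+ y. f y \<partial>N)"
  by (subst (2) distr_snd[symmetric], subst nn_integral_distr) auto

lemma prob_space_coupling: "prob_space (P)"
  by (rule prob_spaceI)
    (use nn_integral_coupling_fst[of "\<lambda>_. 1"] in \<open>simp add: M.emeasure_space_1[simplified]\<close>)

lemma integrable_coupling_fst:
  fixes f :: "'a \<Rightarrow> 'c::{banach, second_countable_topology}"
  shows "integrable M f \<Longrightarrow> integrable (P) (\<lambda>z. f (fst z))"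
  using integrable_distr[of fst P borel f] by (simp add: distr_fst)

lemma integral_coupling_fst:
  fixes f :: "'a \<Rightarrow> 'c::{banach, second_countable_topology}"
  shows "f \<in> borel_measurable borel \<Longrightarrow> (\<integral>z. f (fst z) \<partial>P) = (\<integral>x. f x \<partial>M)"
  using integral_distr[of fst P borel f] by (simp add: distr_fst)

lemma integrable_coupling_snd:
  fixes f :: "'a \<Rightarrow> 'c::{banach, second_countable_topology}"
  shows "integrable N f \<Longrightarrow> integrable (P) (\<lambda>z. f (snd z))"
  using integrable_distr[of snd P borel f] by (simp add: distr_snd)

lemma integral_coupling_snd:
  fixes f :: "'a \<Rightarrow> 'c::{banach, second_countable_topology}"
  shows "f \<in> borel_measurable borel \<Longrightarrow> (\<integral>z. f (snd z) \<partial>P) = (\<integral>y. f y \<partial>N)"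
  using integral_distr[of snd P borel f] by (simp add: distr_snd)

lemma coupling_measure_in_couplings: "P \<in> couplings M N"
  by (simp add: couplings_def sets_coupling_measure distr_fst distr_snd)

lemma W2_le:
  assumes "transport_cost M N w \<le> ennreal e" "0 \<le> e"
  shows "W2 M N \<le> sqrt e"
proof -
  have "(INF P\<in>couplings M N. \<integral>\<^sup>+ z. ennreal ((norm (fst z - snd z))\<^sup>2) \<partial>P) \<le> ennreal e"
    using assms(1) unfolding transport_cost_def
    by (rule INF_lower2[OF coupling_measure_in_couplings])
  then show ?thesis
    unfolding W2_def real_sqrt_le_iff using assms(2) by (metis enn2real_leI)
qed

end

text \<open>A continuous partition of unity takes the place of a partition into small sets, because
  weak convergence tests continuous functions only.\<close>

lemma soft_cells:
  fixes R e :: real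
  assumes "e > 0"
  obtains C :: "'a::euclidean_space set" and h :: "'a \<Rightarrow> 'a \<Rightarrow> real"
  where "finite C" "\<And>c. continuous_on UNIV (h c)" "\<And>c x. 0 \<le> h c x"
    "\<And>x. (\<Sum>c\<in>C. h c x) \<le> 1" "\<And>x. norm x \<le> R \<Longrightarrow> (\<Sum>c\<in>C. h c x) = 1"
    "\<And>c x. h c x \<noteq> 0 \<Longrightarrow> dist x c < e"
proof -
  have "cball 0 R \<subseteq> (\<Union>c\<in>cball 0 R. ball c (e / 2))"
    using assms by force
  from compactE_image[OF compact_cball open_ball this] obtain C :: "'a set"
    where C: "finite C" "cball 0 R \<subseteq> (\<Union>c\<in>C. ball c (e / 2))" by metis
  define g where "g c x = max 0 (e - dist x c)" for c x :: 'a
  \<comment> \<open>The floor e / 2 keeps the quotient continuous where all bumps vanish; on the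
    ball the sum of the bumps is at least e / 2, so there the floor is inactive.\<close>
  define S where "S x = max (\<Sum>c\<in>C. g c x) (e / 2)" for x
  have g0: "0 \<le> g c x" for c x by (simp add: g_def)
  have S: "S x > 0" for x using assms by (simp add: S_def)
  show thesis
  proof
    show "finite C" by (rule C)
    have "continuous_on UNIV S"
      unfolding S_def g_def by (intro continuous_intros)
    then show "continuous_on UNIV (\<lambda>x. g c x / S x)" for c
      using S unfolding g_def
      by (intro continuous_intros) (auto simp: less_imp_neq[symmetric])
    show "0 \<le> g c x / S x" for c x using g0 S[of x] by simp
    show "(\<Sum>c\<in>C. g c x / S x) \<le> 1" for x
      using S[of x] by (simp add: sum_divide_distrib[symmetric] S_def)
    show "(\<Sum>c\<in>C. g c x / S x) = 1" if "norm x \<le> R" for x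
    proof -
      have "x \<in> cball 0 R" using that by simp
      with C(2) obtain c where c: "c \<in> C" "dist c x < e / 2" by (meson UN_E mem_ball subsetD)
      then have "e / 2 \<le> g c x" by (simp add: g_def dist_commute max_def)
      also have "\<dots> \<le> (\<Sum>c\<in>C. g c x)" using C(1) c(1) g0 by (intro member_le_sum) auto
      finally show ?thesis
        using assms by (simp add: sum_divide_distrib[symmetric] S_def)
    qed
    show "dist x c < e" if "g c x / S x \<noteq> 0" for c x
      using that by (auto simp: g_def max_def split: if_splits)
  qed
qed

text \<open>Mass that the two laws share in a cell is coupled independently inside the cell; the excess
  densities \<open>u\<close> and \<open>v\<close>, both of total mass \<open>r\<close>, are coupled independently of each other.\<close>

lemma coupling_density_of_cells:
  fixes M N :: "'a::euclidean_space measure" and h :: "'c \<Rightarrow> 'a \<Rightarrow> real"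
  assumes M: "borel_prob M" and N: "borel_prob N"
    and C: "finite C" and cont: "\<And>c. continuous_on UNIV (h c)" and nonneg: "\<And>c x. 0 \<le> h c x"
    and le_1: "\<And>x. (\<Sum>c\<in>C. h c x) \<le> 1"
    and small: "\<And>c x y. h c x \<noteq> 0 \<Longrightarrow> h c y \<noteq> 0 \<Longrightarrow> dist x y \<le> d" and "0 \<le> d"
    and t: "0 < t" "t < 1"
    and pos: "\<And>c. c \<in> C \<Longrightarrow> 0 < (\<integral>y. h c y \<partial>N)"
    and close: "\<And>c. c \<in> C \<Longrightarrow> (1 - t) * (\<integral>y. h c y \<partial>N) \<le> (\<integral>x. h c x \<partial>M)"
    and D: "(\<integral>\<^sup>+ x. ennreal (norm x ^ 4) \<partial>M) \<le> ennreal D" "(\<integral>\<^sup>+ y. ennreal (norm y ^ 4) \<partial>N) \<le> ennreal D"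
    and "0 \<le> D" "0 < s"
  shows "\<exists>w. coupling_density M N w \<and>
    transport_cost M N w \<le> ennreal (d\<^sup>2 + 4 * s * D + 4 / s * (t + (1 - (\<integral>y. (\<Sum>c\<in>C. h c y) \<partial>N))))"
proof -
  interpret M: prob_space M using M by (simp add: borel_prob_def)
  interpret N: prob_space N using N by (simp add: borel_prob_def)
  have [measurable_cong]: "sets M = sets borel" "sets N = sets borel"
    using M N by (simp_all add: borel_prob_def)
  have mh[measurable]: "h c \<in> borel_measurable borel" for c
    by (rule borel_measurable_continuous_onI[OF cont])
  have h1: "h c x \<le> 1" if "c \<in> C" for c x
    using member_le_sum[OF that, of "\<lambda>c. h c x"] nonneg le_1[of x] C by auto
  define a where "a c = (\<integral>x. h c x \<partial>M)" for c
  define b where "b c = (\<integral>y. h c y \<partial>N)" for c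
  define B where "B = (\<Sum>c\<in>C. b c)"
  have ih: "integrable M (h c)" "integrable N (h c)" if "c \<in> C" for c
    using that h1 nonneg
    by (auto intro!: M.integrable_const_bound[where B = 1] N.integrable_const_bound[where B = 1])
  have b: "0 < b c" if "c \<in> C" for c using pos[OF that] by (simp add: b_def)
  have ab: "(1 - t) * b c \<le> a c" if "c \<in> C" for c using close[OF that] by (simp add: a_def b_def)
  have a: "0 < a c" if "c \<in> C" for c
    using ab[OF that] mult_pos_pos[of "1 - t" "b c"] b[OF that] t by linarith
  have B: "B = (\<integral>y. (\<Sum>c\<in>C. h c y) \<partial>N)"
    unfolding B_def b_def using ih by (intro Bochner_Integration.integral_sum[symmetric]) auto
  have B1: "B \<le> 1"
  proof -
    have "(\<integral>y. (\<Sum>c\<in>C. h c y) \<partial>N) \<le> (\<integral>y. 1 \<partial>N)"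
      by (intro integral_mono Bochner_Integration.integrable_sum ih le_1 N.integrable_const)
    then show ?thesis by (simp add: B N.prob_space)
  qed
  \<comment> \<open>Total mass of the remainder. As t > 0, it is positive even if the cells exhaust
    N and B = 1, so q may be divided by it.\<close>
  define r where "r = 1 - (1 - t) * B"
  have "(1 - t) * B \<le> (1 - t) * 1" using B1 t by (intro mult_left_mono) auto
  then have r: "0 < r" using t unfolding r_def left_diff_distrib by linarith
  have "t * B \<le> t * 1" using B1 t by (intro mult_left_mono) auto
  then have r_le: "r \<le> t + (1 - B)" unfolding r_def left_diff_distrib by linarith
  \<comment> \<open>Here u and v are what the in-cell part p leaves of the marginals: integrating p
    over y gives (1 - t) times the sum of h_c(x) b_c / a_c, and over x it gives (1 - t) times the
    sum of h_c(y). The factor 1 - t is the room that keeps u nonnegative, since (1 - t) b_c \<le>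
    a_c.\<close>
  define u where "u x = 1 - (1 - t) * (\<Sum>c\<in>C. h c x * (b c / a c))" for x
  define v where "v y = 1 - (1 - t) * (\<Sum>c\<in>C. h c y)" for y
  define p where "p x y = (1 - t) * (\<Sum>c\<in>C. h c x * h c y / a c)" for x y
  define q where "q x y = u x * v y / r" for x y
  define w where "w x y = p x y + q x y" for x y
  have [measurable]: "u \<in> borel_measurable borel" "v \<in> borel_measurable borel"
    unfolding u_def v_def by measurable
  have m_fst: "fst \<in> borel_measurable (borel :: ('a \<times> 'a) measure)"
    and m_snd: "snd \<in> borel_measurable (borel :: ('a \<times> 'a) measure)"
    by (simp_all add: borel_prod[symmetric])
  note [measurable] = m_fst m_snd
  have mq[measurable]: "(\<lambda>z. q (fst z) (snd z)) \<in> borel_measurable borel"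
    unfolding q_def by measurable
  have mw[measurable]: "(\<lambda>z. w (fst z) (snd z)) \<in> borel_measurable borel"
    unfolding w_def p_def q_def by measurable
  have u0: "0 \<le> u x" for x
  proof -
    have "(1 - t) * (\<Sum>c\<in>C. h c x * (b c / a c)) = (\<Sum>c\<in>C. h c x * ((1 - t) * b c / a c))"
      by (simp add: sum_distrib_left mult_ac)
    also have "\<dots> \<le> (\<Sum>c\<in>C. h c x * 1)"
      using ab a nonneg by (intro sum_mono mult_left_mono) auto
    finally show ?thesis using le_1[of x] by (simp add: u_def)
  qed
  have u1: "u x \<le> 1" for x
    using t nonneg a b by (simp add: u_def less_imp_le sum_nonneg)
  have v0: "0 \<le> v y" for y
    using mult_mono[of "1 - t" 1 "\<Sum>c\<in>C. h c y" 1] le_1[of y] t nonneg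
    by (simp add: v_def sum_nonneg)
  have v1: "v y \<le> 1" for y
    using t nonneg by (auto simp: v_def intro!: mult_nonneg_nonneg sum_nonneg)
  have p0: "0 \<le> p x y" for x y
    using t nonneg a by (simp add: p_def less_imp_le sum_nonneg)
  have q0: "0 \<le> q x y" for x y
    using u0 v0 r by (simp add: q_def)
  have w0: "0 \<le> w x y" for x y
    using p0 q0 by (simp add: w_def)
  have w_le: "w x y \<le> (1 - t) * (\<Sum>c\<in>C. 1 / a c) + 1 / r" for x y
  proof -
    have "h c x * h c y \<le> 1 * 1" if "c \<in> C" for c
      using h1[OF that] nonneg by (intro mult_mono) auto
    then have "p x y \<le> (1 - t) * (\<Sum>c\<in>C. 1 / a c)"
      unfolding p_def using t a by (intro mult_left_mono sum_mono divide_right_mono) (auto simp: less_imp_le)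
    moreover have "u x * v y \<le> 1 * 1" using u1 v1 u0 v0 by (intro mult_mono) auto
    then have "q x y \<le> 1 / r" unfolding q_def using r by (simp add: divide_right_mono)
    ultimately show ?thesis by (simp add: w_def)
  qed
  have iu: "integrable M u" "integrable N v"
    using u0 u1 v0 v1
    by (auto intro!: M.integrable_const_bound[where B = 1] N.integrable_const_bound[where B = 1])
  have ru: "(\<integral>x. u x \<partial>M) = r"
  proof -
    have "(\<integral>x. u x \<partial>M) = 1 - (1 - t) * (\<Sum>c\<in>C. a c * (b c / a c))"
      unfolding u_def a_def using ih by (simp add: M.prob_space)
    also have "(\<Sum>c\<in>C. a c * (b c / a c)) = B"
      unfolding B_def using a by (intro sum.cong) (auto simp: less_imp_neq[symmetric])
    finally show ?thesis by (simp add: r_def)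
  qed
  have rv: "(\<integral>y. v y \<partial>N) = r"
    unfolding v_def r_def B_def b_def using ih by (simp add: N.prob_space)
  have marg_N: "(\<integral>\<^sup>+ y. ennreal (w x y) \<partial>N) = 1" for x
  proof -
    have iw: "integrable N (w x)"
      unfolding w_def[abs_def] p_def q_def using ih iu by (simp add: mult.assoc)
    have "(\<integral>y. w x y \<partial>N) = (1 - t) * (\<Sum>c\<in>C. h c x * b c / a c) + u x * r / r"
      unfolding w_def p_def q_def rv[symmetric] b_def using ih iu by simp
    also have "\<dots> = 1" using r by (simp add: u_def)
    finally show ?thesis using iw w0 by (simp add: nn_integral_eq_integral)
  qed
  have marg_M: "(\<integral>\<^sup>+ x. ennreal (w x y) \<partial>M) = 1" for y
  proof -
    have iw: "integrable M (\<lambda>x. w x y)"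
      unfolding w_def[abs_def] p_def q_def using ih iu by (simp add: mult.assoc)
    have "(\<integral>x. w x y \<partial>M) = (1 - t) * (\<Sum>c\<in>C. a c * h c y / a c) + r * v y / r"
      unfolding w_def p_def q_def ru[symmetric] a_def using ih iu by simp
    also have "(\<Sum>c\<in>C. a c * h c y / a c) = (\<Sum>c\<in>C. h c y)"
      using a by (intro sum.cong) (auto simp: less_imp_neq[symmetric])
    also have "(1 - t) * \<dots> + r * v y / r = 1" using r by (simp add: v_def)
    finally show ?thesis using iw w0 by (simp add: nn_integral_eq_integral)
  qed
  have cd: "coupling_density M N w"
    unfolding coupling_density_def using mw w0 w_le marg_M marg_N by blast
  interpret coupling M N w by unfold_locales (use M N cd in auto)
  \<comment> \<open>Inside a cell the displacement is at most d. On the remainder it is bounded by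
    2|x|^2 + 2|y|^2, and Young's inequality splits each square into s times a fourth power and a
    constant 1/s, the latter paid only on the small mass of q.\<close>
  have pt: "w x y * (norm (x - y))\<^sup>2
      \<le> d\<^sup>2 * w x y + (2 * s) * (w x y * norm x ^ 4) + (2 * s) * (w x y * norm y ^ 4) + (4 / s) * q x y" for x y
  proof -
    have "h c x * h c y / a c * (norm (x - y))\<^sup>2 \<le> h c x * h c y / a c * d\<^sup>2" if "c \<in> C" for c
    proof (cases "h c x = 0 \<or> h c y = 0")
      case False
      then have "norm (x - y) \<le> d" using small by (auto simp: dist_norm)
      then show ?thesis
        using nonneg a[OF that] by (intro mult_left_mono power_mono) auto
    qed auto
    then have "(\<Sum>c\<in>C. h c x * h c y / a c * (norm (x - y))\<^sup>2) \<le> (\<Sum>c\<in>C. h c x * h c y / a c * d\<^sup>2)"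
      by (rule sum_mono)
    then have "(1 - t) * (\<Sum>c\<in>C. h c x * h c y / a c * (norm (x - y))\<^sup>2)
        \<le> (1 - t) * (\<Sum>c\<in>C. h c x * h c y / a c * d\<^sup>2)"
      using t by (intro mult_left_mono) auto
    then have "p x y * (norm (x - y))\<^sup>2 \<le> p x y * d\<^sup>2"
      unfolding p_def sum_distrib_right[symmetric] by (simp add: mult.assoc)
    also have "\<dots> \<le> w x y * d\<^sup>2" using q0 by (simp add: w_def mult_right_mono)
    finally have 1: "p x y * (norm (x - y))\<^sup>2 \<le> d\<^sup>2 * w x y" by (simp add: mult.commute)
    have sq: "(norm z)\<^sup>2 \<le> s * norm z ^ 4 + 1 / s" for z :: 'a
      using young_weighted[OF \<open>0 < s\<close>, of "(norm z)\<^sup>2" 1] by simp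
    have "(norm (x - y))\<^sup>2 \<le> (norm x + norm y)\<^sup>2"
      by (intro power_mono norm_triangle_ineq4) auto
    also have "\<dots> \<le> 2 * (norm x)\<^sup>2 + 2 * (norm y)\<^sup>2"
      using sum_squares_bound[of "norm x" "norm y"] by (simp add: power2_sum)
    also have "\<dots> \<le> 2 * s * norm x ^ 4 + 2 * s * norm y ^ 4 + 4 / s"
      using sq[of x] sq[of y] by (simp add: algebra_simps)
    finally have "q x y * (norm (x - y))\<^sup>2 \<le> q x y * (2 * s * norm x ^ 4 + 2 * s * norm y ^ 4 + 4 / s)"
      using q0 by (intro mult_left_mono) auto
    also have "\<dots> = q x y * (2 * s * norm x ^ 4 + 2 * s * norm y ^ 4) + (4 / s) * q x y"
      by (simp add: algebra_simps)
    also have "\<dots> \<le> w x y * (2 * s * norm x ^ 4 + 2 * s * norm y ^ 4) + (4 / s) * q x y"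
      using p0 \<open>0 < s\<close> by (intro add_right_mono mult_right_mono) (auto simp: w_def)
    finally have 2: "q x y * (norm (x - y))\<^sup>2
        \<le> (2 * s) * (w x y * norm x ^ 4) + (2 * s) * (w x y * norm y ^ 4) + (4 / s) * q x y"
      by (simp add: algebra_simps)
    have "w x y * (norm (x - y))\<^sup>2 = p x y * (norm (x - y))\<^sup>2 + q x y * (norm (x - y))\<^sup>2"
      by (simp add: w_def algebra_simps)
    with 1 2 show ?thesis by linarith
  qed
  let ?w = "\<lambda>z. w (fst z) (snd z)" and ?q = "\<lambda>z. q (fst z) (snd z)" and ?P = "M \<Otimes>\<^sub>M N"
  have [measurable]: "?w \<in> borel_measurable ?P" "?q \<in> borel_measurable ?P"
    unfolding measurable_cong_sets[OF sets_MN refl] by measurable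
  have dens: "(\<integral>\<^sup>+ z. ennreal (?w z) * ennreal (f z) \<partial>?P) = (\<integral>\<^sup>+ z. ennreal (f z) \<partial>coupling_measure M N w)"
    if "f \<in> borel_measurable borel" for f
  proof -
    have [measurable]: "f \<in> borel_measurable ?P"
      using that unfolding measurable_cong_sets[OF sets_MN refl] .
    show ?thesis
      unfolding coupling_measure_def by (rule nn_integral_density[symmetric]) measurable
  qed
  have tot: "(\<integral>\<^sup>+ z. ennreal (?w z) \<partial>?P) = 1"
    using N.nn_integral_fst[of "\<lambda>z. ennreal (?w z)" M] M.emeasure_space_1 by (simp add: w_snd)
  have mx: "(\<integral>\<^sup>+ z. ennreal (?w z) * ennreal (norm (fst z) ^ 4) \<partial>?P) \<le> ennreal D"
    using D(1) by (subst dens) (auto simp: nn_integral_coupling_fst[of "\<lambda>x. ennreal (norm x ^ 4)"])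
  have my: "(\<integral>\<^sup>+ z. ennreal (?w z) * ennreal (norm (snd z) ^ 4) \<partial>?P) \<le> ennreal D"
    using D(2) by (subst dens) (auto simp: nn_integral_coupling_snd[of "\<lambda>x. ennreal (norm x ^ 4)"])
  have mq: "(\<integral>\<^sup>+ z. ennreal (?q z) \<partial>?P) = ennreal r"
  proof -
    have "(\<integral>\<^sup>+ y. ennreal (q x y) \<partial>N) = ennreal (u x)" for x
    proof -
      have "(\<integral>\<^sup>+ y. ennreal (q x y) \<partial>N) = ennreal (\<integral>y. q x y \<partial>N)"
        using iu q0 by (intro nn_integral_eq_integral) (auto simp: q_def)
      also have "(\<integral>y. q x y \<partial>N) = u x * r / r"
        unfolding q_def rv[symmetric] using iu by simp
      finally show ?thesis using r by simp
    qed
    then have "(\<integral>\<^sup>+ z. ennreal (?q z) \<partial>?P) = (\<integral>\<^sup>+ x. ennreal (u x) \<partial>M)"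
      using N.nn_integral_fst[of "\<lambda>z. ennreal (?q z)" M] by simp
    then show ?thesis using iu u0 by (simp add: nn_integral_eq_integral ru)
  qed
  have "transport_cost M N w = (\<integral>\<^sup>+ z. ennreal (?w z) * ennreal ((norm (fst z - snd z))\<^sup>2) \<partial>?P)"
    unfolding transport_cost_def by (rule dens[symmetric]) measurable
  also have "\<dots> \<le> (\<integral>\<^sup>+ z. ennreal (d\<^sup>2) * ennreal (?w z)
      + ennreal (2 * s) * (ennreal (?w z) * ennreal (norm (fst z) ^ 4))
      + ennreal (2 * s) * (ennreal (?w z) * ennreal (norm (snd z) ^ 4))
      + ennreal (4 / s) * ennreal (?q z) \<partial>?P)"
    using w0 q0 \<open>0 < s\<close> pt
    by (intro nn_integral_mono)
      (simp add: ennreal_mult[symmetric] ennreal_plus[symmetric] ennreal_leI del: ennreal_plus)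
  also have "\<dots> = ennreal (d\<^sup>2) * (\<integral>\<^sup>+ z. ennreal (?w z) \<partial>?P)
      + ennreal (2 * s) * (\<integral>\<^sup>+ z. ennreal (?w z) * ennreal (norm (fst z) ^ 4) \<partial>?P)
      + ennreal (2 * s) * (\<integral>\<^sup>+ z. ennreal (?w z) * ennreal (norm (snd z) ^ 4) \<partial>?P)
      + ennreal (4 / s) * (\<integral>\<^sup>+ z. ennreal (?q z) \<partial>?P)"
    by (simp add: nn_integral_add nn_integral_cmult)
  also have "\<dots> \<le> ennreal (d\<^sup>2) * 1 + ennreal (2 * s) * ennreal D + ennreal (2 * s) * ennreal D
      + ennreal (4 / s) * ennreal r"
    unfolding tot mq by (intro add_mono mult_left_mono mx my) auto
  also have "\<dots> = ennreal (d\<^sup>2 + 4 * s * D + 4 / s * r)"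
    using \<open>0 < s\<close> \<open>0 \<le> D\<close> r
    by (simp add: ennreal_mult[symmetric] ennreal_plus[symmetric] del: ennreal_plus)
  also have "\<dots> \<le> ennreal (d\<^sup>2 + 4 * s * D + 4 / s * (t + (1 - B)))"
    using r_le \<open>0 < s\<close> by (intro ennreal_leI add_left_mono mult_left_mono) auto
  finally show ?thesis using cd unfolding B by blast
qed


lemma eventually_coupling_density:
  fixes M :: "nat \<Rightarrow> 'a::euclidean_space measure"
  assumes M: "\<And>k. borel_prob (M k)" and N: "borel_prob N" and conv: "weakly_converges M N"
    and D: "\<And>k. (\<integral>\<^sup>+ x. ennreal (norm x ^ 4) \<partial>M k) \<le> ennreal D"
      "(\<integral>\<^sup>+ y. ennreal (norm y ^ 4) \<partial>N) \<le> ennreal D" "0 \<le> D"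
    and "0 < e"
  shows "\<forall>\<^sub>F k in sequentially. \<exists>w. coupling_density (M k) N w \<and> transport_cost (M k) N w \<le> ennreal e"
proof -
  interpret N: prob_space N using N by (simp add: borel_prob_def)
  have [measurable_cong]: "sets N = sets borel" using N by (simp_all add: borel_prob_def)
  \<comment> \<open>The error e is split in three: d^2 for the cell size, 4 s D for the fourth
    moments, and 4 / s times the uncoupled mass, where t and the tail beyond radius R each get e s /
    24.\<close>
  define d where "d = sqrt (e / 3)"
  define s where "s = e / (12 * (D + 1))"
  define t where "t = min (1 / 2) (e * s / 24)"
  \<comment> \<open>For R \<ge> 1 the bound R \<le> R^4 avoids a fourth root.\<close>
  define R where "R = max 1 (24 * D / (e * s))"
  have d: "0 < d" "d\<^sup>2 = e / 3" using \<open>0 < e\<close> by (auto simp: d_def)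
  have s: "0 < s" using \<open>0 < e\<close> \<open>0 \<le> D\<close> by (simp add: s_def)
  have "4 * s * D = (e / 3) * (D / (D + 1))" using \<open>0 \<le> D\<close> by (simp add: s_def field_simps)
  also have "\<dots> \<le> (e / 3) * 1" using \<open>0 \<le> D\<close> \<open>0 < e\<close> by (intro mult_left_mono) auto
  finally have sD: "4 * s * D \<le> e / 3" by simp
  have t: "0 < t" "t < 1" "t \<le> e * s / 24" using \<open>0 < e\<close> s by (auto simp: t_def)
  have R: "1 \<le> R" by (simp add: R_def)
  have DR: "D / R ^ 4 \<le> e * s / 24"
  proof -
    have "24 * D / (e * s) \<le> R" by (simp add: R_def)
    also have "R \<le> R ^ 4" using power_increasing[of 1 4 R] R by simp
    finally have "24 * D \<le> R ^ 4 * (e * s)" using \<open>0 < e\<close> s by (simp add: pos_divide_le_eq)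
    then show ?thesis using R by (simp add: pos_divide_le_eq mult.commute)
  qed
  have "0 < d / 2" using d by simp
  from soft_cells[OF this, of R] obtain C0 and h :: "'a \<Rightarrow> 'a \<Rightarrow> real" where C0: "finite C0"
    and cont: "\<And>c. continuous_on UNIV (h c)" and nonneg: "\<And>c x. 0 \<le> h c x"
    and le_1: "\<And>x. (\<Sum>c\<in>C0. h c x) \<le> 1" and eq_1: "\<And>x. norm x \<le> R \<Longrightarrow> (\<Sum>c\<in>C0. h c x) = 1"
    and small: "\<And>c x. h c x \<noteq> 0 \<Longrightarrow> dist x c < d / 2" by blast
  have mh[measurable]: "h c \<in> borel_measurable borel" for c
    by (rule borel_measurable_continuous_onI[OF cont])
  have h1: "h c x \<le> 1" if "c \<in> C0" for c x
    using member_le_sum[OF that, of "\<lambda>c. h c x"] nonneg le_1[of x] C0 by auto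
  have ih: "integrable N (h c)" if "c \<in> C0" for c
    using that h1 nonneg by (auto intro!: N.integrable_const_bound[where B = 1])
  \<comment> \<open>Cells of N-mass zero are dropped: the construction divides by the mass that the
    other law gives to a cell, and that mass is bounded below only through a positive N-mass. The
    covered mass of N does not change.\<close>
  define C where "C = {c\<in>C0. 0 < (\<integral>y. h c y \<partial>N)}"
  have C: "finite C" "C \<subseteq> C0" using C0 by (auto simp: C_def)
  have le_1': "(\<Sum>c\<in>C. h c x) \<le> 1" for x
    using sum_mono2[OF C0 C(2), of "\<lambda>c. h c x"] nonneg le_1[of x] by (meson order_trans)
  have small': "dist x y \<le> d" if "h c x \<noteq> 0" "h c y \<noteq> 0" for c x y
    using small[OF that(1)] small[OF that(2)] dist_triangle2[of x y c] by linarith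
  have B: "1 - (\<integral>y. (\<Sum>c\<in>C. h c y) \<partial>N) \<le> D / R ^ 4"
  proof -
    have zero: "(\<integral>y. h c y \<partial>N) = 0" if "c \<in> C0 - C" for c
    proof -
      have "0 \<le> (\<integral>y. h c y \<partial>N)" by (rule Bochner_Integration.integral_nonneg) (rule nonneg)
      with that show ?thesis by (auto simp: C_def)
    qed
    have "(\<integral>y. (\<Sum>c\<in>C. h c y) \<partial>N) = (\<Sum>c\<in>C. \<integral>y. h c y \<partial>N)"
      using ih C by (intro Bochner_Integration.integral_sum) auto
    also have "\<dots> = (\<Sum>c\<in>C0. \<integral>y. h c y \<partial>N)"
      using C0 C zero by (intro sum.mono_neutral_left) auto
    also have "\<dots> = (\<integral>y. (\<Sum>c\<in>C0. h c y) \<partial>N)"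
      using ih by (intro Bochner_Integration.integral_sum[symmetric]) auto
    finally have "1 - (\<integral>y. (\<Sum>c\<in>C. h c y) \<partial>N) = (\<integral>y. 1 - (\<Sum>c\<in>C0. h c y) \<partial>N)"
      using ih by (simp add: N.prob_space)
    also have "ennreal \<dots> = (\<integral>\<^sup>+ y. ennreal (1 - (\<Sum>c\<in>C0. h c y)) \<partial>N)"
      using ih le_1 by (intro nn_integral_eq_integral[symmetric]) auto
    also have "\<dots> \<le> (\<integral>\<^sup>+ y. ennreal (1 / R ^ 4) * ennreal (norm y ^ 4) \<partial>N)"
    proof (intro nn_integral_mono)
      fix y :: 'a
      have "1 - (\<Sum>c\<in>C0. h c y) \<le> norm y ^ 4 / R ^ 4"
      proof (cases "norm y \<le> R")
        case False
        then have "R ^ 4 \<le> norm y ^ 4" using R by (intro power_mono) auto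
        then have "1 \<le> norm y ^ 4 / R ^ 4" using R by simp
        moreover have "0 \<le> (\<Sum>c\<in>C0. h c y)" using nonneg by (intro sum_nonneg) auto
        ultimately show ?thesis by linarith
      qed (use eq_1 R in auto)
      then show "ennreal (1 - (\<Sum>c\<in>C0. h c y)) \<le> ennreal (1 / R ^ 4) * ennreal (norm y ^ 4)"
        using R by (simp add: ennreal_mult[symmetric] ennreal_leI)
    qed
    also have "\<dots> = ennreal (1 / R ^ 4) * (\<integral>\<^sup>+ y. ennreal (norm y ^ 4) \<partial>N)"
      by (rule nn_integral_cmult) measurable
    also have "\<dots> \<le> ennreal (1 / R ^ 4) * ennreal D"
      by (intro mult_left_mono D) auto
    also have "\<dots> = ennreal (D / R ^ 4)"
      using R \<open>0 \<le> D\<close> by (simp add: ennreal_mult[symmetric])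
    finally show ?thesis
      using R \<open>0 \<le> D\<close> by (subst (asm) ennreal_le_iff) auto
  qed
  have "4 / s * (t + (1 - (\<integral>y. (\<Sum>c\<in>C. h c y) \<partial>N))) \<le> 4 / s * (e * s / 12)"
  proof (rule mult_left_mono)
    show "t + (1 - (\<integral>y. (\<Sum>c\<in>C. h c y) \<partial>N)) \<le> e * s / 12"
      using t(3) B DR by linarith
  qed (use s in simp)
  also have "\<dots> = e / 3" using s by simp
  finally have total: "d\<^sup>2 + 4 * s * D + 4 / s * (t + (1 - (\<integral>y. (\<Sum>c\<in>C. h c y) \<partial>N))) \<le> e"
    using d(2) sD by linarith
  have "\<forall>\<^sub>F k in sequentially. (1 - t) * (\<integral>y. h c y \<partial>N) \<le> (\<integral>x. h c x \<partial>M k)" if "c \<in> C" for c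
  proof -
    have "bounded (range (h c))"
      unfolding bounded_iff using nonneg h1 that C(2) by (intro exI[of _ 1]) (auto simp: subset_iff)
    then have "(\<lambda>k. \<integral>x. h c x \<partial>M k) \<longlonglongrightarrow> (\<integral>y. h c y \<partial>N)"
      using conv cont unfolding weakly_converges_def by blast
    moreover have "(1 - t) * (\<integral>y. h c y \<partial>N) < (\<integral>y. h c y \<partial>N)"
      using that t by (simp add: C_def)
    ultimately have "\<forall>\<^sub>F k in sequentially. (1 - t) * (\<integral>y. h c y \<partial>N) < (\<integral>x. h c x \<partial>M k)"
      by (rule order_tendstoD)
    then show ?thesis by eventually_elim simp
  qed
  then have "\<forall>\<^sub>F k in sequentially. \<forall>c\<in>C. (1 - t) * (\<integral>y. h c y \<partial>N) \<le> (\<integral>x. h c x \<partial>M k)"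
    using C(1) by (simp add: eventually_ball_finite)
  then show ?thesis
  proof eventually_elim
    case (elim k)
    have "\<exists>w. coupling_density (M k) N w \<and> transport_cost (M k) N w
        \<le> ennreal (d\<^sup>2 + 4 * s * D + 4 / s * (t + (1 - (\<integral>y. (\<Sum>c\<in>C. h c y) \<partial>N))))"
      by (rule coupling_density_of_cells[OF M N C(1) cont nonneg le_1' small'])
        (use d t s D elim in \<open>auto simp: C_def\<close>)
    then show ?case
      using total by (meson ennreal_leI order_trans)
  qed
qed

text \<open>For each e a suitable density exists only from some index on, which depends on e.
  Near-minimisers of the cost with slack 1/(k + 1) form one sequence that serves every e; where the
  infimum is infinite, the product coupling w = 1 fills the gap.\<close>

lemma exists_coupling_densities:
  fixes M :: "nat \<Rightarrow> 'a::euclidean_space measure"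
  assumes M: "\<And>k. borel_prob (M k)" and N: "borel_prob N" and conv: "weakly_converges M N"
    and D: "\<And>k. (\<integral>\<^sup>+ x. ennreal (norm x ^ 4) \<partial>M k) \<le> ennreal D"
      "(\<integral>\<^sup>+ y. ennreal (norm y ^ 4) \<partial>N) \<le> ennreal D" "0 \<le> D"
  obtains w where "\<And>k. coupling_density (M k) N (w k)"
    "(\<lambda>k. transport_cost (M k) N (w k)) \<longlonglongrightarrow> 0"
proof -
  let ?W = "\<lambda>k. {w. coupling_density (M k) N w}"
  define I where "I k = (INF w\<in>?W k. transport_cost (M k) N w)" for k
  have triv: "coupling_density (M k) N (\<lambda>x y. 1)" for k
    using M[of k] N by (auto simp: coupling_density_def borel_prob_def prob_space.emeasure_space_1)
  have I: "\<forall>\<^sub>F k in sequentially. I k \<le> ennreal e" if "0 < e" for e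
    using eventually_coupling_density[OF M N conv D that]
    by eventually_elim (auto simp: I_def intro: INF_lower2)
  have "\<exists>w. coupling_density (M k) N w \<and> (I k < \<infinity> \<longrightarrow> transport_cost (M k) N w \<le> I k + ennreal (1 / Suc k))" for k
  proof (cases "I k < \<infinity>")
    case True
    then have "I k < I k + ennreal (1 / Suc k)"
      using ennreal_add_left_cancel_less[of "I k" 0 "ennreal (1 / Suc k)"] by (simp add: less_top)
    then obtain w where "w \<in> ?W k" "transport_cost (M k) N w < I k + ennreal (1 / Suc k)"
      unfolding I_def INF_less_iff by blast
    then show ?thesis by (auto intro: less_imp_le)
  qed (use triv in blast)
  then obtain w where w: "\<And>k. coupling_density (M k) N (w k)"
    "\<And>k. I k < \<infinity> \<Longrightarrow> transport_cost (M k) N (w k) \<le> I k + ennreal (1 / Suc k)" by metis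
  have "(\<lambda>k. transport_cost (M k) N (w k)) \<longlonglongrightarrow> 0"
  proof (rule order_tendstoI)
    fix a :: ennreal assume "0 < a"
    then obtain b where "0 < b" "b < a" using dense by blast
    then obtain e where e: "0 < e" "ennreal e < a"
      by (cases b rule: ennreal_cases) auto
    have "\<forall>\<^sub>F k in sequentially. 1 / real (Suc k) < e / 2"
      using e by (intro order_tendstoD(2)[OF LIMSEQ_Suc[OF lim_const_over_n]]) auto
    moreover have "\<forall>\<^sub>F k in sequentially. I k \<le> ennreal (e / 2)"
      using e by (intro I) auto
    ultimately show "\<forall>\<^sub>F k in sequentially. transport_cost (M k) N (w k) < a"
    proof eventually_elim
      case (elim k)
      have "I k < \<infinity>" using elim(2) by (auto intro: order_le_less_trans)
      then have "transport_cost (M k) N (w k) \<le> I k + ennreal (1 / Suc k)" by (rule w)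
      also have "\<dots> \<le> ennreal (e / 2) + ennreal (e / 2)"
        using elim by (intro add_mono ennreal_leI) auto
      also have "\<dots> = ennreal e" using e by (simp flip: ennreal_plus)
      finally show ?case using e by simp
    qed
  qed auto
  with w show ?thesis by (intro that) auto
qed

section \<open>Jensen's inequality and strongly convergent midpoints\<close>

text \<open>A mean outside S would be strictly separated from S by a hyperplane, and integrating the
  affine inequality rules this out.\<close>

lemma (in prob_space) expectation_in_closed_convex:
  fixes X :: "'a \<Rightarrow> 'b::euclidean_space"
  assumes "integrable M X" "closed S" "convex S" and X: "AE x in M. X x \<in> S"
  shows "expectation X \<in> S"
proof (rule ccontr)
  assume "expectation X \<notin> S"
  from separating_hyperplane_closed_point[OF assms(3,2) this]
  obtain a b where ab: "a \<bullet> expectation X < b" "\<And>x. x \<in> S \<Longrightarrow> b < a \<bullet> x" by blast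
  have "expectation (\<lambda>x. b) \<le> expectation (\<lambda>x. a \<bullet> X x)"
    using assms(1) X ab(2) by (intro integral_mono_AE) (auto intro: less_imp_le)
  also have "\<dots> = a \<bullet> expectation X"
    using assms(1) by simp
  finally show False using ab(1) by (simp add: prob_space)
qed

lemma closed_sublevel:
  fixes F :: "'a::metric_space \<Rightarrow> ennreal"
  assumes S: "closed S" and F: "lower_semicontinuous_on S F"
  shows "closed {x\<in>S. F x \<le> c}"
  unfolding closed_sequential_limits
proof (intro allI impI, elim conjE)
  fix X l assume X: "\<forall>n. X n \<in> {x\<in>S. F x \<le> c}" and l: "X \<longlonglongrightarrow> l"
  have lS: "l \<in> S" using X l S unfolding closed_sequential_limits by blast
  moreover have "F l \<le> c"
  proof (rule ccontr)
    assume "\<not> F l \<le> c"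
    then have "c < Liminf (at l within S) F"
      using F lS by (auto simp: lower_semicontinuous_on_def intro: less_le_trans)
    then obtain c' where "c < c'" "c' < Liminf (at l within S) F" using dense by blast
    then have "\<forall>\<^sub>F x in at l within S. c' < F x"
      using le_Liminf_iff[of "Liminf (at l within S) F" "at l within S" F] by auto
    then have "\<forall>\<^sub>F x in at l within S. c < F x"
      using \<open>c < c'\<close> by (auto elim: eventually_mono)
    \<comment> \<open>The filter \<open>at l\<close> excludes l itself; the case
      \<open>X n = l\<close> is contradicted by c < F l.\<close>
    then obtain d where d: "d > 0" "\<And>x. x \<in> S \<Longrightarrow> x \<noteq> l \<Longrightarrow> dist x l < d \<Longrightarrow> c < F x"
      unfolding eventually_at by auto
    obtain n where "dist (X n) l < d" using l d(1) by (meson LIMSEQ_iff_nz metric_LIMSEQ_D order_refl)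
    then show False
      using d(2)[of "X n"] X \<open>\<not> F l \<le> c\<close> by (metis (mono_tags, lifting) mem_Collect_eq leD)
  qed
  ultimately show "l \<in> {x\<in>S. F x \<le> c}" by simp
qed

lemma measurable_compose_lower_semicontinuous:
  fixes F :: "'b::metric_space \<Rightarrow> ennreal"
  assumes "closed S" "lower_semicontinuous_on S F"
    and f: "f \<in> borel_measurable M" "\<And>x. f x \<in> S"
  shows "(\<lambda>x. F (f x)) \<in> borel_measurable M"
proof (rule borel_measurableI_le)
  fix c
  have "{x\<in>space M. F (f x) \<le> c} = f -` {x\<in>S. F x \<le> c} \<inter> space M"
    using f(2) by auto
  also have "\<dots> \<in> sets M"
    by (rule measurable_sets[OF f(1)]) (intro borel_closed closed_sublevel assms(1,2))
  finally show "{x\<in>space M. F (f x) \<le> c} \<in> sets M" .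
qed

lemma lower_semicontinuous_on_le_liminf:
  fixes F :: "'a::metric_space \<Rightarrow> ennreal"
  assumes "closed S" "lower_semicontinuous_on S F" "X \<longlonglongrightarrow> l" "\<And>n. X n \<in> S"
  shows "F l \<le> liminf (\<lambda>n. F (X n))"
  unfolding le_Liminf_iff
proof (intro allI impI)
  fix c assume "c < F l"
  then have "l \<in> - {x\<in>S. F x \<le> c}" by auto
  moreover have "open (- {x\<in>S. F x \<le> c})"
    using closed_sublevel[OF assms(1,2)] by (simp add: open_Compl)
  ultimately have "\<forall>\<^sub>F n in sequentially. X n \<in> - {x\<in>S. F x \<le> c}"
    using assms(3) by (metis topological_tendstoD)
  then show "\<forall>\<^sub>F n in sequentially. c < F (X n)"
    by eventually_elim (use assms(4) in auto)
qed

lemma closed_epigraph: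
  fixes F :: "'a::metric_space \<Rightarrow> ennreal"
  assumes S: "closed S" and F: "lower_semicontinuous_on S F"
  shows "closed {z. fst z \<in> S \<and> F (fst z) \<le> ennreal (snd z)}"
  unfolding closed_sequential_limits
proof (intro allI impI, elim conjE)
  fix X :: "nat \<Rightarrow> 'a \<times> real" and l
  assume X: "\<forall>n. X n \<in> {z. fst z \<in> S \<and> F (fst z) \<le> ennreal (snd z)}" and l: "X \<longlonglongrightarrow> l"
  have l1: "(\<lambda>n. fst (X n)) \<longlonglongrightarrow> fst l" and l2: "(\<lambda>n. ennreal (snd (X n))) \<longlonglongrightarrow> ennreal (snd l)"
    using l by (auto intro: tendsto_fst tendsto_snd tendsto_ennrealI)
  have "fst l \<in> S"
    using X by (intro closed_sequentially[OF S _ l1]) auto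
  moreover have "F (fst l) \<le> liminf (\<lambda>n. F (fst (X n)))"
    using X by (intro lower_semicontinuous_on_le_liminf[OF S F l1]) auto
  then have "F (fst l) \<le> liminf (\<lambda>n. ennreal (snd (X n)))"
    using X by (elim order_trans) (auto intro: Liminf_mono)
  then have "F (fst l) \<le> ennreal (snd l)"
    using lim_imp_Liminf[OF _ l2] by simp
  ultimately show "l \<in> {z. fst z \<in> S \<and> F (fst z) \<le> ennreal (snd z)}" by simp
qed

text \<open>The condition \<open>0 \<le> snd z\<close> matters: \<open>ennreal\<close> maps negative
  reals to 0, so over zeros of F the set would otherwise contain points of arbitrarily negative
  height, and convexity could fail.\<close>

lemma convex_epigraph:
  assumes "convex_ennreal_on S F"
  shows "convex {z. fst z \<in> S \<and> 0 \<le> snd z \<and> F (fst z) \<le> ennreal (snd z)}"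
  unfolding convex_alt
proof (intro ballI allI impI, elim conjE)
  fix x y and t :: real
  assume x: "x \<in> {z. fst z \<in> S \<and> 0 \<le> snd z \<and> F (fst z) \<le> ennreal (snd z)}"
    and y: "y \<in> {z. fst z \<in> S \<and> 0 \<le> snd z \<and> F (fst z) \<le> ennreal (snd z)}"
    and t: "0 \<le> t" "t \<le> 1"
  have "F ((1 - t) *\<^sub>R fst x + t *\<^sub>R fst y) \<le> ennreal (1 - t) * F (fst x) + ennreal t * F (fst y)"
    using assms x y t unfolding convex_ennreal_on_def by auto
  also have "\<dots> \<le> ennreal (1 - t) * ennreal (snd x) + ennreal t * ennreal (snd y)"
    using x y by (intro add_mono mult_left_mono) auto
  also have "\<dots> = ennreal ((1 - t) * snd x + t * snd y)"
    using x y t by (simp add: ennreal_mult[symmetric] ennreal_plus[symmetric] del: ennreal_plus)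
  finally show "(1 - t) *\<^sub>R x + t *\<^sub>R y \<in> {z. fst z \<in> S \<and> 0 \<le> snd z \<and> F (fst z) \<le> ennreal (snd z)}"
    using assms x y t convexD_alt[of S "fst x" "fst y" t]
    by (simp add: convex_ennreal_on_def)
qed

lemma integral_Pair:
  fixes f :: "'a \<Rightarrow> 'b::euclidean_space" and g :: "'a \<Rightarrow> 'c::euclidean_space"
  assumes "integrable M f" "integrable M g"
  shows "integrable M (\<lambda>x. (f x, g x))"
    and "(\<integral>x. (f x, g x) \<partial>M) = (\<integral>x. f x \<partial>M, \<integral>x. g x \<partial>M)"
proof -
  have l: "bounded_linear (\<lambda>y::'b. (y, 0::'c))" and r: "bounded_linear (\<lambda>z::'c. (0::'b, z))"
    by (intro bounded_linear_Pair bounded_linear_ident bounded_linear_zero)+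
  have i: "integrable M (\<lambda>x. (f x, 0::'c))" "integrable M (\<lambda>x. (0::'b, g x))"
    using integrable_bounded_linear[OF l assms(1)] integrable_bounded_linear[OF r assms(2)] by auto
  have e: "(f x, g x) = (f x, 0) + (0, g x)" for x by simp
  show "integrable M (\<lambda>x. (f x, g x))"
    unfolding e by (rule Bochner_Integration.integrable_add[OF i])
  show "(\<integral>x. (f x, g x) \<partial>M) = (\<integral>x. f x \<partial>M, \<integral>x. g x \<partial>M)"
    unfolding e Bochner_Integration.integral_add[OF i]
      integral_bounded_linear[OF l assms(1)] integral_bounded_linear[OF r assms(2)]
    by simp
qed

text \<open>The pair \<open>(X, F X)\<close> lies in the epigraph of \<open>F\<close>, a closed convex set, hence so does its mean.\<close>

lemma (in prob_space) jensen_ennreal: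
  fixes X :: "'a \<Rightarrow> 'b::euclidean_space"
  assumes S: "closed S" and F: "convex_ennreal_on S F" "lower_semicontinuous_on S F"
    and X: "integrable M X" "\<And>x. X x \<in> S"
  shows "F (expectation X) \<le> (\<integral>\<^sup>+ x. F (X x) \<partial>M)"
proof (cases "(\<integral>\<^sup>+ x. F (X x) \<partial>M) = \<infinity>")
  case False
  let ?E = "{z. fst z \<in> S \<and> 0 \<le> snd z \<and> F (fst z) \<le> ennreal (snd z)}"
  have [measurable]: "(\<lambda>x. F (X x)) \<in> borel_measurable M"
    by (rule measurable_compose_lower_semicontinuous[OF S F(2) _ X(2)]) (use X(1) in auto)
  have fin: "AE x in M. F (X x) \<noteq> \<infinity>"
    using False by (intro nn_integral_PInf_AE) auto
  \<comment> \<open>The value of \<open>enn2real\<close> at \<infinity> affects only a null set, as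
    F (X x) is finite almost everywhere.\<close>
  define f where "f x = enn2real (F (X x))" for x
  have eq: "AE x in M. F (X x) = ennreal (f x)"
    using fin by eventually_elim (simp add: f_def less_top)
  then have nn: "(\<integral>\<^sup>+ x. ennreal (f x) \<partial>M) = (\<integral>\<^sup>+ x. F (X x) \<partial>M)"
    by (intro nn_integral_cong_AE) auto
  have f: "integrable M f"
    using False by (intro integrableI_nonneg) (auto simp: f_def[abs_def] nn[unfolded f_def] less_top)
  have E: "closed ?E"
  proof -
    have "?E = {z. fst z \<in> S \<and> F (fst z) \<le> ennreal (snd z)} \<inter> {z. 0 \<le> snd z}" by auto
    moreover have "closed {z::'b \<times> real. 0 \<le> snd z}"
      by (intro closed_Collect_le continuous_intros)
    ultimately show ?thesis using closed_epigraph[OF S F(2)] by (auto intro: closed_Int)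
  qed
  have "expectation (\<lambda>x. (X x, f x)) \<in> ?E"
  proof (rule expectation_in_closed_convex[OF _ E convex_epigraph[OF F(1)]])
    show "integrable M (\<lambda>x. (X x, f x))" using X(1) f by (rule integral_Pair)
    show "AE x in M. (X x, f x) \<in> ?E"
      using eq by eventually_elim (use X(2) in \<open>auto simp: f_def\<close>)
  qed
  moreover have "expectation (\<lambda>x. (X x, f x)) = (expectation X, expectation f)"
    using X(1) f by (rule integral_Pair)
  ultimately have "F (expectation X) \<le> ennreal (expectation f)" by simp
  also have "\<dots> = (\<integral>\<^sup>+ x. ennreal (f x) \<partial>M)"
    using f by (intro nn_integral_eq_integral[symmetric]) (auto simp: f_def)
  finally show ?thesis using nn by simp
qed simp


text \<open>Averages with equal weights suffice: the parallelogram identity compares two functions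
  with their midpoint only, and linear or convex bounds reach all members by induction without
  bookkeeping of weights.\<close>

inductive_set midpoint_hull :: "('a \<Rightarrow> 'b::real_vector) set \<Rightarrow> ('a \<Rightarrow> 'b) set" for A where
  base: "f \<in> A \<Longrightarrow> f \<in> midpoint_hull A"
| midpoint: "f \<in> midpoint_hull A \<Longrightarrow> g \<in> midpoint_hull A \<Longrightarrow>
    (\<lambda>x. (1 / 2) *\<^sub>R f x + (1 / 2) *\<^sub>R g x) \<in> midpoint_hull A"

lemma midpoint_hull_mono:
  assumes "A \<subseteq> B"
  shows "midpoint_hull A \<subseteq> midpoint_hull B"
proof
  show "f \<in> midpoint_hull B" if "f \<in> midpoint_hull A" for f
    using that by induction (use assms in \<open>auto intro: midpoint_hull.intros\<close>)
qed

lemma parallelogram_midpoint: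
  fixes x y :: "'a::real_inner"
  shows "(norm (x - y))\<^sup>2
    = 2 * (norm x)\<^sup>2 + 2 * (norm y)\<^sup>2 - 4 * (norm ((1 / 2) *\<^sub>R x + (1 / 2) *\<^sub>R y))\<^sup>2"
  by (simp add: power2_norm_eq_inner inner_simps inner_commute algebra_simps)

text \<open>Almost minimisers of the \<open>L\<^sup>2\<close> norm in the hulls of the tails are Cauchy in \<open>L\<^sup>2\<close> by the
  parallelogram identity, so strongly convergent; this replaces weak compactness.\<close>

lemma (in prob_space) convergent_midpoints:
  fixes \<sigma> :: "nat \<Rightarrow> 'a \<Rightarrow> 'b::euclidean_space"
  assumes m: "\<And>j. \<sigma> j \<in> borel_measurable M"
    and C: "\<And>j. (\<integral>\<^sup>+ x. ennreal ((norm (\<sigma> j x))\<^sup>2) \<partial>M) \<le> ennreal C" "0 \<le> C"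
  shows "\<exists>f. (\<forall>j. f j \<in> midpoint_hull (\<sigma> ` {j..})) \<and>
    (AE x in M. convergent (\<lambda>j. f j x)) \<and>
    (\<lambda>j. \<integral>\<^sup>+ x. ennreal (norm (f j x - lim (\<lambda>j. f j x))) \<partial>M) \<longlonglongrightarrow> 0"
proof -
  define V where "V k = midpoint_hull (\<sigma> ` {k..})" for k
  define Q where "Q f = (\<integral>x. (norm (f x))\<^sup>2 \<partial>M)" for f :: "'a \<Rightarrow> 'b"
  define \<rho> where "\<rho> k = 1 / real (Suc k)" for k
  have \<rho>: "0 < \<rho> k" "k \<le> l \<Longrightarrow> \<rho> l \<le> \<rho> k" for k l
    by (auto simp: \<rho>_def field_simps)
  have \<rho>_lim: "(\<lambda>k. \<rho> k) \<longlonglongrightarrow> 0"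
    unfolding \<rho>_def by (intro LIMSEQ_Suc lim_const_over_n)
  have V: "f \<in> borel_measurable M \<and> integrable M (\<lambda>x. (norm (f x))\<^sup>2) \<and> Q f \<le> C"
    if "f \<in> V k" for f k
    using that unfolding V_def
  proof induction
    case (base f)
    then obtain j where j: "f = \<sigma> j" by auto
    have [measurable]: "\<sigma> j \<in> borel_measurable M" by (rule m)
    have i: "integrable M (\<lambda>x. (norm (\<sigma> j x))\<^sup>2)"
      using C(1)[of j] by (intro integrableI_bounded) (auto simp: order_le_less_trans)
    moreover have "Q (\<sigma> j) \<le> C"
      using C(1)[of j] C(2) unfolding Q_def by (simp add: nn_integral_eq_integral[OF i])
    ultimately show ?case using m by (simp add: j)
  next
    case (midpoint f g)
    let ?h = "\<lambda>x. (1 / 2) *\<^sub>R f x + (1 / 2) *\<^sub>R g x"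
    have [measurable]: "f \<in> borel_measurable M" "g \<in> borel_measurable M" using midpoint by auto
    have i: "integrable M (\<lambda>x. (1 / 2) * (norm (f x))\<^sup>2 + (1 / 2) * (norm (g x))\<^sup>2)"
      using midpoint by auto
    have le: "(norm (?h x))\<^sup>2 \<le> (1 / 2) * (norm (f x))\<^sup>2 + (1 / 2) * (norm (g x))\<^sup>2" for x
      using parallelogram_midpoint[of "f x" "g x"] zero_le_power2[of "norm (f x - g x)"] by linarith
    have ih: "integrable M (\<lambda>x. (norm (?h x))\<^sup>2)"
      using le by (intro Bochner_Integration.integrable_bound[OF i]) auto
    have "Q ?h \<le> (\<integral>x. (1 / 2) * (norm (f x))\<^sup>2 + (1 / 2) * (norm (g x))\<^sup>2 \<partial>M)"
      unfolding Q_def by (rule integral_mono[OF ih i le])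
    also have "\<dots> = (1 / 2) * Q f + (1 / 2) * Q g"
      unfolding Q_def using midpoint by simp
    also have "\<dots> \<le> C" using midpoint by simp
    finally show ?case using ih by simp
  qed
  have Vm: "f \<in> borel_measurable M" and Vi: "integrable M (\<lambda>x. (norm (f x))\<^sup>2)" and QC: "Q f \<le> C"
    if "f \<in> V k" for f k
    using V[OF that] by auto
  have Q0: "0 \<le> Q f" for f by (simp add: Q_def)
  have V_mono: "f \<in> V k" if "f \<in> V l" "k \<le> l" for f k l
  proof -
    have "\<sigma> ` {l..} \<subseteq> \<sigma> ` {k..}" using that(2) by (intro image_mono) auto
    from midpoint_hull_mono[OF this] that(1) show ?thesis unfolding V_def by blast
  qed
  have \<sigma>V: "\<sigma> k \<in> V k" for k
    unfolding V_def by (rule midpoint_hull.base) simp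
  have V_ne: "V k \<noteq> {}" for k using \<sigma>V by blast
  \<comment> \<open>The tail hulls shrink, so these infima increase with k; being bounded by C they
    converge, and the gap D - d k enters the Cauchy bound.\<close>
  define d where "d k = Inf (Q ` V k)" for k
  have bdd: "bdd_below (Q ` V k)" for k using Q0 by (intro bdd_belowI2) auto
  have d_le: "d k \<le> Q f" if "f \<in> V k" for f k
    unfolding d_def using bdd that by (intro cInf_lower) auto
  have d_mono: "mono d"
    unfolding d_def by (intro monoI cInf_superset_mono image_mono subsetI bdd) (auto simp: V_ne intro: V_mono)
  have d_C: "d k \<le> C" for k
    using d_le[OF \<sigma>V] QC[OF \<sigma>V] by (rule order_trans)
  obtain D where D: "d \<longlonglongrightarrow> D" "\<And>k. d k \<le> D"
    using incseq_convergent[of d C] d_mono d_C by (auto simp: mono_def incseq_def)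
  have "\<exists>f\<in>V k. Q f < d k + \<rho> k" for k
  proof -
    have "Inf (Q ` V k) < d k + \<rho> k" using \<rho>(1) by (simp add: d_def)
    then show ?thesis using \<sigma>V cInf_lessD[of "Q ` V k"] by blast
  qed
  then obtain g where g: "\<And>k. g k \<in> V k" "\<And>k. Q (g k) < d k + \<rho> k" by metis
  \<comment> \<open>Twice the energies of \<open>g k\<close> and \<open>g l\<close> minus four times
    the energy of their midpoint, which is at least d k.\<close>
  define e where "e k = 2 * (D - d k) + 4 * \<rho> k" for k
  have cauchy: "(\<integral>x. (norm (g k x - g l x))\<^sup>2 \<partial>M) \<le> e k \<and> integrable M (\<lambda>x. (norm (g k x - g l x))\<^sup>2)"
    if "k \<le> l" for k l
  proof -
    have l: "g l \<in> V k" using g(1) that by (rule V_mono)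
    define h where "h x = (1 / 2) *\<^sub>R g k x + (1 / 2) *\<^sub>R g l x" for x
    have h: "h \<in> V k" using midpoint_hull.midpoint[OF g(1)[of k, unfolded V_def] l[unfolded V_def]]
      by (simp add: V_def h_def[abs_def])
    have eq: "(norm (g k x - g l x))\<^sup>2 = 2 * (norm (g k x))\<^sup>2 + 2 * (norm (g l x))\<^sup>2 - 4 * (norm (h x))\<^sup>2" for x
      unfolding h_def by (rule parallelogram_midpoint)
    have "(\<integral>x. (norm (g k x - g l x))\<^sup>2 \<partial>M) = 2 * Q (g k) + 2 * Q (g l) - 4 * Q h"
      unfolding eq Q_def using Vi[OF h] Vi[OF l] Vi[OF g(1)[of k]] by simp
    also have "\<dots> \<le> 2 * (d k + \<rho> k) + 2 * (D + \<rho> k) - 4 * d k"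
    proof -
      have "Q (g k) \<le> d k + \<rho> k" using g(2)[of k] by simp
      moreover have "Q (g l) \<le> D + \<rho> k"
        using \<rho>(2)[OF that] g(2)[of l] D(2)[of l] by linarith
      ultimately show ?thesis using d_le[OF h] by simp
    qed
    also have "\<dots> = e k" by (simp add: e_def)
    finally show ?thesis
      unfolding eq using Vi[OF h] Vi[OF l] Vi[OF g(1)[of k]] by auto
  qed
  have "(\<lambda>k. 2 * (D - d k) + 4 * \<rho> k) \<longlonglongrightarrow> 2 * (D - D) + 4 * 0"
    by (intro tendsto_intros D \<rho>_lim)
  then have e: "e \<longlonglongrightarrow> 0" by (simp add: e_def[abs_def])
  have ex: "\<exists>n\<ge>N. e n < (1 / 4) ^ j" for N j
  proof -
    have "\<forall>\<^sub>F n in sequentially. e n < (1 / 4) ^ j"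
      by (rule order_tendstoD(2)[OF e]) simp
    then obtain K where "\<And>n. n \<ge> K \<Longrightarrow> e n < (1 / 4) ^ j"
      unfolding eventually_sequentially by blast
    then show ?thesis by (intro exI[of _ "max N K"]) simp
  qed
  \<comment> \<open>The subsequence is so sparse that squared L^2 distances beyond stage j stay
    below 4^(-j); j \<le> n j keeps \<open>f j\<close> in the hull of the tail from j.\<close>
  have "\<exists>n. \<forall>j. (j \<le> n j \<and> e (n j) < (1 / 4) ^ j) \<and> n j < n (Suc j)"
  proof (rule dependent_nat_choice)
    show "\<exists>n\<ge>0. e n < (1 / 4) ^ 0" by (rule ex)
    show "\<exists>m. (Suc j \<le> m \<and> e m < (1 / 4) ^ Suc j) \<and> n < m" for n j
    proof -
      obtain m where "m \<ge> Suc (j + n)" "e m < (1 / 4) ^ Suc j" using ex by blast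
      then show ?thesis by (intro exI[of _ m]) simp
    qed
  qed
  then obtain n where n: "\<And>j. j \<le> n j" "\<And>j. e (n j) < (1 / 4) ^ j" "\<And>j. n j < n (Suc j)" by blast
  define f where "f j = g (n j)" for j
  have fV: "f j \<in> V j" for j unfolding f_def by (rule V_mono[OF g(1) n(1)])
  have fm[measurable]: "f j \<in> borel_measurable M" for j by (rule Vm[OF fV])
  have n_mono: "i \<le> j \<Longrightarrow> n i \<le> n j" for i j
    by (rule lift_Suc_mono_le[of n]) (auto intro: less_imp_le n(3))
  have L1: "(\<integral>\<^sup>+ x. ennreal (norm (f i x - f j x)) \<partial>M) \<le> ennreal ((1 / 2) ^ i)" if "i \<le> j" for i j
  proof -
    have c: "(\<integral>x. (norm (f i x - f j x))\<^sup>2 \<partial>M) \<le> (1 / 4) ^ i"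
      and ci: "integrable M (\<lambda>x. (norm (f i x - f j x))\<^sup>2)"
      using cauchy[OF n_mono[OF that]] n(2)[of i] unfolding f_def by auto
    \<comment> \<open>With weight 2^i the squared L^2 bound 4^(-i) becomes the L^1 bound 2^(-i),
      which is summable.\<close>
    have young: "t \<le> (1 / 2) ^ i / 2 + 2 ^ i / 2 * t\<^sup>2" for t :: real
    proof -
      define p where "p = (2::real) ^ i"
      have p: "0 < p" "(1 / 2) ^ i = 1 / p" by (simp_all add: p_def power_one_over)
      have "0 \<le> (p * t - 1)\<^sup>2 / (2 * p)" using p by simp
      also have "\<dots> = 1 / p / 2 + p / 2 * t\<^sup>2 - t"
        using p by (simp add: power2_eq_square field_simps)
      finally show ?thesis unfolding p(2) p_def[symmetric] by simp
    qed
    have "(\<integral>\<^sup>+ x. ennreal (norm (f i x - f j x)) \<partial>M)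
        \<le> (\<integral>\<^sup>+ x. ennreal ((1 / 2) ^ i / 2 + 2 ^ i / 2 * (norm (f i x - f j x))\<^sup>2) \<partial>M)"
      by (intro nn_integral_mono ennreal_leI young)
    also have "\<dots> = ennreal (\<integral>x. (1 / 2) ^ i / 2 + 2 ^ i / 2 * (norm (f i x - f j x))\<^sup>2 \<partial>M)"
      using ci by (intro nn_integral_eq_integral) auto
    also have "(\<integral>x. (1 / 2) ^ i / 2 + 2 ^ i / 2 * (norm (f i x - f j x))\<^sup>2 \<partial>M)
        = (1 / 2) ^ i / 2 + 2 ^ i / 2 * (\<integral>x. (norm (f i x - f j x))\<^sup>2 \<partial>M)"
      using ci by (simp add: prob_space)
    also have "\<dots> \<le> (1 / 2) ^ i / 2 + 2 ^ i / 2 * (1 / 4) ^ i"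
      using c by (intro add_left_mono mult_left_mono) auto
    also have "\<dots> = (1 / 2) ^ i"
    proof -
      have "(2::real) ^ i * (1 / 4) ^ i = (1 / 2) ^ i" by (simp flip: power_mult_distrib)
      then show ?thesis by simp
    qed
    finally show ?thesis by (simp add: ennreal_leI)
  qed
  have "(\<integral>\<^sup>+ x. (\<Sum>j. ennreal (norm (f j x - f (Suc j) x))) \<partial>M)
      = (\<Sum>j. \<integral>\<^sup>+ x. ennreal (norm (f j x - f (Suc j) x)) \<partial>M)"
    by (rule nn_integral_suminf) measurable
  also have "\<dots> \<le> (\<Sum>j. ennreal ((1 / 2) ^ j))"
    by (intro suminf_le L1 summableI) auto
  also have "\<dots> = ennreal 2"
    using suminf_geometric[of "1 / 2 :: real"] by (subst suminf_ennreal2) (simp_all add: summable_geometric)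
  finally have "(\<integral>\<^sup>+ x. (\<Sum>j. ennreal (norm (f j x - f (Suc j) x))) \<partial>M) \<noteq> \<infinity>"
    by (auto simp: top_unique)
  then have "AE x in M. (\<Sum>j. ennreal (norm (f j x - f (Suc j) x))) \<noteq> \<infinity>"
    by (intro nn_integral_PInf_AE) auto
  then have conv: "AE x in M. convergent (\<lambda>j. f j x)"
  proof eventually_elim
    case (elim x)
    then have "summable (\<lambda>j. norm (f j x - f (Suc j) x))"
      by (intro summable_suminf_not_top) auto
    then have "summable (\<lambda>j. f j x - f (Suc j) x)" by (rule summable_norm_cancel)
    then have "convergent (\<lambda>k. \<Sum>j<k. f j x - f (Suc j) x)" by (simp add: summable_iff_convergent)
    then obtain l where "(\<lambda>k. f 0 x - f k x) \<longlonglongrightarrow> l"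
      by (auto simp: sum_lessThan_telescope'[of "\<lambda>j. f j x"] convergent_def)
    from tendsto_diff[OF tendsto_const[of "f 0 x"] this]
    show ?case by (auto simp: convergent_def)
  qed
  \<comment> \<open>Fatou's lemma lets the second index in \<open>L1\<close> tend to
    infinity.\<close>
  have rate: "(\<integral>\<^sup>+ x. ennreal (norm (f i x - lim (\<lambda>j. f j x))) \<partial>M) \<le> ennreal ((1 / 2) ^ i)" for i
  proof -
    have "(\<integral>\<^sup>+ x. ennreal (norm (f i x - lim (\<lambda>j. f j x))) \<partial>M)
        = (\<integral>\<^sup>+ x. liminf (\<lambda>j. ennreal (norm (f i x - f j x))) \<partial>M)"
    proof (rule nn_integral_cong_AE)
      show "AE x in M. ennreal (norm (f i x - lim (\<lambda>j. f j x))) = liminf (\<lambda>j. ennreal (norm (f i x - f j x)))"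
        using conv
      proof eventually_elim
        case (elim x)
        then have "(\<lambda>j. ennreal (norm (f i x - f j x))) \<longlonglongrightarrow> ennreal (norm (f i x - lim (\<lambda>j. f j x)))"
          by (intro tendsto_ennrealI tendsto_norm tendsto_diff tendsto_const)
            (simp add: convergent_LIMSEQ_iff)
        then show ?case by (intro lim_imp_Liminf[symmetric]) auto
      qed
    qed
    also have "\<dots> \<le> liminf (\<lambda>j. \<integral>\<^sup>+ x. ennreal (norm (f i x - f j x)) \<partial>M)"
      by (rule nn_integral_liminf) measurable
    also have "\<dots> \<le> ennreal ((1 / 2) ^ i)"
      by (intro Liminf_le eventually_sequentiallyI[of i] L1) auto
    finally show ?thesis .
  qed
  have "(\<lambda>i. ennreal ((1 / 2) ^ i)) \<longlonglongrightarrow> ennreal 0"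
    by (intro tendsto_ennrealI LIMSEQ_realpow_zero) auto
  then have "(\<lambda>i. \<integral>\<^sup>+ x. ennreal (norm (f i x - lim (\<lambda>j. f j x))) \<partial>M) \<longlonglongrightarrow> 0"
    by (intro tendsto_sandwich[OF _ always_eventually[OF allI[OF rate]] tendsto_const]) simp_all
  with conv fV show ?thesis by (intro exI[of _ f]) (auto simp: V_def)
qed

section \<open>Transport of kernels to the limit law\<close>

lemma convex_ennreal_on_ennreal:
  assumes q: "convex_on S q" and nonneg: "\<And>x. x \<in> S \<Longrightarrow> 0 \<le> q x"
  shows "convex_ennreal_on S (\<lambda>x. ennreal (q x))"
  unfolding convex_ennreal_on_def
proof (intro conjI ballI)
  show "convex S" using q by (simp add: convex_on_def)
  fix x y and t :: real
  assume x: "x \<in> S" and y: "y \<in> S" and t: "t \<in> {0..1}"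
  have "ennreal (q ((1 - t) *\<^sub>R x + t *\<^sub>R y)) \<le> ennreal ((1 - t) * q x + t * q y)"
    using convex_onD[OF q, of t x y] x y t by (intro ennreal_leI) auto
  also have "\<dots> = ennreal (1 - t) * ennreal (q x) + ennreal t * ennreal (q y)"
    using nonneg[OF x] nonneg[OF y] t by (simp add: ennreal_mult ennreal_plus)
  finally show "ennreal (q ((1 - t) *\<^sub>R x + t *\<^sub>R y))
      \<le> ennreal (1 - t) * ennreal (q x) + ennreal t * ennreal (q y)" .
qed

text \<open>The convexity defect is exactly t (1 - t) b (x - y) (x - y). Nonnegativity is asked for
  only on differences from S because the form Tr(BXBX) used later is in general nonnegative only on
  symmetric X.\<close>

lemma convex_on_quadratic:
  fixes b :: "'a::real_normed_vector \<Rightarrow> 'a \<Rightarrow> real"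
  assumes "bounded_bilinear b" "convex S" and nonneg: "\<And>x y. x \<in> S \<Longrightarrow> y \<in> S \<Longrightarrow> 0 \<le> b (x - y) (x - y)"
  shows "convex_on S (\<lambda>x. b x x)"
proof (rule convex_onI)
  interpret bounded_bilinear b by fact
  fix t :: real and x y :: 'a assume t: "0 < t" "t < 1" and "x \<in> S" "y \<in> S"
  then have "0 \<le> t * (1 - t) * b (x - y) (x - y)"
    using nonneg[of x y] by simp
  also have "\<dots> = (1 - t) * b x x + t * b y y - b ((1 - t) *\<^sub>R x + t *\<^sub>R y) ((1 - t) *\<^sub>R x + t *\<^sub>R y)"
    by (simp add: add_left add_right diff_left diff_right scaleR_left scaleR_right algebra_simps)
  finally show "b ((1 - t) *\<^sub>R x + t *\<^sub>R y) ((1 - t) *\<^sub>R x + t *\<^sub>R y) \<le> (1 - t) * b x x + t * b y y"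
    by simp
qed fact

lemma lower_semicontinuous_on_ennreal:
  fixes q :: "'a::metric_space \<Rightarrow> real"
  assumes "continuous_on S q"
  shows "lower_semicontinuous_on S (\<lambda>x. ennreal (q x))"
  unfolding lower_semicontinuous_on_def
proof
  fix x assume "x \<in> S"
  show "ennreal (q x) \<le> Liminf (at x within S) (\<lambda>x. ennreal (q x))"
  proof (cases "at x within S = bot")
    case False
    have "((\<lambda>x. ennreal (q x)) \<longlongrightarrow> ennreal (q x)) (at x within S)"
      using assms \<open>x \<in> S\<close> by (intro tendsto_ennrealI) (auto simp: continuous_on_def)
    then show ?thesis using lim_imp_Liminf[OF False] by fastforce
  qed (simp add: le_Liminf_iff)
qed

lemma norm_square_convex_lower_semicontinuous:
  "convex_ennreal_on UNIV (\<lambda>x::'a::euclidean_space. ennreal ((norm x)\<^sup>2))"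
  "lower_semicontinuous_on UNIV (\<lambda>x::'a. ennreal ((norm x)\<^sup>2))"
proof -
  have "convex_on UNIV (\<lambda>x::'a. (norm x)\<^sup>2)"
    using convex_on_quadratic[OF bounded_bilinear_inner, of "UNIV :: 'a set"]
    by (simp add: power2_norm_eq_inner)
  then show "convex_ennreal_on UNIV (\<lambda>x::'a. ennreal ((norm x)\<^sup>2))"
    by (rule convex_ennreal_on_ennreal) simp
  show "lower_semicontinuous_on UNIV (\<lambda>x::'a. ennreal ((norm x)\<^sup>2))"
    by (intro lower_semicontinuous_on_ennreal continuous_intros)
qed

lemma integrable_inner_bounded:
  fixes h H :: "'a \<Rightarrow> 'b::euclidean_space"
  assumes h: "integrable M h" and H: "H \<in> borel_measurable M" and B: "\<And>y. norm (H y) \<le> B"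
  shows "integrable M (\<lambda>y. h y \<bullet> H y)"
proof (rule Bochner_Integration.integrable_bound)
  show "integrable M (\<lambda>y. norm (h y) * B)" using h by simp
  show "AE y in M. norm (h y \<bullet> H y) \<le> norm (norm (h y) * B)"
  proof (rule always_eventually, rule allI)
    fix y
    have "0 \<le> B" using norm_ge_zero B by (rule order_trans)
    have "norm (h y \<bullet> H y) \<le> norm (h y) * B"
      using Cauchy_Schwarz_ineq2[of "h y" "H y"] mult_left_mono[OF B[of y], of "norm (h y)"] by simp
    then show "norm (h y \<bullet> H y) \<le> norm (norm (h y) * B)" using \<open>0 \<le> B\<close> by simp
  qed
qed (use borel_measurable_integrable[OF h] H in measurable)

text \<open>The conditional expectation of \<open>\<tau> X\<close> given \<open>Y\<close> for a coupling \<open>(X, Y)\<close> with density \<open>w\<close>.\<close>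

definition transported ::
  "'a measure \<Rightarrow> ('a \<Rightarrow> 'a \<Rightarrow> real) \<Rightarrow> ('a \<Rightarrow> 'b::euclidean_space) \<Rightarrow> 'a \<Rightarrow> 'b" where
  "transported M w \<tau> y = (\<integral>x. w x y *\<^sub>R \<tau> x \<partial>M)"

text \<open>The set S will be the cone of positive semidefinite matrices.\<close>

locale transported_kernel = coupling M N w
  for M N :: "'a::euclidean_space measure" and w +
  fixes \<tau> :: "'a \<Rightarrow> 'b::euclidean_space" and S C
  assumes \<tau>_borel [measurable]: "\<tau> \<in> borel_measurable borel"
    and \<tau>_S: "\<And>x. \<tau> x \<in> S" and S: "closed S" "convex S"
    and \<tau>_C: "(\<integral>\<^sup>+ x. ennreal ((norm (\<tau> x))\<^sup>2) \<partial>M) \<le> ennreal C" and C: "0 \<le> C"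
begin

abbreviation "\<sigma> \<equiv> transported M w \<tau>"

lemma integrable_\<tau>2: "integrable M (\<lambda>x. (norm (\<tau> x))\<^sup>2)"
  by (rule integrable_of_moments(3)[OF M \<tau>_borel \<tau>_C])

lemma integral_\<tau>2: "(\<integral>x. (norm (\<tau> x))\<^sup>2 \<partial>M) \<le> C"
  using \<tau>_C C by (simp add: nn_integral_eq_integral[OF integrable_\<tau>2])

lemma integrable_\<tau>: "integrable M \<tau>"
  using integrable_of_moments(4)[OF M \<tau>_borel \<tau>_C] .

lemma prob_space_density: "prob_space (density M (\<lambda>x. ennreal (w x y)))"
  by (rule prob_spaceI) (simp add: emeasure_density w_fst)

lemma integrable_density_\<tau>: "integrable (density M (\<lambda>x. ennreal (w x y))) \<tau>"
proof -
  obtain B where B: "\<And>x y. w x y \<le> B" using w by (auto simp: coupling_density_def)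
  have "norm (w x y *\<^sub>R \<tau> x) \<le> norm (B *\<^sub>R \<tau> x)" for x
    using B[of x y] w_nonneg[of x y] by (simp add: mult_right_mono)
  then have "AE x in M. norm (w x y *\<^sub>R \<tau> x) \<le> norm (B *\<^sub>R \<tau> x)"
    by (rule always_eventually[OF allI])
  moreover have "integrable M (\<lambda>x. B *\<^sub>R \<tau> x)"
    by (intro integrable_scaleR_right integrable_\<tau>)
  moreover have "(\<lambda>x. w x y *\<^sub>R \<tau> x) \<in> borel_measurable M"
    by measurable
  ultimately have "integrable M (\<lambda>x. w x y *\<^sub>R \<tau> x)"
    by (rule Bochner_Integration.integrable_bound[rotated 2])
  then show ?thesis
    by (subst integrable_density) (auto simp: w_nonneg)
qed

lemma transported_eq: "\<sigma> y = (\<integral>x. \<tau> x \<partial>density M (\<lambda>x. ennreal (w x y)))"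
  unfolding transported_def by (subst integral_density) (auto simp: w_nonneg)

lemma transported_in: "\<sigma> y \<in> S"
proof -
  interpret K: prob_space "density M (\<lambda>x. ennreal (w x y))" by (rule prob_space_density)
  show ?thesis
    unfolding transported_eq
    by (rule K.expectation_in_closed_convex[OF integrable_density_\<tau> S]) (simp add: \<tau>_S)
qed

lemma borel_measurable_transported [measurable]: "\<sigma> \<in> borel_measurable borel"
proof -
  have [measurable]: "(\<lambda>z. w (snd z) (fst z)) \<in> borel_measurable (borel \<Otimes>\<^sub>M M)"
  proof -
    have "(\<lambda>z. (snd z, fst z)) \<in> (borel \<Otimes>\<^sub>M M) \<rightarrow>\<^sub>M borel \<Otimes>\<^sub>M borel" by measurable
    then show ?thesis
      using measurable_compose[OF _ w_measurable, of "\<lambda>z. (snd z, fst z)"] by (simp add: borel_prod)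
  qed
  show ?thesis
    unfolding transported_def[abs_def]
    by (rule M.borel_measurable_lebesgue_integral) (simp add: split_beta')
qed

text \<open>Jensen's inequality is applied under each conditional law, and integrating over y
  restores the first marginal. T is separate from S because F will live on all symmetric matrices
  while the kernel values lie in the semidefinite cone.\<close>

lemma nn_integral_transported_le:
  assumes T: "closed T" "S \<subseteq> T" and F: "convex_ennreal_on T F" "lower_semicontinuous_on T F"
  shows "(\<integral>\<^sup>+ y. F (\<sigma> y) \<partial>N) \<le> (\<integral>\<^sup>+ x. F (\<tau> x) \<partial>M)"
proof -
  have \<tau>T: "\<tau> x \<in> T" for x using \<tau>_S T(2) by blast
  have Fm[measurable]: "(\<lambda>x. F (\<tau> x)) \<in> borel_measurable borel"
    by (rule measurable_compose_lower_semicontinuous[OF T(1) F(2) \<tau>_borel \<tau>T])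
  have "F (\<sigma> y) \<le> (\<integral>\<^sup>+ x. ennreal (w x y) * F (\<tau> x) \<partial>M)" for y
  proof -
    interpret K: prob_space "density M (\<lambda>x. ennreal (w x y))" by (rule prob_space_density)
    have "F (\<sigma> y) \<le> (\<integral>\<^sup>+ x. F (\<tau> x) \<partial>density M (\<lambda>x. ennreal (w x y)))"
      unfolding transported_eq by (rule K.jensen_ennreal[OF T(1) F integrable_density_\<tau> \<tau>T])
    then show ?thesis by (simp add: nn_integral_density)
  qed
  then have "(\<integral>\<^sup>+ y. F (\<sigma> y) \<partial>N) \<le> (\<integral>\<^sup>+ y. \<integral>\<^sup>+ x. ennreal (w x y) * F (\<tau> x) \<partial>M \<partial>N)"
    by (rule nn_integral_mono)
  also have "\<dots> = (\<integral>\<^sup>+ z. F (\<tau> (fst z)) \<partial>P)"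
  proof -
    have "fst \<in> borel_measurable (borel :: ('a \<times> 'a) measure)"
      by (simp add: borel_prod[symmetric])
    from measurable_compose[OF this Fm]
    have "(\<lambda>z::'a \<times> 'a. F (\<tau> (fst z))) \<in> borel_measurable borel" .
    from nn_integral_coupling_measure(2)[OF this] show ?thesis by simp
  qed
  also have "\<dots> = (\<integral>\<^sup>+ x. F (\<tau> x) \<partial>M)"
    by (rule nn_integral_coupling_fst[of "\<lambda>x. F (\<tau> x)"]) measurable
  finally show ?thesis .
qed

lemma nn_integral_transported_square: "(\<integral>\<^sup>+ y. ennreal ((norm (\<sigma> y))\<^sup>2) \<partial>N) \<le> ennreal C"
proof -
  have "(\<integral>\<^sup>+ y. ennreal ((norm (\<sigma> y))\<^sup>2) \<partial>N) \<le> (\<integral>\<^sup>+ x. ennreal ((norm (\<tau> x))\<^sup>2) \<partial>M)"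
    by (intro nn_integral_transported_le[of UNIV] norm_square_convex_lower_semicontinuous) auto
  with \<tau>_C show ?thesis by (rule order_trans[rotated])
qed

text \<open>Tower property: \<sigma> conditions on the second coordinate, so its pairing with H(Y)
  is the mean of \<tau>(X) \<bullet> H(Y). On the coupling the two pairings differ only in the point
  at which H is evaluated.\<close>

lemma transported_difference:
  fixes H :: "'a \<Rightarrow> 'b"
  assumes H[measurable]: "H \<in> borel_measurable borel" and B: "\<And>x. norm (H x) \<le> B"
  shows "(\<integral>y. \<sigma> y \<bullet> H y \<partial>N) = (\<integral>z. \<tau> (fst z) \<bullet> H (snd z) \<partial>P)"
    and "(\<integral>x. \<tau> x \<bullet> H x \<partial>M) = (\<integral>z. \<tau> (fst z) \<bullet> H (fst z) \<partial>P)"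
    and "integrable P (\<lambda>z. \<tau> (fst z) \<bullet> H (snd z))" "integrable P (\<lambda>z. \<tau> (fst z) \<bullet> H (fst z))"
proof -
  have i: "integrable P (\<lambda>z. norm (\<tau> (fst z)) * B)"
    using integrable_coupling_fst[OF integrable_norm[OF integrable_\<tau>]] by simp
  have b: "norm (\<tau> x \<bullet> H y) \<le> norm (\<tau> x) * B" for x y
    using Cauchy_Schwarz_ineq2[of "\<tau> x" "H y"] mult_left_mono[OF B[of y], of "norm (\<tau> x)"] by simp
  then have b': "norm (\<tau> x \<bullet> H y) \<le> norm (norm (\<tau> x) * B)" for x y
    using abs_ge_self[of "norm (\<tau> x) * B"] unfolding real_norm_def by (rule order_trans)
  show 1: "integrable P (\<lambda>z. \<tau> (fst z) \<bullet> H (snd z))" "integrable P (\<lambda>z. \<tau> (fst z) \<bullet> H (fst z))"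
    using b' by (auto intro!: Bochner_Integration.integrable_bound[OF i])
  show "(\<integral>x. \<tau> x \<bullet> H x \<partial>M) = (\<integral>z. \<tau> (fst z) \<bullet> H (fst z) \<partial>P)"
    by (rule integral_coupling_fst[symmetric]) measurable
  have [measurable]: "(\<lambda>z. w (fst z) (snd z)) \<in> borel_measurable (M \<Otimes>\<^sub>M N)"
    unfolding measurable_cong_sets[OF sets_MN refl] by measurable
  have "integrable (M \<Otimes>\<^sub>M N) (\<lambda>z. w (fst z) (snd z) *\<^sub>R (\<tau> (fst z) \<bullet> H (snd z)))"
    using 1(1) unfolding coupling_measure_def
    by (subst (asm) integrable_density) (auto simp: w_nonneg)
  then have "(\<integral>y. (\<integral>x. w x y *\<^sub>R (\<tau> x \<bullet> H y) \<partial>M) \<partial>N)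
      = (\<integral>z. w (fst z) (snd z) *\<^sub>R (\<tau> (fst z) \<bullet> H (snd z)) \<partial>(M \<Otimes>\<^sub>M N))"
    using MN.integral_snd[of "\<lambda>x y. w x y *\<^sub>R (\<tau> x \<bullet> H y)"] by (simp add: split_beta')
  also have "\<dots> = (\<integral>z. \<tau> (fst z) \<bullet> H (snd z) \<partial>P)"
    unfolding coupling_measure_def by (subst integral_density) (auto simp: w_nonneg)
  also have "(\<integral>y. (\<integral>x. w x y *\<^sub>R (\<tau> x \<bullet> H y) \<partial>M) \<partial>N) = (\<integral>y. \<sigma> y \<bullet> H y \<partial>N)"
  proof (rule Bochner_Integration.integral_cong)
    fix y
    have "integrable M (\<lambda>x. w x y *\<^sub>R \<tau> x)"
      using integrable_density_\<tau>[of y] by (subst (asm) integrable_density) (auto simp: w_nonneg)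
    from integral_inner_left[OF this, of "H y"]
    show "(\<integral>x. w x y *\<^sub>R (\<tau> x \<bullet> H y) \<partial>M) = \<sigma> y \<bullet> H y"
      by (simp add: transported_def)
  qed simp
  finally show "(\<integral>y. \<sigma> y \<bullet> H y \<partial>N) = (\<integral>z. \<tau> (fst z) \<bullet> H (snd z) \<partial>P)" .
qed

text \<open>The difference is the mean of \<tau>(X) \<bullet> (H(X) - H(Y)). Young's inequality
  leaves s times the second moment of \<tau> and, through the modulus of H, 1/s times \<eta> plus a
  multiple of the transport cost.\<close>

lemma transported_difference_le:
  fixes H :: "'a \<Rightarrow> 'b"
  assumes H[measurable]: "H \<in> borel_measurable borel" and B: "\<And>x. norm (H x) \<le> B"
    and mod: "\<And>x y. (norm (H x - H y))\<^sup>2 \<le> \<eta> + \<kappa> * (norm (x - y))\<^sup>2" and "0 \<le> \<eta>" "0 \<le> \<kappa>"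
    and cost: "transport_cost M N w \<le> ennreal c" "0 \<le> c" and "0 < s"
  shows "(\<integral>x. \<tau> x \<bullet> H x \<partial>M) - (\<integral>y. \<sigma> y \<bullet> H y \<partial>N) \<le> s * C + (\<eta> + \<kappa> * c) / s"
proof -
  interpret P: prob_space P by (rule prob_space_coupling)
  note d = transported_difference[OF H B]
  have ic: "integrable P (\<lambda>z. (norm (fst z - snd z))\<^sup>2)"
    using cost unfolding transport_cost_def
    by (intro integrableI_bounded) (auto simp: order_le_less_trans)
  have cc: "(\<integral>z. (norm (fst z - snd z))\<^sup>2 \<partial>P) \<le> c"
    using cost unfolding transport_cost_def by (simp add: nn_integral_eq_integral[OF ic])
  have it: "integrable P (\<lambda>z. (norm (\<tau> (fst z)))\<^sup>2)"
    by (rule integrable_coupling_fst[OF integrable_\<tau>2])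
  have tC: "(\<integral>z. (norm (\<tau> (fst z)))\<^sup>2 \<partial>P) \<le> C"
    using integral_\<tau>2 by (subst integral_coupling_fst[of "\<lambda>x. (norm (\<tau> x))\<^sup>2"]) auto
  have pt: "\<tau> x \<bullet> H x - \<tau> x \<bullet> H y \<le> s * (norm (\<tau> x))\<^sup>2 + (\<eta> + \<kappa> * (norm (x - y))\<^sup>2) / s" for x y
  proof -
    let ?a = "norm (\<tau> x)" and ?b = "norm (H x - H y)"
    have "\<tau> x \<bullet> H x - \<tau> x \<bullet> H y \<le> ?a * ?b"
      using norm_cauchy_schwarz[of "\<tau> x" "H x - H y"] by (simp add: inner_diff_right)
    also have "\<dots> \<le> s * ?a\<^sup>2 + ?b\<^sup>2 / s"
      using \<open>0 < s\<close> by (intro young_weighted) auto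
    also have "\<dots> \<le> s * ?a\<^sup>2 + (\<eta> + \<kappa> * (norm (x - y))\<^sup>2) / s"
      using mod[of x y] \<open>0 < s\<close> by (intro add_left_mono divide_right_mono) auto
    finally show ?thesis .
  qed
  have "(\<integral>x. \<tau> x \<bullet> H x \<partial>M) - (\<integral>y. \<sigma> y \<bullet> H y \<partial>N)
      = (\<integral>z. \<tau> (fst z) \<bullet> H (fst z) - \<tau> (fst z) \<bullet> H (snd z) \<partial>P)"
    using d by simp
  also have "\<dots> \<le> (\<integral>z. s * (norm (\<tau> (fst z)))\<^sup>2 + (\<eta> + \<kappa> * (norm (fst z - snd z))\<^sup>2) / s \<partial>P)"
    using d(3,4) it ic by (intro integral_mono pt) auto
  also have "\<dots> = s * (\<integral>z. (norm (\<tau> (fst z)))\<^sup>2 \<partial>P) + (\<eta> + \<kappa> * (\<integral>z. (norm (fst z - snd z))\<^sup>2 \<partial>P)) / s"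
    using it ic by (simp add: P.prob_space)
  also have "\<dots> \<le> s * C + (\<eta> + \<kappa> * c) / s"
    using tC cc \<open>0 < s\<close> \<open>0 \<le> \<kappa>\<close>
    by (intro add_mono mult_left_mono divide_right_mono) auto
  finally show ?thesis .
qed

end

text \<open>Beyond distance d the increment is at most 2 B, hence at most (2 B / d) |x - y|. A
  modulus in this quadratic form can be integrated over a coupling and compared with its transport
  cost.\<close>

lemma uniformly_continuous_quadratic_modulus:
  fixes H :: "'a::real_normed_vector \<Rightarrow> 'b::real_normed_vector"
  assumes "uniformly_continuous_on UNIV H" and B: "\<And>x. norm (H x) \<le> B" and "0 < \<eta>"
  obtains \<kappa> where "0 \<le> \<kappa>" "\<And>x y. (norm (H x - H y))\<^sup>2 \<le> \<eta> + \<kappa> * (norm (x - y))\<^sup>2"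
proof -
  obtain d where d: "0 < d" "\<And>x y. dist x y < d \<Longrightarrow> dist (H x) (H y) < sqrt \<eta>"
    using assms(1,3) unfolding uniformly_continuous_on_def
    by (metis UNIV_I dist_commute real_sqrt_gt_0_iff)
  have "(norm (H x - H y))\<^sup>2 \<le> \<eta> + (2 * B / d)\<^sup>2 * (norm (x - y))\<^sup>2" for x y
  proof (cases "dist x y < d")
    case True
    from d(2)[OF this] have "norm (H x - H y) \<le> sqrt \<eta>" by (simp add: dist_norm)
    then have "(norm (H x - H y))\<^sup>2 \<le> (sqrt \<eta>)\<^sup>2" by (rule power_mono) simp
    then show ?thesis using \<open>0 < \<eta>\<close> by (simp add: add_increasing2)
  next
    case False
    have "norm (H x - H y) \<le> norm (H x) + norm (H y)" by (rule norm_triangle_ineq4)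
    also have "\<dots> \<le> 2 * B / d * d" using B[of x] B[of y] d(1) by simp
    also have "\<dots> \<le> 2 * B / d * norm (x - y)"
      using False d(1) order_trans[OF norm_ge_zero B[of x]]
      by (intro mult_left_mono) (auto simp: dist_norm)
    finally have "(norm (H x - H y))\<^sup>2 \<le> (2 * B / d * norm (x - y))\<^sup>2"
      by (intro power_mono) auto
    with \<open>0 < \<eta>\<close> show ?thesis unfolding power_mult_distrib[of _ "norm (x - y)"] by linarith
  qed
  then show thesis by (intro that[of "(2 * B / d)\<^sup>2"]) auto
qed


lemma sets_Collect_lim_in_closed:
  fixes f :: "nat \<Rightarrow> 'a::topological_space \<Rightarrow> 'b::euclidean_space"
  assumes "\<And>j. f j \<in> borel_measurable borel" and "closed A"
  shows "{x. lim (\<lambda>j. f j x) \<in> A} \<in> sets borel"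
proof -
  have "(\<lambda>x. lim (\<lambda>j. f j x)) \<in> borel_measurable borel"
    by (rule borel_measurable_lim_metric[OF assms(1)])
  from measurable_sets[OF this borel_closed[OF assms(2)]] show ?thesis
    by (simp add: vimage_def)
qed

text \<open>The last two conclusions are shaped so that later claims become instances: a convex
  functional needs only an eventual bound, and the linear one is an inequality, which fits the
  Poincare bound directly and gives the Stein identity through H and -H.\<close>

lemma kernel_limit:
  fixes M :: "nat \<Rightarrow> 'a::euclidean_space measure" and \<tau> :: "nat \<Rightarrow> 'a \<Rightarrow> 'b::euclidean_space"
  assumes M: "\<And>k. borel_prob (M k)" and N: "borel_prob N"
    and w: "\<And>k. coupling_density (M k) N (w k)"
    and cost: "(\<lambda>k. transport_cost (M k) N (w k)) \<longlonglongrightarrow> 0"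
    and \<tau>: "\<And>k. \<tau> k \<in> borel_measurable borel" "\<And>k x. \<tau> k x \<in> S"
    and S: "closed S" "convex S"
    and C: "\<And>k. (\<integral>\<^sup>+ x. ennreal ((norm (\<tau> k x))\<^sup>2) \<partial>M k) \<le> ennreal C" "0 \<le> C"
  obtains \<tau>' where "\<tau>' \<in> borel_measurable borel" "\<And>y. \<tau>' y \<in> S" "integrable N \<tau>'"
    "\<And>T F c. closed T \<Longrightarrow> S \<subseteq> T \<Longrightarrow> convex_ennreal_on T F \<Longrightarrow> lower_semicontinuous_on T F \<Longrightarrow>
      \<forall>\<^sub>F k in sequentially. (\<integral>\<^sup>+ x. F (\<tau> k x) \<partial>M k) \<le> c \<Longrightarrow> (\<integral>\<^sup>+ y. F (\<tau>' y) \<partial>N) \<le> c"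
    "\<And>H a l. uniformly_continuous_on UNIV H \<Longrightarrow> bounded (range H) \<Longrightarrow>
      (\<And>k. a k \<le> (\<integral>x. \<tau> k x \<bullet> H x \<partial>M k)) \<Longrightarrow> a \<longlonglongrightarrow> l \<Longrightarrow> l \<le> (\<integral>y. \<tau>' y \<bullet> H y \<partial>N)"
proof -
  interpret N: prob_space N using N by (simp add: borel_prob_def)
  have sets_N[measurable_cong]: "sets N = sets borel" using N by (simp add: borel_prob_def)
  have tk: "transported_kernel (M k) N (w k) (\<tau> k) S C" for k
    by unfold_locales (use M N w \<tau> S C in auto)
  define \<sigma> where "\<sigma> k = transported (M k) (w k) (\<tau> k)" for k
  have \<sigma>m[measurable]: "\<sigma> k \<in> borel_measurable borel" and \<sigma>S: "\<sigma> k y \<in> S"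
    and \<sigma>C: "(\<integral>\<^sup>+ y. ennreal ((norm (\<sigma> k y))\<^sup>2) \<partial>N) \<le> ennreal C" for k y
    using transported_kernel.borel_measurable_transported[OF tk]
      transported_kernel.transported_in[OF tk]
      transported_kernel.nn_integral_transported_square[OF tk]
    unfolding \<sigma>_def by auto
  have \<sigma>mN: "\<sigma> k \<in> borel_measurable N" for k by measurable
  obtain f where f: "\<And>j. f j \<in> midpoint_hull (\<sigma> ` {j..})"
    and conv: "AE y in N. convergent (\<lambda>j. f j y)"
    and L1: "(\<lambda>j. \<integral>\<^sup>+ y. ennreal (norm (f j y - lim (\<lambda>j. f j y))) \<partial>N) \<longlonglongrightarrow> 0"
    using N.convergent_midpoints[of \<sigma> C, OF \<sigma>mN \<sigma>C C(2)]
    by (elim exE conjE) (rule that, erule spec)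
  have \<sigma>i: "integrable N (\<sigma> k)" for k
    by (rule integrable_of_moments(4)[OF N \<sigma>m \<sigma>C])
  have hull: "h \<in> borel_measurable borel \<and> (\<forall>y. h y \<in> S) \<and> integrable N h"
    if "h \<in> midpoint_hull (\<sigma> ` K)" for h K
    using that
  proof induction
    case (midpoint g h)
    have "(1 / 2) *\<^sub>R g y + (1 / 2) *\<^sub>R h y \<in> S" for y
      using midpoint by (intro convexD[OF S(2)]) auto
    moreover have [measurable]: "g \<in> borel_measurable borel" "h \<in> borel_measurable borel"
      using midpoint by auto
    have "(\<lambda>y. (1 / 2) *\<^sub>R g y + (1 / 2) *\<^sub>R h y) \<in> borel_measurable borel" by measurable
    ultimately show ?case using midpoint by simp
  qed (use \<sigma>S \<sigma>i \<sigma>m in auto)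
  have fm[measurable]: "f j \<in> borel_measurable borel" and fS: "f j y \<in> S" and fi: "integrable N (f j)" for j y
    using hull[OF f] by auto
  \<comment> \<open>Where the sequence diverges, \<open>lim\<close> is arbitrary; falling back on
    \<open>f 0\<close> puts the values in S at every point. Testing membership in S instead of
    convergence makes measurability a matter of one closed set.\<close>
  define \<tau>' where "\<tau>' y = (if lim (\<lambda>j. f j y) \<in> S then lim (\<lambda>j. f j y) else f 0 y)" for y
  have lim: "AE y in N. (\<lambda>j. f j y) \<longlonglongrightarrow> \<tau>' y"
    using conv
  proof eventually_elim
    case (elim y)
    then have "(\<lambda>j. f j y) \<longlonglongrightarrow> lim (\<lambda>j. f j y)" by (simp add: convergent_LIMSEQ_iff)
    moreover from this have "lim (\<lambda>j. f j y) \<in> S"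
      by (rule closed_sequentially[OF S(1) fS])
    ultimately show ?case by (simp add: \<tau>'_def)
  qed
  have \<tau>'m[measurable]: "\<tau>' \<in> borel_measurable borel"
    unfolding \<tau>'_def[abs_def]
    using sets_Collect_lim_in_closed[OF fm S(1)]
    by (intro measurable_If borel_measurable_lim_metric) auto
  have \<tau>'S: "\<tau>' y \<in> S" for y using fS by (simp add: \<tau>'_def)
  have eq: "(\<integral>\<^sup>+ y. ennreal (norm (f j y - lim (\<lambda>j. f j y))) \<partial>N)
      = (\<integral>\<^sup>+ y. ennreal (norm (f j y - \<tau>' y)) \<partial>N)" for j
    by (rule nn_integral_cong_AE) (use lim in eventually_elim, simp add: limI)
  have L1': "(\<lambda>j. \<integral>\<^sup>+ y. ennreal (norm (f j y - \<tau>' y)) \<partial>N) \<longlonglongrightarrow> 0"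
    using L1 unfolding eq .
  have \<tau>'i: "integrable N \<tau>'"
  proof -
    have "\<forall>\<^sub>F j in sequentially. (\<integral>\<^sup>+ y. ennreal (norm (f j y - \<tau>' y)) \<partial>N) < 1"
      by (rule order_tendstoD(2)[OF L1']) simp
    then obtain j where "(\<integral>\<^sup>+ y. ennreal (norm (f j y - \<tau>' y)) \<partial>N) < 1"
      by (auto simp: eventually_sequentially)
    then have "integrable N (\<lambda>y. f j y - \<tau>' y)"
      by (intro integrableI_bounded) (auto intro: less_trans)
    from Bochner_Integration.integrable_diff[OF fi[of j] this] show ?thesis by simp
  qed
  have limit_F: "(\<integral>\<^sup>+ y. F (\<tau>' y) \<partial>N) \<le> c"
    if T: "closed T" "S \<subseteq> T" and F: "convex_ennreal_on T F" "lower_semicontinuous_on T F"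
      and bound: "\<forall>\<^sub>F k in sequentially. (\<integral>\<^sup>+ x. F (\<tau> k x) \<partial>M k) \<le> c" for T F c
  proof -
    have cv: "F ((1 - t) *\<^sub>R x + t *\<^sub>R y) \<le> ennreal (1 - t) * F x + ennreal t * F y"
      if "x \<in> T" "y \<in> T" "t \<in> {0..1}" for x y t
      using F(1) that unfolding convex_ennreal_on_def by blast
    obtain K where K: "\<And>k. k \<ge> K \<Longrightarrow> (\<integral>\<^sup>+ x. F (\<tau> k x) \<partial>M k) \<le> c"
      using bound by (auto simp: eventually_sequentially)
    have Fm: "(\<lambda>y. F (h y)) \<in> borel_measurable N" if "h \<in> borel_measurable borel" "\<And>y. h y \<in> S" for h
      using that T(2) measurable_cong_sets[OF sets_N refl]
      by (intro measurable_compose_lower_semicontinuous[OF T(1) F(2)]) auto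
    have h: "(\<integral>\<^sup>+ y. F (h y) \<partial>N) \<le> c" if "h \<in> midpoint_hull (\<sigma> ` {j..})" "j \<ge> K" for h j
      using that(1)
    proof induction
      case (base h)
      then obtain k where k: "h = \<sigma> k" "k \<ge> j" by auto
      have "(\<integral>\<^sup>+ y. F (\<sigma> k y) \<partial>N) \<le> (\<integral>\<^sup>+ x. F (\<tau> k x) \<partial>M k)"
        unfolding \<sigma>_def by (rule transported_kernel.nn_integral_transported_le[OF tk T F])
      also have "\<dots> \<le> c" using K k(2) \<open>j \<ge> K\<close> by simp
      finally show ?case by (simp add: k)
    next
      case (midpoint g h)
      have gS: "g y \<in> T" "h y \<in> T" for y using hull midpoint T(2) by blast+
      have [measurable]: "(\<lambda>y. F (g y)) \<in> borel_measurable N" "(\<lambda>y. F (h y)) \<in> borel_measurable N"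
        using hull midpoint by (auto intro!: Fm)
      have "F ((1 - 1 / 2) *\<^sub>R g y + (1 / 2) *\<^sub>R h y)
          \<le> ennreal (1 - 1 / 2) * F (g y) + ennreal (1 / 2) * F (h y)" for y
        by (rule cv[OF gS]) simp
      then have "(\<integral>\<^sup>+ y. F ((1 / 2) *\<^sub>R g y + (1 / 2) *\<^sub>R h y) \<partial>N)
          \<le> (\<integral>\<^sup>+ y. ennreal (1 - 1 / 2) * F (g y) + ennreal (1 / 2) * F (h y) \<partial>N)"
        by (intro nn_integral_mono) simp
      also have "\<dots> = ennreal (1 - 1 / 2) * (\<integral>\<^sup>+ y. F (g y) \<partial>N) + ennreal (1 / 2) * (\<integral>\<^sup>+ y. F (h y) \<partial>N)"
        by (simp only: nn_integral_add nn_integral_cmult borel_measurable_times_ennreal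
            borel_measurable_const \<open>(\<lambda>y. F (g y)) \<in> borel_measurable N\<close>
            \<open>(\<lambda>y. F (h y)) \<in> borel_measurable N\<close>)
      also have "\<dots> \<le> ennreal (1 - 1 / 2) * c + ennreal (1 / 2) * c"
        using midpoint by (intro add_mono mult_left_mono) auto
      also have "\<dots> = (ennreal (1 - 1 / 2) + ennreal (1 / 2)) * c"
        by (rule distrib_right[symmetric])
      also have "\<dots> = c"
        by (subst ennreal_plus[symmetric]) auto
      finally show ?case .
    qed
    have "(\<integral>\<^sup>+ y. F (\<tau>' y) \<partial>N) \<le> (\<integral>\<^sup>+ y. liminf (\<lambda>j. F (f j y)) \<partial>N)"
      using lim
      by (intro nn_integral_mono_AE, eventually_elim)
        (use fS T(2) in \<open>auto intro!: lower_semicontinuous_on_le_liminf[OF T(1) F(2)]\<close>)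
    also have "\<dots> \<le> liminf (\<lambda>j. \<integral>\<^sup>+ y. F (f j y) \<partial>N)"
      by (intro nn_integral_liminf Fm fm fS)
    also have "\<dots> \<le> c"
      by (intro Liminf_le eventually_sequentiallyI[of K] h[OF f]) auto
    finally show ?thesis .
  qed
  have limit_H: "l \<le> (\<integral>y. \<tau>' y \<bullet> H y \<partial>N)"
    if uc: "uniformly_continuous_on UNIV H" and bd: "bounded (range H)"
      and a: "\<And>k. a k \<le> (\<integral>x. \<tau> k x \<bullet> H x \<partial>M k)" "a \<longlonglongrightarrow> l" for H and a :: "nat \<Rightarrow> real" and l
  proof (rule field_le_epsilon)
    fix e :: real assume "0 < e"
    obtain B where B: "\<And>x. norm (H x) \<le> B" "0 < B" using bd by (auto simp: bounded_pos)
    have [measurable]: "H \<in> borel_measurable borel"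
      by (rule borel_measurable_continuous_onI[OF uniformly_continuous_imp_continuous[OF uc]])
    have int: "integrable N (\<lambda>y. h y \<bullet> H y)" if "integrable N h" for h
      by (rule integrable_inner_bounded[OF that _ B(1)]) measurable
    \<comment> \<open>Budget: s C \<le> e/8 for the kernels, e/4 for the oscillation of H along the
      coupling and e/4 for \<open>a k\<close>, together below 3 e/4; the last e/4 pays for replacing
      \<open>f j\<close> by its limit.\<close>
    define s where "s = e / (8 * (C + 1))"
    have s: "0 < s" using \<open>0 < e\<close> C(2) by (simp add: s_def)
    have "s * C = (e / 8) * (C / (C + 1))" using C(2) by (simp add: s_def field_simps)
    also have "\<dots> \<le> (e / 8) * 1" using C(2) \<open>0 < e\<close> by (intro mult_left_mono) auto
    finally have sC: "s * C \<le> e / 8" by simp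
    have "0 < s * e / 8" using s \<open>0 < e\<close> by simp
    from uniformly_continuous_quadratic_modulus[OF uc B(1) this]
    obtain \<kappa> where \<kappa>: "0 \<le> \<kappa>" "\<And>x y. (norm (H x - H y))\<^sup>2 \<le> s * e / 8 + \<kappa> * (norm (x - y))\<^sup>2" by blast
    define c where "c = s * e / (8 * (\<kappa> + 1))"
    have c: "0 < c" using s \<open>0 < e\<close> \<kappa>(1) by (simp add: c_def)
    have "\<kappa> * c = (s * e / 8) * (\<kappa> / (\<kappa> + 1))" using \<kappa>(1) by (simp add: c_def field_simps)
    also have "\<dots> \<le> (s * e / 8) * 1" using \<kappa>(1) s \<open>0 < e\<close> by (intro mult_left_mono) auto
    finally have \<kappa>c: "(s * e / 8 + \<kappa> * c) / s \<le> e / 4" using s by (simp add: field_simps)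
    have "\<forall>\<^sub>F k in sequentially. transport_cost (M k) N (w k) < ennreal c"
      using c by (intro order_tendstoD(2)[OF cost]) simp
    moreover have "\<forall>\<^sub>F k in sequentially. l - e / 4 < a k"
      using \<open>0 < e\<close> by (intro order_tendstoD(1)[OF a(2)]) simp
    ultimately have "\<forall>\<^sub>F k in sequentially. l - 3 * e / 4 \<le> (\<integral>y. \<sigma> k y \<bullet> H y \<partial>N)"
    proof eventually_elim
      case (elim k)
      have "(\<integral>x. \<tau> k x \<bullet> H x \<partial>M k) - (\<integral>y. \<sigma> k y \<bullet> H y \<partial>N) \<le> s * C + (s * e / 8 + \<kappa> * c) / s"
        unfolding \<sigma>_def using elim(1) c s \<open>0 < e\<close> \<kappa>
        by (intro transported_kernel.transported_difference_le[OF tk _ B(1)]) auto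
      then show ?case using elim(2) a(1)[of k] sC \<kappa>c \<open>0 < e\<close> by linarith
    qed
    then obtain K where K: "\<And>k. k \<ge> K \<Longrightarrow> l - 3 * e / 4 \<le> (\<integral>y. \<sigma> k y \<bullet> H y \<partial>N)"
      by (auto simp: eventually_sequentially)
    \<comment> \<open>A lower bound on a linear functional survives midpoints, hence holds on the
      hull of a late tail.\<close>
    have h: "l - 3 * e / 4 \<le> (\<integral>y. h y \<bullet> H y \<partial>N)" if "h \<in> midpoint_hull (\<sigma> ` {j..})" "j \<ge> K" for h j
      using that(1)
    proof induction
      case (midpoint g h)
      have "(\<integral>y. ((1 / 2) *\<^sub>R g y + (1 / 2) *\<^sub>R h y) \<bullet> H y \<partial>N)
          = (1 / 2) * (\<integral>y. g y \<bullet> H y \<partial>N) + (1 / 2) * (\<integral>y. h y \<bullet> H y \<partial>N)"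
        using hull midpoint(1,2) int by (simp add: inner_add_left)
      then show ?case using midpoint(3,4) by linarith
    qed (use K \<open>j \<ge> K\<close> in auto)
    have "\<forall>\<^sub>F j in sequentially. (\<integral>\<^sup>+ y. ennreal (norm (f j y - \<tau>' y)) \<partial>N) < ennreal (e / (4 * B))"
      using \<open>0 < e\<close> B(2) by (intro order_tendstoD(2)[OF L1']) simp
    then obtain J where J: "\<And>j. j \<ge> J \<Longrightarrow>
        (\<integral>\<^sup>+ y. ennreal (norm (f j y - \<tau>' y)) \<partial>N) < ennreal (e / (4 * B))"
      by (auto simp: eventually_sequentially)
    define j where "j = max J K"
    have ni: "integrable N (\<lambda>y. norm (f j y - \<tau>' y))" using fi \<tau>'i by simp
    have small: "(\<integral>y. norm (f j y - \<tau>' y) \<partial>N) < e / (4 * B)"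
      using J[of j] by (simp add: j_def nn_integral_eq_integral[OF ni[unfolded j_def]] ennreal_less_iff)
    have "(\<integral>y. f j y \<bullet> H y \<partial>N) - (\<integral>y. \<tau>' y \<bullet> H y \<partial>N) = (\<integral>y. (f j y - \<tau>' y) \<bullet> H y \<partial>N)"
      using int[OF fi] int[OF \<tau>'i] by (simp add: inner_diff_left)
    also have "\<dots> \<le> (\<integral>y. norm (f j y - \<tau>' y) * B \<partial>N)"
    proof (rule integral_mono)
      show "(f j y - \<tau>' y) \<bullet> H y \<le> norm (f j y - \<tau>' y) * B" for y
        using norm_cauchy_schwarz[of "f j y - \<tau>' y" "H y"]
          mult_left_mono[OF B(1)[of y], of "norm (f j y - \<tau>' y)"] by simp
      show "integrable N (\<lambda>y. (f j y - \<tau>' y) \<bullet> H y)"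
        by (intro int Bochner_Integration.integrable_diff fi \<tau>'i)
    qed (use ni in simp)
    also have "\<dots> = (\<integral>y. norm (f j y - \<tau>' y) \<partial>N) * B" by simp
    also have "\<dots> \<le> e / (4 * B) * B" using small B(2) by (intro mult_right_mono) auto
    also have "\<dots> = e / 4" using B(2) by simp
    finally have "(\<integral>y. f j y \<bullet> H y \<partial>N) - (\<integral>y. \<tau>' y \<bullet> H y \<partial>N) \<le> e / 4" .
    moreover have "l - 3 * e / 4 \<le> (\<integral>y. f j y \<bullet> H y \<partial>N)"
      by (rule h[OF f]) (simp add: j_def)
    ultimately show "l \<le> (\<integral>y. \<tau>' y \<bullet> H y \<partial>N) + e" by linarith
  qed
  show thesis
    by (rule that[OF \<tau>'m \<tau>'S \<tau>'i limit_F limit_H])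
qed

section \<open>Positive semidefinite matrices\<close>

lemma sym_matrices_iff: "A \<in> sym_matrices \<longleftrightarrow> (\<forall>u v. u \<bullet> (A *v v) = (A *v u) \<bullet> v)"
proof
  assume "A \<in> sym_matrices"
  then show "\<forall>u v. u \<bullet> (A *v v) = (A *v u) \<bullet> v"
    by (metis (mono_tags) dot_lmul_matrix mem_Collect_eq sym_matrices_def transpose_matrix_vector)
next
  assume *: "\<forall>u v. u \<bullet> (A *v v) = (A *v u) \<bullet> v"
  have "A $ i $ j = A $ j $ i" for i j
    using *[rule_format, of "axis i 1" "axis j 1"]
    by (simp add: inner_axis inner_axis' matrix_vector_mul_component row_def column_def
        matrix_vector_mult_basis)
  then show "A \<in> sym_matrices"
    by (simp add: sym_matrices_def transpose_def vec_eq_iff)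
qed

lemma sym_psd_sym: "sym_psd A \<Longrightarrow> A \<in> sym_matrices"
  by (simp add: sym_psd_def)

lemma sym_psd_nonneg: "sym_psd A \<Longrightarrow> 0 \<le> v \<bullet> (A *v v)"
  by (simp add: sym_psd_def)

lemma trace_sym_mult: "A \<in> sym_matrices \<Longrightarrow> trace (A ** B) = A \<bullet> B"
  by (simp add: hs_inner_eq_inner[symmetric] hs_inner_def sym_matrices_def)

lemma subspace_sym_matrices: "subspace sym_matrices"
  by (auto simp: subspace_def sym_matrices_def transpose_def vec_eq_iff)

lemma closed_convex_sym_matrices: "closed (sym_matrices :: (real^'n^'n) set)" "convex (sym_matrices :: (real^'n^'n) set)"
  using subspace_sym_matrices by (auto intro: closed_subspace subspace_imp_convex)

lemma sym_psd_0: "sym_psd 0"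
  by (simp add: sym_psd_def sym_matrices_def transpose_def vec_eq_iff)

lemma sym_psd_add: "sym_psd A \<Longrightarrow> sym_psd B \<Longrightarrow> sym_psd (A + B)"
  by (auto simp: sym_psd_def subspace_add[OF subspace_sym_matrices] matrix_vector_mult_add_rdistrib
      inner_add_right)

lemma sym_psd_scaleR: "sym_psd A \<Longrightarrow> 0 \<le> c \<Longrightarrow> sym_psd (c *\<^sub>R A)"
  by (auto simp: sym_psd_def subspace_scale[OF subspace_sym_matrices] scaleR_matrix_vector_assoc[symmetric])

lemma convex_sym_psd: "convex {A. sym_psd A}"
  by (auto intro!: convexI sym_psd_add sym_psd_scaleR)

lemma closed_sym_psd: "closed {A :: real^'n^'n. sym_psd A}"
proof -
  have "{A :: real^'n^'n. sym_psd A} = sym_matrices \<inter> (\<Inter>v. {A. 0 \<le> A \<bullet> (\<chi> i j. v $ i * v $ j)})"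
    by (auto simp: sym_psd_def inner_matrix_rank_one)
  moreover have "closed {A :: real^'n^'n. 0 \<le> A \<bullet> B}" for B
    by (intro closed_Collect_le continuous_intros)
  ultimately show ?thesis
    by (auto intro!: closed_Int closed_convex_sym_matrices closed_INT)
qed

lemma quadratic_form_rank_one:
  fixes c v :: "real^'n"
  shows "v \<bullet> ((\<chi> i j. c $ i * c $ j) *v v) = (c \<bullet> v)\<^sup>2"
  by (simp add: inner_vec_def matrix_vector_mult_def power2_eq_square sum_product
      sum_distrib_left mult_ac)

text \<open>One Cholesky step splits off a rank one matrix and increases the number of vanishing diagonal entries.\<close>

lemma sym_psd_inner_nonneg:
  fixes A B :: "real^'n^'n"
  assumes "sym_psd A" and B: "sym_psd B"
  shows "0 \<le> A \<bullet> B"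
  using assms(1)
proof (induction "card {i. A $ i $ i \<noteq> 0}" arbitrary: A rule: less_induct)
  case less
  note A = less.prems
  have entry: "axis i 1 \<bullet> (A *v axis j 1) = A $ i $ j" for i j
    by (simp add: inner_axis' matrix_vector_mult_basis column_def)
  have sym: "A $ i $ j = A $ j $ i" for i j
    using A by (auto simp: sym_psd_def sym_matrices_def transpose_def vec_eq_iff)
  show ?case
  proof (cases "\<exists>i. A $ i $ i \<noteq> 0")
    case False
    \<comment> \<open>With zero diagonal the form at e_i + t e_j reduces to 2 t A_ij, nonnegative
      for t = 1 and for t = -1.\<close>
    have "A $ i $ j = 0" for i j
    proof -
      have "0 \<le> 2 * t * A $ i $ j" for t
        using sym_psd_nonneg[OF A, of "axis i 1 + t *\<^sub>R axis j 1"] False sym[of i j]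
        by (simp add: matrix_vector_right_distrib matrix_vector_mult_scaleR inner_simps entry)
      from this[of 1] this[of "-1"] show ?thesis by simp
    qed
    then have "A = 0" by (simp add: vec_eq_iff)
    then show ?thesis by simp
  next
    case True
    then obtain i where i: "A $ i $ i \<noteq> 0" by blast
    define d where "d = A $ i $ i"
    have d: "0 < d"
      using i sym_psd_nonneg[OF A, of "axis i 1"] by (simp add: d_def entry)
    define c where "c = column i A"
    define R where "R = (\<chi> j k. c $ j * c $ k)"
    define A' where "A' = A - (1 / d) *\<^sub>R R"
    have c: "c $ j = A $ j $ i" for j by (simp add: c_def column_def)
    have Rv: "v \<bullet> (R *v v) = (c \<bullet> v)\<^sup>2" for v
      unfolding R_def by (rule quadratic_form_rank_one)
    have cv: "axis i 1 \<bullet> (A *v v) = c \<bullet> v" "v \<bullet> (A *v axis i 1) = c \<bullet> v" for v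
      using A[THEN sym_psd_sym, unfolded sym_matrices_iff, rule_format, of v "axis i 1"]
        A[THEN sym_psd_sym, unfolded sym_matrices_iff, rule_format, of "axis i 1" v]
      by (simp_all add: c_def matrix_vector_mult_basis inner_commute)
    have ci: "c \<bullet> axis i 1 = A $ i $ i" by (simp add: inner_axis c)
    have A'v: "v \<bullet> (A' *v v) = v \<bullet> (A *v v) - (c \<bullet> v)\<^sup>2 / d" for v
      by (simp add: A'_def matrix_vector_mult_diff_rdistrib scaleR_matrix_vector_assoc[symmetric]
          inner_diff_right Rv)
    have psd: "sym_psd A'"
      unfolding sym_psd_def
    proof (intro conjI allI)
      have "R \<in> sym_matrices"
        by (simp add: R_def sym_matrices_def transpose_def vec_eq_iff mult.commute)
      then show "A' \<in> sym_matrices"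
        unfolding A'_def using A
        by (intro subspace_diff subspace_scale subspace_sym_matrices) (auto dest: sym_psd_sym)
      fix v
      \<comment> \<open>This multiple of e_i minimises the form of A on the line v + t e_i, and the
        minimum is the form of the Schur complement A'.\<close>
      let ?t = "- (c \<bullet> v) / d"
      have "0 \<le> (v + ?t *\<^sub>R axis i 1) \<bullet> (A *v (v + ?t *\<^sub>R axis i 1))"
        by (rule sym_psd_nonneg[OF A])
      also have "\<dots> = v \<bullet> (A *v v) + 2 * ?t * (c \<bullet> v) + ?t\<^sup>2 * d"
        by (simp add: matrix_vector_right_distrib matrix_vector_mult_scaleR inner_simps cv ci entry d_def
            power2_eq_square algebra_simps)
      also have "\<dots> = v \<bullet> (A' *v v)"
        using d by (simp add: A'v field_simps power2_eq_square)
      finally show "0 \<le> v \<bullet> (A' *v v)" .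
    qed
    have diag: "A' $ j $ j = A $ j $ j - (A $ j $ i)\<^sup>2 / d" for j
      by (simp add: A'_def R_def c power2_eq_square)
    have "{j. A' $ j $ j \<noteq> 0} \<subset> {j. A $ j $ j \<noteq> 0}"
    proof
      show "{j. A' $ j $ j \<noteq> 0} \<subseteq> {j. A $ j $ j \<noteq> 0}"
      proof safe
        fix j assume "A $ j $ j = 0" "A' $ j $ j \<noteq> 0"
        moreover have "0 \<le> A' $ j $ j"
          using sym_psd_nonneg[OF psd, of "axis j 1"]
          by (simp add: inner_axis' matrix_vector_mult_basis column_def)
        moreover have "0 \<le> (A $ j $ i)\<^sup>2 / d" using d by simp
        ultimately show False unfolding diag by linarith
      qed
      have "A' $ i $ i = 0" using d by (simp add: diag d_def[symmetric] power2_eq_square)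
      with i show "{j. A' $ j $ j \<noteq> 0} \<noteq> {j. A $ j $ j \<noteq> 0}" by blast
    qed
    then have "0 \<le> A' \<bullet> B"
      by (intro less.hyps psd psubset_card_mono) auto
    moreover have "0 \<le> R \<bullet> B"
      using sym_psd_nonneg[OF B, of c] inner_matrix_rank_one[of B c c]
      by (simp add: R_def inner_commute)
    moreover have "A \<bullet> B = A' \<bullet> B + (1 / d) * (R \<bullet> B)"
      by (simp add: A'_def inner_diff_left)
    ultimately show ?thesis using d by simp
  qed
qed

lemma sym_psd_conjugate:
  assumes B: "sym_psd B" and T: "T \<in> sym_matrices"
  shows "sym_psd (T ** B ** T)"
proof -
  have T': "u \<bullet> (T *v v) = (T *v u) \<bullet> v" for u v
    using T by (simp add: sym_matrices_iff)
  have B': "u \<bullet> (B *v v) = (B *v u) \<bullet> v" for u v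
    using sym_psd_sym[OF B] by (simp add: sym_matrices_iff)
  have "T ** B ** T \<in> sym_matrices"
    unfolding sym_matrices_iff by (simp add: T' B' flip: matrix_vector_mul_assoc)
  moreover have "0 \<le> v \<bullet> ((T ** B ** T) *v v)" for v
    using sym_psd_nonneg[OF B, of "T *v v"] by (simp add: T' flip: matrix_vector_mul_assoc)
  ultimately show ?thesis by (simp add: sym_psd_def)
qed

text \<open>The trace pairs A with the congruence T B T, which is again semidefinite, so
  self-duality of the cone applies and no matrix square roots enter.\<close>

lemma trace_conjugate_nonneg:
  assumes "sym_psd A" "sym_psd B" "T \<in> sym_matrices"
  shows "0 \<le> trace (A ** T ** B ** T)"
proof -
  have "trace (A ** T ** B ** T) = A \<bullet> (T ** B ** T)"
    using trace_sym_mult[OF sym_psd_sym[OF assms(1)], of "T ** B ** T"] by (simp add: matrix_mul_assoc)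
  then show ?thesis
    using sym_psd_inner_nonneg[OF assms(1) sym_psd_conjugate[OF assms(2,3)]] by simp
qed

text \<open>\<open>P\<close> is the projection of \<open>A\<close> onto the self-dual cone; \<open>P + N\<close> will play the role of \<open>|A|\<close>.\<close>

lemma sym_matrix_moreau:
  fixes A :: "real^'n^'n"
  assumes A: "A \<in> sym_matrices"
  obtains P N where "sym_psd P" "sym_psd N" "A = P - N" "P \<bullet> N = 0"
proof -
  let ?K = "{B :: real^'n^'n. sym_psd B}"
  define P where "P = closest_point ?K A"
  have P: "sym_psd P"
    using closest_point_in_set[OF closed_sym_psd, of A] sym_psd_0 by (auto simp: P_def)
  have dot: "(A - P) \<bullet> (B - P) \<le> 0" if "sym_psd B" for B
    unfolding P_def using that
    by (intro closest_point_dot convex_sym_psd closed_sym_psd) auto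
  \<comment> \<open>The variational inequality at 2 P and at 0 gives both signs, hence
    orthogonality.\<close>
  have "(A - P) \<bullet> (2 *\<^sub>R P - P) \<le> 0" using P by (intro dot sym_psd_scaleR) auto
  moreover have "2 *\<^sub>R P - P = P" by (simp add: scaleR_2)
  ultimately have orth: "(A - P) \<bullet> P = 0" using dot[OF sym_psd_0] by simp
  have "sym_psd (P - A)"
    unfolding sym_psd_def
  proof (intro conjI allI)
    show "P - A \<in> sym_matrices"
      using P A by (intro subspace_diff subspace_sym_matrices) (auto dest: sym_psd_sym)
    fix v :: "real^'n"
    let ?R = "\<chi> i j. v $ i * v $ j"
    have R: "sym_psd ?R"
      by (simp add: sym_psd_def quadratic_form_rank_one) (simp add: sym_matrices_def transpose_def mult.commute)
    \<comment> \<open>Moving from P in the direction v v^T isolates the form of P - A at v.\<close>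
    from dot[OF sym_psd_add[OF P R]] have "0 \<le> (P - A) \<bullet> ?R"
      by (simp add: inner_diff_left)
    then show "0 \<le> v \<bullet> ((P - A) *v v)" by (simp add: inner_matrix_rank_one)
  qed
  moreover have "P \<bullet> (P - A) = 0"
    using orth inner_commute[of P A] by (simp add: inner_diff_left inner_diff_right)
  ultimately show thesis using that[of P "P - A"] P by simp
qed

lemma matrix_add_distribs:
  fixes A B C :: "real^'n^'n"
  shows "(A + B) ** C = A ** C + B ** C" "C ** (A + B) = C ** A + C ** B"
    "(A - B) ** C = A ** C - B ** C" "C ** (A - B) = C ** A - C ** B"
  by (simp_all add: matrix_matrix_mult_def vec_eq_iff algebra_simps sum.distrib sum_subtractf)

lemma bounded_bilinear_trace:
  fixes A B :: "real^'n^'n"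
  shows "bounded_bilinear (\<lambda>T T'. trace (A ** T ** B ** T'))"
proof -
  have scale: "trace (c *\<^sub>R X) = c * trace X" for c and X :: "real^'n^'n"
    by (simp add: trace_def sum_distrib_left)
  have "bilinear (\<lambda>T T'. trace (A ** T ** B ** T'))"
    unfolding bilinear_def
    by (intro conjI allI linearI)
      (simp_all only: matrix_add_distribs trace_add matrix_scalar_ac scalar_matrix_assoc[symmetric]
        scale real_scaleR_def)
  then show ?thesis by (simp add: bilinear_conv_bounded_bilinear)
qed

text \<open>Only positive semidefinite \<open>A\<close> make \<open>T \<mapsto> Tr(ATAT)\<close> convex; replacing \<open>A = P - N\<close> by
  \<open>P + N\<close> increases \<open>Tr(ATAT)\<close> for positive semidefinite \<open>T\<close> and keeps \<open>Tr(A\<^sup>2)\<close>.\<close>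

lemma sym_matrix_absolute_value:
  fixes A :: "real^'n^'n"
  assumes "A \<in> sym_matrices"
  obtains B where "sym_psd B" "trace (B ** B) = trace (A ** A)"
    "\<And>T. sym_psd T \<Longrightarrow> trace (A ** T ** A ** T) \<le> trace (B ** T ** B ** T)"
proof -
  obtain P N where P: "sym_psd P" and N: "sym_psd N" and A: "A = P - N" and orth: "P \<bullet> N = 0"
    using sym_matrix_moreau[OF assms] by blast
  have B: "sym_psd (P + N)" by (rule sym_psd_add[OF P N])
  have "trace ((P + N) ** (P + N)) = trace (A ** A)"
    unfolding trace_sym_mult[OF sym_psd_sym[OF B]] trace_sym_mult[OF assms]
    using orth by (simp add: A inner_simps inner_commute)
  moreover have "trace (A ** T ** A ** T) \<le> trace ((P + N) ** T ** (P + N) ** T)" if T: "sym_psd T" for T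
  proof -
    \<comment> \<open>Replacing P - N by P + N changes the trace by twice the sum of these two cross
      terms.\<close>
    have "0 \<le> trace (P ** T ** N ** T)" "0 \<le> trace (N ** T ** P ** T)"
      using P N sym_psd_sym[OF T] by (auto intro: trace_conjugate_nonneg)
    then show ?thesis
      unfolding A matrix_add_distribs trace_add trace_sub by simp
  qed
  ultimately show thesis using B that by blast
qed

section \<open>Limits of moments and test functions\<close>

text \<open>The truncation min(|y|^4, n) is bounded and continuous, so the bound passes through weak
  convergence at each level n, and Fatou's lemma lets n grow.\<close>

lemma fourth_moment_limit:
  fixes M :: "nat \<Rightarrow> 'a::euclidean_space measure"
  assumes M: "\<And>k. borel_prob (M k)" and N: "borel_prob N" and conv: "weakly_converges M N"
    and D: "\<And>k. (\<integral>\<^sup>+ x. ennreal (norm x ^ 4) \<partial>M k) \<le> ennreal D" "0 \<le> D"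
  shows "(\<integral>\<^sup>+ y. ennreal (norm y ^ 4) \<partial>N) \<le> ennreal D"
proof -
  interpret N: prob_space N using N by (simp add: borel_prob_def)
  have [measurable_cong]: "sets N = sets borel" using N by (simp add: borel_prob_def)
  define g where "g n x = min (norm x ^ 4) (real n)" for n and x :: 'a
  have g: "0 \<le> g n x" "g n x \<le> real n" for n x by (auto simp: g_def)
  have cont: "continuous_on UNIV (g n)" for n
    unfolding g_def by (intro continuous_intros)
  have [measurable]: "g n \<in> borel_measurable borel" for n
    by (rule borel_measurable_continuous_onI[OF cont])
  have bound: "(\<integral>\<^sup>+ y. ennreal (g n y) \<partial>N) \<le> ennreal D" for n
  proof -
    have "bounded (range (g n))"
      unfolding bounded_iff using g by (intro exI[of _ "real n"]) auto
    then have "(\<lambda>k. \<integral>x. g n x \<partial>M k) \<longlonglongrightarrow> (\<integral>y. g n y \<partial>N)"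
      using conv cont unfolding weakly_converges_def by blast
    moreover have "(\<integral>x. g n x \<partial>M k) \<le> D" for k
    proof -
      interpret M: prob_space "M k" using M by (simp add: borel_prob_def)
      have [measurable_cong]: "sets (M k) = sets borel" using M by (simp add: borel_prob_def)
      have i: "integrable (M k) (g n)"
        using g by (auto intro!: M.integrable_const_bound[where B = "real n"])
      have "ennreal (\<integral>x. g n x \<partial>M k) = (\<integral>\<^sup>+ x. ennreal (g n x) \<partial>M k)"
        using i g by (intro nn_integral_eq_integral[symmetric]) auto
      also have "\<dots> \<le> (\<integral>\<^sup>+ x. ennreal (norm x ^ 4) \<partial>M k)"
        by (intro nn_integral_mono ennreal_leI) (simp add: g_def)
      also have "\<dots> \<le> ennreal D" by (rule D)
      finally show ?thesis using D(2) by simp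
    qed
    ultimately have "(\<integral>y. g n y \<partial>N) \<le> D" by (intro LIMSEQ_le_const2) auto
    moreover have "integrable N (g n)"
      using g by (auto intro!: N.integrable_const_bound[where B = "real n"])
    ultimately show ?thesis using g by (simp add: nn_integral_eq_integral ennreal_leI)
  qed
  have "(\<lambda>n. ennreal (g n y)) \<longlonglongrightarrow> ennreal (norm y ^ 4)" for y
  proof (rule tendsto_eventually)
    obtain K where "norm y ^ 4 \<le> real K" using real_arch_simple by blast
    then show "\<forall>\<^sub>F n in sequentially. ennreal (g n y) = ennreal (norm y ^ 4)"
      by (intro eventually_sequentiallyI[of K]) (simp add: g_def min_def)
  qed
  then have "(\<integral>\<^sup>+ y. ennreal (norm y ^ 4) \<partial>N) = (\<integral>\<^sup>+ y. liminf (\<lambda>n. ennreal (g n y)) \<partial>N)"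
    by (intro nn_integral_cong lim_imp_Liminf[symmetric]) auto
  also have "\<dots> \<le> liminf (\<lambda>n. \<integral>\<^sup>+ y. ennreal (g n y) \<partial>N)"
    by (rule nn_integral_liminf) measurable
  also have "\<dots> \<le> ennreal D"
    by (intro Liminf_le always_eventually allI bound) auto
  finally show ?thesis .
qed

lemma integrable_quadratic_growth:
  fixes f :: "'a::euclidean_space \<Rightarrow> real"
  assumes M: "borel_prob M" and i: "integrable M (\<lambda>x. (norm x)\<^sup>2)"
    and f: "f \<in> borel_measurable borel" and growth: "\<And>x y. \<bar>f x - f y\<bar> \<le> K * (norm (x - y) * (1 + norm x + norm y))"
  shows "integrable M f"
proof (rule Bochner_Integration.integrable_bound)
  interpret M: prob_space M using M by (simp add: borel_prob_def)
  have sets[measurable_cong]: "sets M = sets borel" using M by (simp add: borel_prob_def)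
  show "integrable M (\<lambda>x. \<bar>f 0\<bar> + \<bar>K\<bar> * (1 + 2 * (norm x)\<^sup>2))"
    using i by simp
  show "f \<in> borel_measurable M" using f measurable_cong_sets[OF sets refl] by blast
  show "AE x in M. norm (f x) \<le> norm (\<bar>f 0\<bar> + \<bar>K\<bar> * (1 + 2 * (norm x)\<^sup>2))"
  proof (rule always_eventually, rule allI)
    fix x :: 'a
    have "norm x \<le> 1 + (norm x)\<^sup>2"
      using zero_le_power2[of "norm x - 1 / 2"] by (simp add: power2_eq_square algebra_simps)
    then have "norm x * (1 + norm x) \<le> 1 + 2 * (norm x)\<^sup>2"
      by (simp add: power2_eq_square algebra_simps)
    then have "K * (norm x * (1 + norm x)) \<le> \<bar>K\<bar> * (1 + 2 * (norm x)\<^sup>2)"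
      by (intro mult_mono) auto
    then have "\<bar>f x\<bar> \<le> \<bar>f 0\<bar> + \<bar>K\<bar> * (1 + 2 * (norm x)\<^sup>2)"
      using growth[of x 0] by simp
    then show "norm (f x) \<le> norm (\<bar>f 0\<bar> + \<bar>K\<bar> * (1 + 2 * (norm x)\<^sup>2))" by simp
  qed
qed

text \<open>Linear and quadratic functions are unbounded, so weak convergence alone does not reach
  them. On a coupling, Young's inequality separates the vanishing transport cost from the growth
  factor, whose square is controlled by fourth moments.\<close>

lemma integral_convergence_of_couplings:
  fixes M :: "nat \<Rightarrow> 'a::euclidean_space measure"
  assumes M: "\<And>k. borel_prob (M k)" and N: "borel_prob N"
    and w: "\<And>k. coupling_density (M k) N (w k)"
    and cost: "(\<lambda>k. transport_cost (M k) N (w k)) \<longlonglongrightarrow> 0"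
    and D: "\<And>k. (\<integral>\<^sup>+ x. ennreal (norm x ^ 4) \<partial>M k) \<le> ennreal D"
      "(\<integral>\<^sup>+ y. ennreal (norm y ^ 4) \<partial>N) \<le> ennreal D" "0 \<le> D"
    and f: "f \<in> borel_measurable borel"
    and growth: "\<And>x y. \<bar>f x - f y\<bar> \<le> K * (norm (x - y) * (1 + norm x + norm y))" and "0 \<le> K"
  shows "(\<lambda>k. \<integral>x. f x \<partial>M k) \<longlonglongrightarrow> (\<integral>y. f y \<partial>N)"
proof -
  have N2: "integrable N (\<lambda>x. (norm x)\<^sup>2)" "integrable N (\<lambda>x. norm x ^ 4)" and M2: "integrable (M k) (\<lambda>x. (norm x)\<^sup>2)"
    "integrable (M k) (\<lambda>x. norm x ^ 4)" for k
    using integrable_of_moments(1,2)[OF M D(1)] integrable_of_moments(1,2)[OF N D(2)] by auto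
  have iN: "integrable N f" and iM: "integrable (M k) f" for k
    by (rule integrable_quadratic_growth[OF N N2(1) f growth], rule integrable_quadratic_growth[OF M M2(1) f growth])
  have bound: "\<bar>(\<integral>x. f x \<partial>M k) - (\<integral>y. f y \<partial>N)\<bar> \<le> K * (s * (9 + 6 * D) + c / s)"
    if c: "transport_cost (M k) N (w k) \<le> ennreal c" "0 \<le> c" and s: "0 < s" for k c s
  proof -
    interpret coupling "M k" N "w k" by unfold_locales (use M N w in auto)
    let ?P = "coupling_measure (M k) N (w k)"
    interpret P: prob_space ?P by (rule prob_space_coupling)
    have dM: "integrable ?P (\<lambda>z. h (fst z))" "(\<integral>z. h (fst z) \<partial>?P) = (\<integral>x. h x \<partial>M k)"
      if "integrable (M k) h" "h \<in> borel_measurable borel" for h :: "'a \<Rightarrow> real"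
      by (rule integrable_coupling_fst[OF that(1)], rule integral_coupling_fst[OF that(2)])
    have dN: "integrable ?P (\<lambda>z. h (snd z))" "(\<integral>z. h (snd z) \<partial>?P) = (\<integral>x. h x \<partial>N)"
      if "integrable N h" "h \<in> borel_measurable borel" for h :: "'a \<Rightarrow> real"
      by (rule integrable_coupling_snd[OF that(1)], rule integral_coupling_snd[OF that(2)])
    have ic: "integrable ?P (\<lambda>z. (norm (fst z - snd z))\<^sup>2)"
      using c unfolding transport_cost_def
      by (intro integrableI_bounded) (auto simp: order_le_less_trans)
    have cc: "(\<integral>z. (norm (fst z - snd z))\<^sup>2 \<partial>?P) \<le> c"
      using c unfolding transport_cost_def by (simp add: nn_integral_eq_integral[OF ic])
    have D4: "(\<integral>x. norm x ^ 4 \<partial>M k) \<le> D" "(\<integral>x. norm x ^ 4 \<partial>N) \<le> D"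
      using D(1)[of k] D(2,3) by (simp_all add: nn_integral_eq_integral[OF M2(2)] nn_integral_eq_integral[OF N2(2)])
    have pt: "\<bar>f x - f y\<bar> \<le> K * (s * (9 + 3 * norm x ^ 4 + 3 * norm y ^ 4) + (norm (x - y))\<^sup>2 / s)" for x y
    proof -
      let ?a = "norm x" and ?b = "norm y" and ?d = "norm (x - y)"
      have "?d * (1 + ?a + ?b) \<le> s * (1 + ?a + ?b)\<^sup>2 + ?d\<^sup>2 / s"
        using young_weighted[OF s, of "1 + ?a + ?b" ?d] by (simp add: mult.commute)
      \<comment> \<open>The source of 9 + 6 D: (1 + a + b)^2 \<le> 3 (1 + a^2 + b^2) and t^2 \<le> 1
        + t^4.\<close>
      also have "(1 + ?a + ?b)\<^sup>2 \<le> 9 + 3 * ?a ^ 4 + 3 * ?b ^ 4"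
      proof -
        have "(1 + ?a + ?b)\<^sup>2 \<le> 3 * (1 + ?a\<^sup>2 + ?b\<^sup>2)"
          using zero_le_power2[of "1 - ?a"] zero_le_power2[of "1 - ?b"] zero_le_power2[of "?a - ?b"]
          by (simp add: power2_eq_square algebra_simps)
        moreover have "t\<^sup>2 \<le> 1 + t ^ 4" for t :: real
          using zero_le_power2[of "t\<^sup>2 - 1 / 2"]
          by (simp add: power2_diff power_divide)
        from this[of ?a] this[of ?b] have "3 * (1 + ?a\<^sup>2 + ?b\<^sup>2) \<le> 9 + 3 * ?a ^ 4 + 3 * ?b ^ 4"
          by simp
        ultimately show ?thesis by linarith
      qed
      finally have "?d * (1 + ?a + ?b) \<le> s * (9 + 3 * ?a ^ 4 + 3 * ?b ^ 4) + ?d\<^sup>2 / s"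
        using s by simp
      then show ?thesis using growth[of x y] \<open>0 \<le> K\<close> by (meson mult_left_mono order_trans)
    qed
    have "(\<integral>x. f x \<partial>M k) - (\<integral>y. f y \<partial>N) = (\<integral>z. f (fst z) - f (snd z) \<partial>?P)"
      using dM[OF iM f] dN[OF iN f] by simp
    also have "\<bar>\<dots>\<bar> \<le> (\<integral>z. \<bar>f (fst z) - f (snd z)\<bar> \<partial>?P)"
      by (rule integral_abs_bound)
    also have "\<dots> \<le> (\<integral>z. K * (s * (9 + 3 * norm (fst z) ^ 4 + 3 * norm (snd z) ^ 4) + (norm (fst z - snd z))\<^sup>2 / s) \<partial>?P)"
      using dM(1)[OF iM f] dN(1)[OF iN f] dM(1)[OF M2(2)] dN(1)[OF N2(2)] ic
      by (intro integral_mono pt) auto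
    also have "\<dots> = K * (s * (9 + 3 * (\<integral>x. norm x ^ 4 \<partial>M k) + 3 * (\<integral>y. norm y ^ 4 \<partial>N))
        + (\<integral>z. (norm (fst z - snd z))\<^sup>2 \<partial>?P) / s)"
      using dM[OF M2(2)] dN[OF N2(2)] ic by (simp add: P.prob_space)
    also have "\<dots> \<le> K * (s * (9 + 6 * D) + c / s)"
    proof -
      have "9 + 3 * (\<integral>x. norm x ^ 4 \<partial>M k) + 3 * (\<integral>y. norm y ^ 4 \<partial>N) \<le> 9 + 6 * D"
        using D4 by linarith
      then show ?thesis
        by (rule mult_left_mono[OF add_mono[OF mult_left_mono divide_right_mono[OF cc]]])
          (use s \<open>0 \<le> K\<close> in auto)
    qed
    finally show ?thesis .
  qed
  show ?thesis
  proof (rule LIMSEQ_I)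
    fix e :: real assume "0 < e"
    \<comment> \<open>Both error terms become e / (4 (K + 1)), so K times their sum is at most e /
      2; K + 1 instead of K covers K = 0.\<close>
    define s where "s = e / (4 * (K + 1) * (9 + 6 * D))"
    have s: "0 < s" using \<open>0 < e\<close> \<open>0 \<le> K\<close> D(3) by (simp add: s_def)
    define c where "c = s * e / (4 * (K + 1))"
    have c: "0 < c" using s \<open>0 < e\<close> \<open>0 \<le> K\<close> by (simp add: c_def)
    have "s * (9 + 6 * D) = e / (4 * (K + 1))" "c / s = e / (4 * (K + 1))"
      using s D(3) by (simp_all add: s_def c_def)
    then have "K * (s * (9 + 6 * D) + c / s) = K * (e / (4 * (K + 1)) + e / (4 * (K + 1)))"
      by simp
    also have "\<dots> = K / (K + 1) * (e / 2)"
    proof -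
      define q where "q = K + 1"
      have "0 < q" using \<open>0 \<le> K\<close> by (simp add: q_def)
      then show ?thesis unfolding q_def[symmetric] by (simp add: field_simps)
    qed
    also have "\<dots> \<le> 1 * (e / 2)" using \<open>0 \<le> K\<close> \<open>0 < e\<close> by (intro mult_right_mono) auto
    also have "\<dots> < e" using \<open>0 < e\<close> by simp
    finally have small: "K * (s * (9 + 6 * D) + c / s) < e" .
    have "\<forall>\<^sub>F k in sequentially. transport_cost (M k) N (w k) < ennreal c"
      using c by (intro order_tendstoD(2)[OF cost]) simp
    then obtain n where n: "\<And>k. k \<ge> n \<Longrightarrow> transport_cost (M k) N (w k) < ennreal c"
      by (auto simp: eventually_sequentially)
    have "norm ((\<integral>x. f x \<partial>M k) - (\<integral>y. f y \<partial>N)) < e" if "k \<ge> n" for k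
      using bound[OF less_imp_le[OF n[OF that]] less_imp_le[OF c] s] small by simp
    then show "\<exists>no. \<forall>k\<ge>no. norm ((\<integral>x. f x \<partial>M k) - (\<integral>y. f y \<partial>N)) < e" by blast
  qed
qed

text \<open>The ball of radius R + 1 leaves a margin: two points closer than 1 either both lie in
  it, where compactness applies, or both have norm above R, where f vanishes.\<close>

lemma continuous_compact_support_uniformly_continuous:
  fixes f :: "'a::euclidean_space \<Rightarrow> 'b::real_normed_vector"
  assumes f: "continuous_on UNIV f" and supp: "\<And>x. norm x > R \<Longrightarrow> f x = 0"
  shows "uniformly_continuous_on UNIV f" "bounded (range f)"
proof -
  let ?K = "cball (0::'a) (R + 1)"
  have fK: "continuous_on ?K f" using f by (rule continuous_on_subset) simp
  then have uc: "uniformly_continuous_on ?K f" by (rule compact_uniformly_continuous) simp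
  show "uniformly_continuous_on UNIV f"
    unfolding uniformly_continuous_on_def
  proof (intro allI impI)
    fix e :: real assume "0 < e"
    with uc[unfolded uniformly_continuous_on_def] obtain d where d: "0 < d"
      "\<forall>x\<in>?K. \<forall>x'\<in>?K. dist x' x < d \<longrightarrow> dist (f x') (f x) < e"
      by blast
    have "dist (f x') (f x) < e" if "dist x' x < min d 1" for x x'
    proof (cases "x \<in> ?K \<and> x' \<in> ?K")
      case False
      have "\<bar>norm x' - norm x\<bar> < 1"
        using norm_triangle_ineq3[of x' x] that by (simp add: dist_norm)
      with False have "R < norm x" "R < norm x'" by (auto simp: abs_if split: if_splits)
      then show ?thesis using supp \<open>0 < e\<close> by simp
    qed (use d that in auto)
    then show "\<exists>d>0. \<forall>x\<in>UNIV. \<forall>x'\<in>UNIV. dist x' x < d \<longrightarrow> dist (f x') (f x) < e"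
      using d(1) by (intro exI[of _ "min d 1"]) auto
  qed
  have "range f \<subseteq> insert 0 (f ` ?K)"
  proof safe
    fix x assume "f x \<notin> f ` ?K"
    then have "x \<notin> ?K" by blast
    then show "f x = 0" by (intro supp) simp
  qed
  moreover have "bounded (insert 0 (f ` ?K))"
    using compact_imp_bounded[OF compact_continuous_image[OF fK]] by simp
  ultimately show "bounded (range f)" by (rule bounded_subset[rotated])
qed

lemma test_function_derivative:
  fixes f :: "'a::euclidean_space \<Rightarrow> 'b::real_normed_vector"
  assumes "test_function f"
  obtains R where "continuous_on UNIV f" "\<And>x. norm x > R \<Longrightarrow> f x = 0"
    "\<And>v. continuous_on UNIV (\<lambda>x. frechet_derivative f (at x) v)"
    "\<And>x v. norm x > R \<Longrightarrow> frechet_derivative f (at x) v = 0"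
proof -
  let ?K = "closure {x. f x \<noteq> 0}"
  have "bounded ?K" using assms by (simp add: test_function_def compact_imp_bounded)
  then obtain R where R: "\<And>x. x \<in> ?K \<Longrightarrow> norm x \<le> R" unfolding bounded_iff by blast
  have out: "f x = 0" if "norm x > R" for x
    using R[of x] that closure_subset[of "{x. f x \<noteq> 0}"] by force
  have "C_k 0 f" "C_k 1 f" using assms by (auto simp: test_function_def smooth_def simp del: C_k.simps)
  moreover have "frechet_derivative f (at x) v = 0" if "norm x > R" for x v
  proof -
    \<comment> \<open>The complement of the closed support is open, so f vanishes near x and its
      derivative there is that of a constant.\<close>
    have x: "x \<in> - ?K" using R that by force
    have eq: "0 = f y" if "y \<in> - ?K" for y
      using that closure_subset[of "{x. f x \<noteq> 0}"] by auto
    have "(f has_derivative (\<lambda>v. 0)) (at x)"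
      by (rule has_derivative_transform_within_open[OF has_derivative_const _ x eq]) auto
    from frechet_derivative_at[OF this, symmetric] show ?thesis by simp
  qed
  ultimately show thesis using out that by auto
qed

lemma variance_weakly_converges:
  fixes g :: "'a::euclidean_space \<Rightarrow> real"
  assumes M: "\<And>k. borel_prob (M k)" and N: "borel_prob N" and conv: "weakly_converges M N"
    and g: "continuous_on UNIV g" "bounded (range g)"
  shows "(\<lambda>k. prob_space.variance (M k) g) \<longlonglongrightarrow> prob_space.variance N g"
proof -
  obtain B where B: "\<And>x. \<bar>g x\<bar> \<le> B" using g(2) by (auto simp: bounded_iff)
  have [measurable]: "g \<in> borel_measurable borel" by (rule borel_measurable_continuous_onI[OF g(1)])
  have sq: "\<bar>(g x)\<^sup>2\<bar> \<le> B\<^sup>2" for x using power_mono[OF B[of x], of 2] by simp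
  have eq: "prob_space.variance L g = (\<integral>x. (g x)\<^sup>2 \<partial>L) - (\<integral>x. g x \<partial>L)\<^sup>2" if L: "borel_prob L" for L
  proof -
    interpret L: prob_space L using L by (simp add: borel_prob_def)
    have [measurable_cong]: "sets L = sets borel" using L by (simp add: borel_prob_def)
    have "integrable L g" "integrable L (\<lambda>x. (g x)\<^sup>2)"
      by (rule L.integrable_const_bound[where B = B], use B in auto)
        (rule L.integrable_const_bound[where B = "B\<^sup>2"], use sq in auto)
    then show ?thesis by (rule L.variance_eq)
  qed
  have "(\<lambda>k. \<integral>x. g x \<partial>M k) \<longlonglongrightarrow> (\<integral>x. g x \<partial>N)"
    using conv g unfolding weakly_converges_def by blast
  moreover have "(\<lambda>k. \<integral>x. (g x)\<^sup>2 \<partial>M k) \<longlonglongrightarrow> (\<integral>x. (g x)\<^sup>2 \<partial>N)"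
  proof -
    have "continuous_on UNIV (\<lambda>x. (g x)\<^sup>2)" using g(1) by (intro continuous_intros)
    moreover have "bounded (range (\<lambda>x. (g x)\<^sup>2))"
      unfolding bounded_iff using sq by (intro exI[of _ "B\<^sup>2"]) auto
    ultimately show ?thesis using conv unfolding weakly_converges_def by blast
  qed
  ultimately show ?thesis
    unfolding eq[OF M] eq[OF N] by (intro tendsto_intros)
qed

section \<open>Limits of Stein kernels\<close>

lemma bilinear_form_rank_one:
  fixes u v x y :: "real^'n"
  shows "x \<bullet> ((\<chi> i j. u $ i * v $ j) *v y) = (x \<bullet> u) * (v \<bullet> y)"
  by (simp add: inner_vec_def matrix_vector_mult_def sum_product sum_distrib_left mult_ac)
    (rule sum.swap)

lemma integrable_bounded_bilinear_square:
  fixes f :: "'a \<Rightarrow> 'b::euclidean_space" and b :: "'b \<Rightarrow> 'b \<Rightarrow> real"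
  assumes b: "bounded_bilinear b" and f: "f \<in> borel_measurable M"
    and f2: "integrable M (\<lambda>x. (norm (f x))\<^sup>2)"
  shows "integrable M (\<lambda>x. b (f x) (f x))"
proof -
  obtain K where K: "\<And>x y. norm (b x y) \<le> norm x * norm y * K"
    using bounded_bilinear.bounded[OF b] by blast
  show ?thesis
  proof (rule Bochner_Integration.integrable_bound)
    show "integrable M (\<lambda>x. (norm (f x))\<^sup>2 * K)" using f2 by simp
    have "continuous_on UNIV (\<lambda>x. b x x)"
      by (intro bounded_bilinear.continuous_on[OF b] continuous_on_id)
    then show "(\<lambda>x. b (f x) (f x)) \<in> borel_measurable M"
      by (rule borel_measurable_continuous_on[OF _ f])
    have "norm (b (f x) (f x)) \<le> norm ((norm (f x))\<^sup>2 * K)" for x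
      using K[of "f x" "f x"] by (simp add: power2_eq_square)
    then show "AE x in M. norm (b (f x) (f x)) \<le> norm ((norm (f x))\<^sup>2 * K)"
      by (rule always_eventually[OF allI])
  qed
qed

theorem proposition4p2:
  fixes \<mu>s :: "nat \<Rightarrow> (real^'n) measure"
    and \<mu> :: "(real^'n) measure"
    and \<tau>s :: "nat \<Rightarrow> real^'n \<Rightarrow> real^'n^'n"
  assumes "\<And>k. borel_prob (\<mu>s k)"
    and "\<And>k. centered (\<mu>s k)"
    and "\<And>k. finite_second_moment (\<mu>s k)"
    and "borel_prob \<mu>"
    and "weakly_converges \<mu>s \<mu>"
    and "\<And>k. sym_psd_stein_kernel (\<mu>s k) (\<tau>s k)"
    and "(SUP k. \<integral>\<^sup>+ y. ennreal ((hs_norm (\<tau>s k y))\<^sup>2) \<partial>\<mu>s k) < \<infinity>"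
  shows "centered \<mu> \<and> W2_converges \<mu>s \<mu> \<and>
    (\<exists>\<tau>. sym_psd_stein_kernel \<mu> \<tau> \<and>
      integrable \<mu> \<tau> \<and> (\<integral>y. \<tau> y \<partial>\<mu>) = cov_matrix \<mu> \<and>
      (\<integral>\<^sup>+ y. ennreal ((hs_norm (\<tau> y))\<^sup>2) \<partial>\<mu>)
        \<le> liminf (\<lambda>k. \<integral>\<^sup>+ y. ennreal ((hs_norm (\<tau>s k y))\<^sup>2) \<partial>\<mu>s k) \<and>
      (\<forall>(F :: real^'n^'n \<Rightarrow> ennreal) (C\<^sub>F :: ennreal).
        convex_ennreal_on sym_matrices F \<and> lower_semicontinuous_on sym_matrices F \<and>
        (SUP k. \<integral>\<^sup>+ y. F (\<tau>s k y) \<partial>\<mu>s k) \<le> C\<^sub>F \<longrightarrow>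
        (\<integral>\<^sup>+ y. F (\<tau> y) \<partial>\<mu>) \<le> C\<^sub>F) \<and>
      (\<forall>C\<^sub>t\<^sub>r :: real.
        (\<forall>k. \<forall>A\<in>sym_matrices.
          prob_space.variance (\<mu>s k) (\<lambda>y. trace (A ** \<tau>s k y)) \<le> C\<^sub>t\<^sub>r * trace (A ** A)) \<longrightarrow>
        (\<forall>A\<in>sym_matrices.
          prob_space.variance \<mu> (\<lambda>y. trace (A ** \<tau> y)) \<le> C\<^sub>t\<^sub>r * trace (A ** A))) \<and>
      (\<forall>C\<^sub>e\<^sub>n :: real.
        (\<forall>k. \<forall>A\<in>sym_matrices.
          (\<integral>y. trace (A ** \<tau>s k y ** A ** \<tau>s k y) \<partial>\<mu>s k) \<le> C\<^sub>e\<^sub>n * trace (A ** A)) \<longrightarrow>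
        (\<forall>A\<in>sym_matrices.
          (\<integral>y. trace (A ** \<tau> y ** A ** \<tau> y) \<partial>\<mu>) \<le> C\<^sub>e\<^sub>n * trace (A ** A))) \<and>
      (\<forall>C\<^sub>w\<^sub>p :: real.
        (\<forall>k. \<forall>g :: real^'n \<Rightarrow> real. test_function g \<longrightarrow>
          prob_space.variance (\<mu>s k) g
            \<le> C\<^sub>w\<^sub>p * (\<integral>y. (\<tau>s k y *v grad g y) \<bullet> grad g y \<partial>\<mu>s k)) \<longrightarrow>
        (\<forall>g :: real^'n \<Rightarrow> real. test_function g \<longrightarrow>
          prob_space.variance \<mu> g
            \<le> C\<^sub>w\<^sub>p * (\<integral>y. (\<tau> y *v grad g y) \<bullet> grad g y \<partial>\<mu>))))"
proof -

  \<comment> \<open>Moment bounds and couplings\<close>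
  note prob = assms(1) and cent = assms(2) and prob_\<mu> = assms(4) and conv = assms(5) and kernel = assms(6)
  have \<tau>s_borel: "\<tau>s k \<in> borel_measurable borel" and \<tau>s_psd: "\<tau>s k y \<in> {A. sym_psd A}"
    and \<tau>s_stein: "stein_kernel (\<mu>s k) (\<tau>s k)" for k y
    using kernel[of k] by (simp_all add: sym_psd_stein_kernel_def stein_kernel_def)
  obtain C where C: "0 \<le> C" "(SUP k. \<integral>\<^sup>+ y. ennreal ((norm (\<tau>s k y))\<^sup>2) \<partial>\<mu>s k) = ennreal C"
    using assms(7) unfolding hs_norm_eq_norm
    by (cases "(SUP k. \<integral>\<^sup>+ y. ennreal ((norm (\<tau>s k y))\<^sup>2) \<partial>\<mu>s k)" rule: ennreal_cases) auto
  have \<tau>s_C: "(\<integral>\<^sup>+ y. ennreal ((norm (\<tau>s k y))\<^sup>2) \<partial>\<mu>s k) \<le> ennreal C" for k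
    unfolding C(2)[symmetric] by (rule SUP_upper) simp
  define D where "D = (norm (mat 1 :: real^'n^'n) + 2)\<^sup>2 * C"
  have D0: "0 \<le> D" using C(1) by (simp add: D_def)
  have D: "(\<integral>\<^sup>+ y. ennreal (norm y ^ 4) \<partial>\<mu>s k) \<le> ennreal D" for k
    unfolding D_def by (rule stein_fourth_moment[OF prob kernel \<tau>s_C C(1)])
  have D\<mu>: "(\<integral>\<^sup>+ y. ennreal (norm y ^ 4) \<partial>\<mu>) \<le> ennreal D"
    by (rule fourth_moment_limit[OF prob prob_\<mu> conv D D0])
  obtain w where w: "\<And>k. coupling_density (\<mu>s k) \<mu> (w k)"
    and cost: "(\<lambda>k. transport_cost (\<mu>s k) \<mu> (w k)) \<longlonglongrightarrow> 0"
    using exists_coupling_densities[OF prob prob_\<mu> conv D D\<mu> D0] by metis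
  interpret \<mu>: prob_space \<mu> using prob_\<mu> by (simp add: borel_prob_def)
  have sets_\<mu>[measurable_cong]: "sets \<mu> = sets borel" using prob_\<mu> by (simp add: borel_prob_def)
  have second_\<mu>: "integrable \<mu> (\<lambda>y. (norm y)\<^sup>2)"
    by (rule integrable_of_moments(2)[OF prob_\<mu> D\<mu>])

  \<comment> \<open>Convergence in the quadratic Wasserstein distance\<close>
  have "(\<lambda>k. W2 (\<mu>s k) \<mu>) \<longlonglongrightarrow> 0"
  proof (rule order_tendstoI)
    fix a :: real assume "a < 0"
    then show "\<forall>\<^sub>F k in sequentially. a < W2 (\<mu>s k) \<mu>"
      by (intro always_eventually allI) (auto simp: W2_def intro: less_le_trans)
  next
    fix a :: real assume "0 < a"
    then have "\<forall>\<^sub>F k in sequentially. transport_cost (\<mu>s k) \<mu> (w k) < ennreal ((a / 2)\<^sup>2)"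
      by (intro order_tendstoD(2)[OF cost]) simp
    then show "\<forall>\<^sub>F k in sequentially. W2 (\<mu>s k) \<mu> < a"
    proof eventually_elim
      case (elim k)
      interpret coupling "\<mu>s k" \<mu> "w k" by unfold_locales (use prob prob_\<mu> w in auto)
      have "W2 (\<mu>s k) \<mu> \<le> sqrt ((a / 2)\<^sup>2)" by (rule W2_le) (use elim in auto)
      with \<open>0 < a\<close> show ?case by simp
    qed
  qed
  then have W2: "W2_converges \<mu>s \<mu>"
    using prob prob_\<mu> assms(3) second_\<mu> by (simp add: W2_converges_def finite_second_moment_def)

  \<comment> \<open>Centering of the limit law\<close>
  have int_y: "integrable \<mu> (\<lambda>y. y)"
    by (rule Bochner_Integration.integrable_bound[of _ "\<lambda>y. 1 + (norm y)\<^sup>2"])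
      (use second_\<mu> le_one_plus_square[of "norm _"] in auto)
  have "(\<integral>y. y \<partial>\<mu>) = 0"
  \<comment> \<open>Pairing the mean b of \<mu> with itself reduces the vector limit to the scalar
    function y \<bullet> b, whose mean vanishes for every k.\<close>
  proof (rule inner_eq_zero_iff[THEN iffD1])
    let ?b = "\<integral>y. y \<partial>\<mu>"
    have "(\<lambda>k. \<integral>y. y \<bullet> ?b \<partial>\<mu>s k) \<longlonglongrightarrow> (\<integral>y. y \<bullet> ?b \<partial>\<mu>)"
    proof (rule integral_convergence_of_couplings[OF prob prob_\<mu> w cost D D\<mu> D0])
      show "\<bar>x \<bullet> ?b - y \<bullet> ?b\<bar> \<le> norm ?b * (norm (x - y) * (1 + norm x + norm y))" for x y
      proof -
        have "\<bar>x \<bullet> ?b - y \<bullet> ?b\<bar> \<le> norm (x - y) * norm ?b * 1"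
          using Cauchy_Schwarz_ineq2[of "x - y" ?b] by (simp add: inner_diff_left)
        also have "\<dots> \<le> norm (x - y) * norm ?b * (1 + norm x + norm y)"
          by (intro mult_left_mono) auto
        finally show ?thesis by (simp add: mult_ac)
      qed
    qed auto
    moreover have "(\<integral>y. y \<bullet> ?b \<partial>\<mu>s k) = 0" for k
      using cent[of k] unfolding centered_def by (subst integral_inner_left) auto
    ultimately have "(\<integral>y. y \<bullet> ?b \<partial>\<mu>) = 0"
      by (simp add: LIMSEQ_const_iff)
    then show "?b \<bullet> ?b = 0" using int_y by simp
  qed
  then have centered: "centered \<mu>" using int_y by (simp add: centered_def)

  \<comment> \<open>Choice of the subsequence and of the limit kernel\<close>
  let ?u = "\<lambda>k. \<integral>\<^sup>+ y. ennreal ((hs_norm (\<tau>s k y))\<^sup>2) \<partial>\<mu>s k"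
  \<comment> \<open>Along this subsequence the energies converge to their liminf. The hypotheses of
    (i) to (iv) hold for every k and are inherited, while their conclusions concern \<mu>
    only.\<close>
  obtain r where r: "strict_mono r" "(?u \<circ> r) \<longlonglongrightarrow> liminf ?u"
    using liminf_subseq_lim[of ?u] by blast
  define M where "M k = \<mu>s (r k)" for k
  define T where "T k = \<tau>s (r k)" for k
  have cost_r: "(\<lambda>k. transport_cost (M k) \<mu> (w (r k))) \<longlonglongrightarrow> 0"
    using LIMSEQ_subseq_LIMSEQ[OF cost r(1)] by (simp add: M_def comp_def)
  have conv_r: "weakly_converges M \<mu>"
    using conv LIMSEQ_subseq_LIMSEQ[OF _ r(1)]
    unfolding weakly_converges_def M_def by (fastforce simp: comp_def)
  have M: "borel_prob (M k)" and T_borel: "T k \<in> borel_measurable borel"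
    and T_psd: "T k y \<in> {A. sym_psd A}" and T_stein: "stein_kernel (M k) (T k)"
    and T_C: "(\<integral>\<^sup>+ y. ennreal ((norm (T k y))\<^sup>2) \<partial>M k) \<le> ennreal C"
    and M_D: "(\<integral>\<^sup>+ y. ennreal (norm y ^ 4) \<partial>M k) \<le> ennreal D"
    and w_r: "coupling_density (M k) \<mu> (w (r k))" for k y
    unfolding M_def T_def using prob \<tau>s_borel \<tau>s_psd \<tau>s_stein \<tau>s_C D w by auto
  have T_i: "integrable (M k) (T k)" and T_i2: "integrable (M k) (\<lambda>y. (norm (T k y))\<^sup>2)" for k
    using integrable_of_moments(3,4)[OF M T_borel T_C] by auto

  show ?thesis
  proof (rule kernel_limit[OF M prob_\<mu> w_r cost_r T_borel T_psd
        closed_sym_psd convex_sym_psd T_C C(1)])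
    fix \<tau> :: "real^'n \<Rightarrow> real^'n^'n"
    assume \<tau>_borel[measurable]: "\<tau> \<in> borel_measurable borel" and \<tau>_psd: "\<And>y. \<tau> y \<in> {A. sym_psd A}"
      and \<tau>_i: "integrable \<mu> \<tau>"
      and lim_F: "\<And>X F c. closed X \<Longrightarrow> {A. sym_psd A} \<subseteq> X \<Longrightarrow> convex_ennreal_on X F \<Longrightarrow>
        lower_semicontinuous_on X F \<Longrightarrow> \<forall>\<^sub>F k in sequentially. (\<integral>\<^sup>+ x. F (T k x) \<partial>M k) \<le> c \<Longrightarrow>
        (\<integral>\<^sup>+ y. F (\<tau> y) \<partial>\<mu>) \<le> c"
      and lim_H: "\<And>H a l. uniformly_continuous_on UNIV H \<Longrightarrow> bounded (range H) \<Longrightarrow>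
        (\<And>k. a k \<le> (\<integral>x. T k x \<bullet> H x \<partial>M k)) \<Longrightarrow> a \<longlonglongrightarrow> l \<Longrightarrow> l \<le> (\<integral>y. \<tau> y \<bullet> H y \<partial>\<mu>)"
    have \<tau>_le: "(\<integral>\<^sup>+ y. ennreal ((norm (\<tau> y))\<^sup>2) \<partial>\<mu>) \<le> c"
      if "\<forall>\<^sub>F k in sequentially. (\<integral>\<^sup>+ y. ennreal ((norm (T k y))\<^sup>2) \<partial>M k) \<le> c" for c
      using that by (intro lim_F[of UNIV] norm_square_convex_lower_semicontinuous) auto
    have \<tau>_C: "(\<integral>\<^sup>+ y. ennreal ((norm (\<tau> y))\<^sup>2) \<partial>\<mu>) \<le> ennreal C"
      using T_C by (intro \<tau>_le always_eventually) auto
    have \<tau>_i2: "integrable \<mu> (\<lambda>y. (norm (\<tau> y))\<^sup>2)"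
      by (rule integrable_of_moments(3)[OF prob_\<mu> \<tau>_borel \<tau>_C])
    have psd_sym: "{A. sym_psd A} \<subseteq> (sym_matrices :: (real^'n^'n) set)"
      by (auto dest: sym_psd_sym)

    have liminf: "(\<integral>\<^sup>+ y. ennreal ((hs_norm (\<tau> y))\<^sup>2) \<partial>\<mu>) \<le> liminf ?u"
    \<comment> \<open>Every c above the liminf eventually bounds the energies along the subsequence,
      which is the fixed bound that \<open>lim_F\<close> asks for.\<close>
    proof (rule dense_ge)
      fix c assume "liminf ?u < c"
      then have "\<forall>\<^sub>F k in sequentially. (?u \<circ> r) k < c" by (rule order_tendstoD(2)[OF r(2)])
      then show "(\<integral>\<^sup>+ y. ennreal ((hs_norm (\<tau> y))\<^sup>2) \<partial>\<mu>) \<le> c"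
        unfolding hs_norm_eq_norm
        by (intro \<tau>_le) (auto elim!: eventually_mono simp: M_def T_def)
    qed

    \<comment> \<open>Stein identity in the limit\<close>
    have stein: "stein_kernel \<mu> \<tau>"
      unfolding stein_kernel_def hs_inner_eq_inner
    proof (intro conjI allI impI \<tau>_borel)
      fix \<Phi> :: "real^'n \<Rightarrow> real^'n" assume \<Phi>: "test_function \<Phi>"
      let ?J = "\<lambda>y. jacobian \<Phi> (at y)"
      obtain R where R: "continuous_on UNIV \<Phi>" "\<And>x. norm x > R \<Longrightarrow> \<Phi> x = 0"
        "\<And>v. continuous_on UNIV (\<lambda>x. frechet_derivative \<Phi> (at x) v)"
        "\<And>x v. norm x > R \<Longrightarrow> frechet_derivative \<Phi> (at x) v = 0"
        by (rule test_function_derivative[OF \<Phi>]) blast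
      have J_cont: "continuous_on UNIV ?J"
        unfolding jacobian_def matrix_def
        by (intro continuous_on_vec_lambda continuous_on_component R(3))
      have J_supp: "?J x = 0" if "norm x > R" for x
        using R(4)[OF that] by (simp add: jacobian_def matrix_def vec_eq_iff)
      have J: "uniformly_continuous_on UNIV ?J" "bounded (range ?J)"
        using continuous_compact_support_uniformly_continuous[OF J_cont, of R] J_supp by blast+
      obtain B where B: "\<And>y. norm (?J y) \<le> B" using J(2) by (auto simp: bounded_iff)
      have f_cont: "continuous_on UNIV (\<lambda>y. y \<bullet> \<Phi> y)" using R(1) by (intro continuous_intros)
      have f_bd: "bounded (range (\<lambda>y. y \<bullet> \<Phi> y))"
        by (rule continuous_compact_support_uniformly_continuous(2)[OF f_cont, of R]) (simp add: R(2))
      then obtain B' where B': "\<And>y. \<bar>y \<bullet> \<Phi> y\<bar> \<le> B'" by (auto simp: bounded_iff)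
      have [measurable]: "(\<lambda>y. y \<bullet> \<Phi> y) \<in> borel_measurable borel" "?J \<in> borel_measurable borel"
        by (intro borel_measurable_continuous_onI f_cont J_cont)+
      show "integrable \<mu> (\<lambda>y. y \<bullet> \<Phi> y)"
        by (rule \<mu>.integrable_const_bound[where B = B']) (use B' in auto)
      show "integrable \<mu> (\<lambda>y. \<tau> y \<bullet> ?J y)"
        by (rule integrable_inner_bounded[OF \<tau>_i _ B]) measurable
      have eq: "(\<integral>y. y \<bullet> \<Phi> y \<partial>M k) = (\<integral>y. T k y \<bullet> ?J y \<partial>M k)" for k
        using T_stein[of k] \<Phi> by (simp add: stein_kernel_def hs_inner_eq_inner)
      have lim: "(\<lambda>k. \<integral>y. y \<bullet> \<Phi> y \<partial>M k) \<longlonglongrightarrow> (\<integral>y. y \<bullet> \<Phi> y \<partial>\<mu>)"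
        using conv_r f_cont f_bd unfolding weakly_converges_def by blast
      show "(\<integral>y. y \<bullet> \<Phi> y \<partial>\<mu>) = (\<integral>y. \<tau> y \<bullet> ?J y \<partial>\<mu>)"
      \<comment> \<open>As \<open>lim_H\<close> is one-sided, it is applied to the Jacobian and to
        its negative.\<close>
      proof (rule antisym)
        show "(\<integral>y. y \<bullet> \<Phi> y \<partial>\<mu>) \<le> (\<integral>y. \<tau> y \<bullet> ?J y \<partial>\<mu>)"
          by (rule lim_H[OF J _ lim]) (rule eq_refl[OF eq])
        have "- (\<integral>y. y \<bullet> \<Phi> y \<partial>\<mu>) \<le> (\<integral>y. \<tau> y \<bullet> - ?J y \<partial>\<mu>)"
        proof (rule lim_H[OF _ _ _ tendsto_minus[OF lim]])
          show "uniformly_continuous_on UNIV (\<lambda>y. - ?J y)"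
            by (intro uniformly_continuous_on_minus J)
          show "bounded (range (\<lambda>y. - ?J y))"
            using B by (auto simp: bounded_iff)
          show "- (\<integral>y. y \<bullet> \<Phi> y \<partial>M k) \<le> (\<integral>y. T k y \<bullet> - ?J y \<partial>M k)" for k
            by (simp add: eq)
        qed
        then show "(\<integral>y. \<tau> y \<bullet> ?J y \<partial>\<mu>) \<le> (\<integral>y. y \<bullet> \<Phi> y \<partial>\<mu>)" by simp
      qed
    qed

    \<comment> \<open>Mean of the kernel and covariance\<close>
    have mean: "(\<integral>y. \<tau> y \<bullet> A \<partial>\<mu>) = (\<integral>y. y \<bullet> (A *v y) \<partial>\<mu>)" for A
      by (rule stein_kernel_mean[OF prob_\<mu> stein \<tau>_C D\<mu>])
    have cov: "(\<integral>y. \<tau> y \<partial>\<mu>) = cov_matrix \<mu>"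
    proof -
      have "(\<integral>y. \<tau> y \<partial>\<mu>) $ i $ j = cov_matrix \<mu> $ i $ j" for i j
      proof -
        have "(\<integral>z. z $ l \<partial>\<mu>) = 0" for l
        proof -
          have "(\<integral>z. z $ l \<partial>\<mu>) = (\<integral>z. z \<bullet> axis l 1 \<partial>\<mu>)" by (simp add: inner_axis)
          also have "\<dots> = (\<integral>z. z \<partial>\<mu>) \<bullet> axis l 1" using int_y by (intro integral_inner_left) auto
          finally show ?thesis using centered by (simp add: centered_def)
        qed
        then have "cov_matrix \<mu> $ i $ j = (\<integral>y. y $ i * y $ j \<partial>\<mu>)" by (simp add: cov_matrix_def)
        \<comment> \<open>The rank one matrix of two unit vectors reads off the entry i, j of the
          kernel and of the second moments.\<close>
        also have "\<dots> = (\<integral>y. y \<bullet> ((\<chi> a b. axis i 1 $ a * axis j 1 $ b) *v y) \<partial>\<mu>)"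
          by (simp add: bilinear_form_rank_one inner_axis inner_axis')
        also have "\<dots> = (\<integral>y. \<tau> y \<bullet> (\<chi> a b. axis i 1 $ a * axis j 1 $ b) \<partial>\<mu>)"
          by (rule mean[symmetric])
        also have "\<dots> = (\<integral>y. \<tau> y \<partial>\<mu>) \<bullet> (\<chi> a b. axis i 1 $ a * axis j 1 $ b)"
          using \<tau>_i by (intro integral_inner_left) auto
        also have "\<dots> = (\<integral>y. \<tau> y \<partial>\<mu>) $ i $ j"
          by (simp add: inner_matrix_rank_one inner_axis' matrix_vector_mult_basis column_def)
        finally show ?thesis by simp
      qed
      then show ?thesis by (simp add: vec_eq_iff)
    qed

    \<comment> \<open>Limits of means and of quadratic functionals\<close>
    have lim_mean: "(\<lambda>k. \<integral>y. T k y \<bullet> A \<partial>M k) \<longlonglongrightarrow> (\<integral>y. \<tau> y \<bullet> A \<partial>\<mu>)" for A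
    proof -
      \<comment> \<open>A limit of lower bounds is an input of \<open>lim_H\<close>, so convergence
        of the means has to come from elsewhere: by the Stein identity they are second moments,
        which converge along the couplings.\<close>
      have "(\<lambda>k. \<integral>y. y \<bullet> (A *v y) \<partial>M k) \<longlonglongrightarrow> (\<integral>y. y \<bullet> (A *v y) \<partial>\<mu>)"
      proof (rule integral_convergence_of_couplings[OF M prob_\<mu> w_r cost_r M_D D\<mu> D0])
        have "continuous_on UNIV (\<lambda>y. A *v y)"
          by (intro linear_continuous_on matrix_vector_mul_bounded_linear)
        then show "(\<lambda>y. y \<bullet> (A *v y)) \<in> borel_measurable borel"
          by (intro borel_measurable_continuous_onI continuous_intros)
        show "\<bar>x \<bullet> (A *v x) - y \<bullet> (A *v y)\<bar> \<le> norm A * (norm (x - y) * (1 + norm x + norm y))" for x y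
        proof -
          have "x \<bullet> (A *v x) - y \<bullet> (A *v y) = (x - y) \<bullet> (A *v x) + y \<bullet> (A *v (x - y))"
            by (simp add: matrix_vector_mult_diff_distrib inner_diff_left inner_diff_right)
          also have "\<bar>\<dots>\<bar> \<le> norm A * (norm (x - y) * norm x) + norm A * (norm y * norm (x - y))"
            by (intro order_trans[OF abs_triangle_ineq] add_mono abs_inner_matrix_vector_le)
          also have "\<dots> \<le> norm A * (norm (x - y) * (1 + norm x + norm y))"
            by (simp add: algebra_simps)
          finally show ?thesis .
        qed
      qed auto
      then show ?thesis
        unfolding mean stein_kernel_mean[OF M T_stein T_C M_D] .
    qed

    \<comment> \<open>The bound varies with k because a variance bound turns into a second moment
      bound with the squared mean on the right. As \<open>lim_F\<close> accepts fixed bounds only, a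
      slack e is spent.\<close>
    have lim_q: "(\<integral>y. b (\<tau> y) (\<tau> y) \<partial>\<mu>) \<le> l"
      if b: "bounded_bilinear b" and nonneg: "\<And>A. A \<in> sym_matrices \<Longrightarrow> 0 \<le> b A A"
        and c: "\<And>k. (\<integral>y. b (T k y) (T k y) \<partial>M k) \<le> c k" "c \<longlonglongrightarrow> l"
      for b :: "real^'n^'n \<Rightarrow> real^'n^'n \<Rightarrow> real" and c l
    proof (rule field_le_epsilon)
      fix e :: real assume "0 < e"
      then have ev: "\<forall>\<^sub>F k in sequentially. c k < l + e" by (intro order_tendstoD(2)[OF c(2)]) simp
      have i: "integrable (M k) (\<lambda>y. b (T k y) (T k y))" for k
        by (rule integrable_bounded_bilinear_square[OF b _ T_i2])
          (use T_i in auto)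
      have i\<mu>: "integrable \<mu> (\<lambda>y. b (\<tau> y) (\<tau> y))"
        by (rule integrable_bounded_bilinear_square[OF b _ \<tau>_i2]) (use \<tau>_i in auto)
      have 0: "0 \<le> b (T k y) (T k y)" "0 \<le> b (\<tau> y) (\<tau> y)" for k y
        using nonneg psd_sym T_psd \<tau>_psd by blast+
      \<comment> \<open>A negative l + e would be truncated by \<open>ennreal\<close>; a single late
        k shows that it is nonnegative.\<close>
      obtain k where "c k < l + e" using ev by (auto simp: eventually_sequentially)
      with c(1)[of k] Bochner_Integration.integral_nonneg[of "M k" "\<lambda>y. b (T k y) (T k y)"] 0(1)
      have le: "0 \<le> l + e" by fastforce
      have "(\<integral>\<^sup>+ y. ennreal (b (\<tau> y) (\<tau> y)) \<partial>\<mu>) \<le> ennreal (l + e)"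
      proof (rule lim_F[OF closed_convex_sym_matrices(1) psd_sym])
        show "convex_ennreal_on sym_matrices (\<lambda>A. ennreal (b A A))"
          by (intro convex_ennreal_on_ennreal convex_on_quadratic b closed_convex_sym_matrices nonneg
              subspace_diff subspace_sym_matrices)
        show "lower_semicontinuous_on sym_matrices (\<lambda>A. ennreal (b A A))"
          by (intro lower_semicontinuous_on_ennreal bounded_bilinear.continuous_on[OF b] continuous_on_id)
        show "\<forall>\<^sub>F k in sequentially. (\<integral>\<^sup>+ y. ennreal (b (T k y) (T k y)) \<partial>M k) \<le> ennreal (l + e)"
          using ev
        proof eventually_elim
          case (elim k)
          with c(1)[of k] show ?case
            by (subst nn_integral_eq_integral[OF i]) (auto intro!: ennreal_leI simp: 0)
        qed
      qed
      then show "(\<integral>y. b (\<tau> y) (\<tau> y) \<partial>\<mu>) \<le> l + e"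
        using le 0 by (simp add: nn_integral_eq_integral[OF i\<mu>])
    qed

    \<comment> \<open>Convex functionals, (i)\<close>
    have part_F: "(\<integral>\<^sup>+ y. F (\<tau> y) \<partial>\<mu>) \<le> c"
      if "convex_ennreal_on sym_matrices F" "lower_semicontinuous_on sym_matrices F"
        "(SUP k. \<integral>\<^sup>+ y. F (\<tau>s k y) \<partial>\<mu>s k) \<le> c" for F c
    proof (rule lim_F[OF closed_convex_sym_matrices(1) psd_sym that(1,2)])
      show "\<forall>\<^sub>F k in sequentially. (\<integral>\<^sup>+ x. F (T k x) \<partial>M k) \<le> c"
        using that(3) unfolding SUP_le_iff M_def T_def by (intro always_eventually) auto
    qed

    \<comment> \<open>Variances of traces, (ii)\<close>
    have part_tr: "prob_space.variance \<mu> (\<lambda>y. trace (A ** \<tau> y)) \<le> c * trace (A ** A)"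
      if hyp: "\<forall>k. \<forall>A\<in>sym_matrices.
          prob_space.variance (\<mu>s k) (\<lambda>y. trace (A ** \<tau>s k y)) \<le> c * trace (A ** A)"
        and A: "A \<in> sym_matrices" for c A
    proof -
      let ?b = "\<lambda>X Y :: real^'n^'n. (A \<bullet> X) * (A \<bullet> Y)"
      have b: "bounded_bilinear ?b"
        by (rule bounded_bilinear.comp[OF bounded_bilinear_mult bounded_linear_inner_right
              bounded_linear_inner_right])
      have var: "prob_space.variance L (\<lambda>y. A \<bullet> t y) = (\<integral>y. ?b (t y) (t y) \<partial>L) - (\<integral>y. t y \<bullet> A \<partial>L)\<^sup>2"
        if "borel_prob L" "integrable L t" "integrable L (\<lambda>y. (norm (t y))\<^sup>2)" for L t
      proof -
        interpret L: prob_space L using that(1) by (simp add: borel_prob_def)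
        have "integrable L (\<lambda>y. ?b (t y) (t y))"
          by (rule integrable_bounded_bilinear_square[OF b _ that(3)]) (use that(2) in auto)
        then show ?thesis
          using that(2) by (subst L.variance_eq) (auto simp: power2_eq_square inner_commute[of _ A])
      qed
      \<comment> \<open>The convex second moment passes to the limit only as an inequality; the
        squared mean, which enters the variance with a minus sign, converges by
        \<open>lim_mean\<close>.\<close>
      have "(\<integral>y. ?b (\<tau> y) (\<tau> y) \<partial>\<mu>) \<le> c * trace (A ** A) + (\<integral>y. \<tau> y \<bullet> A \<partial>\<mu>)\<^sup>2"
      proof (rule lim_q[OF b])
        show "(\<integral>y. ?b (T k y) (T k y) \<partial>M k) \<le> c * trace (A ** A) + (\<integral>y. T k y \<bullet> A \<partial>M k)\<^sup>2" for k
          using hyp[rule_format, OF A, of "r k"] var[OF M T_i T_i2, of k]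
          by (simp add: trace_sym_mult[OF A] M_def T_def)
        show "(\<lambda>k. c * trace (A ** A) + (\<integral>y. T k y \<bullet> A \<partial>M k)\<^sup>2)
            \<longlonglongrightarrow> c * trace (A ** A) + (\<integral>y. \<tau> y \<bullet> A \<partial>\<mu>)\<^sup>2"
          by (intro tendsto_intros lim_mean)
      qed simp
      with var[OF prob_\<mu> \<tau>_i \<tau>_i2] show ?thesis by (simp add: trace_sym_mult[OF A])
    qed

    \<comment> \<open>Quadratic energies, (iii)\<close>
    have part_en: "(\<integral>y. trace (A ** \<tau> y ** A ** \<tau> y) \<partial>\<mu>) \<le> c * trace (A ** A)"
      if hyp: "\<forall>k. \<forall>A\<in>sym_matrices.
          (\<integral>y. trace (A ** \<tau>s k y ** A ** \<tau>s k y) \<partial>\<mu>s k) \<le> c * trace (A ** A)"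
        and A: "A \<in> sym_matrices" for c A
    proof -
      obtain B where B: "sym_psd B" "trace (B ** B) = trace (A ** A)"
        "\<And>X. sym_psd X \<Longrightarrow> trace (A ** X ** A ** X) \<le> trace (B ** X ** B ** X)"
        using sym_matrix_absolute_value[OF A] by metis
      have i: "integrable \<mu> (\<lambda>y. trace (X ** \<tau> y ** X ** \<tau> y))" for X
        by (rule integrable_bounded_bilinear_square[OF bounded_bilinear_trace _ \<tau>_i2])
          (use \<tau>_i in auto)
      have "(\<integral>y. trace (A ** \<tau> y ** A ** \<tau> y) \<partial>\<mu>) \<le> (\<integral>y. trace (B ** \<tau> y ** B ** \<tau> y) \<partial>\<mu>)"
        using \<tau>_psd by (intro integral_mono i B(3)) auto
      \<comment> \<open>The hypothesis is used at B instead of A, because there the form is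
        nonnegative on symmetric matrices and hence convex.\<close>
      also have "\<dots> \<le> c * trace (B ** B)"
      proof (rule lim_q[OF bounded_bilinear_trace _ _ tendsto_const])
        show "0 \<le> trace (B ** X ** B ** X)" if "X \<in> sym_matrices" for X
          by (rule trace_conjugate_nonneg[OF B(1) B(1) that])
        show "(\<integral>y. trace (B ** T k y ** B ** T k y) \<partial>M k) \<le> c * trace (B ** B)" for k
          unfolding M_def T_def using hyp sym_psd_sym[OF B(1)] by blast
      qed
      finally show ?thesis using B(2) by simp
    qed

    \<comment> \<open>Weighted Poincare inequalities, (iv)\<close>
    have part_wp: "prob_space.variance \<mu> g \<le> c * (\<integral>y. (\<tau> y *v grad g y) \<bullet> grad g y \<partial>\<mu>)"
      if hyp: "\<forall>k. \<forall>g :: real^'n \<Rightarrow> real. test_function g \<longrightarrow>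
          prob_space.variance (\<mu>s k) g \<le> c * (\<integral>y. (\<tau>s k y *v grad g y) \<bullet> grad g y \<partial>\<mu>s k)"
        and g: "test_function g" for c and g :: "real^'n \<Rightarrow> real"
    proof -
      obtain R where R: "continuous_on UNIV g" "\<And>x. norm x > R \<Longrightarrow> g x = 0"
        "\<And>v. continuous_on UNIV (\<lambda>x. frechet_derivative g (at x) v)"
        "\<And>x v. norm x > R \<Longrightarrow> frechet_derivative g (at x) v = 0"
        by (rule test_function_derivative[OF g]) blast
      \<comment> \<open>The right-hand side is linear in the kernel, paired with a continuous
        compactly supported field. With c inside this field, \<open>lim_H\<close> applies whatever
        the sign of c.\<close>
      define H where "H y = c *\<^sub>R (\<chi> i j. grad g y $ i * grad g y $ j)" for y
      have H: "(c * ((X *v grad g y) \<bullet> grad g y)) = X \<bullet> H y" for X y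
        by (simp add: H_def inner_matrix_rank_one inner_commute)
      have H_cont: "continuous_on UNIV H"
        unfolding H_def grad_def
        by (intro continuous_intros continuous_on_vec_lambda continuous_on_component R(3))
      have H_supp: "H x = 0" if "norm x > R" for x
        using R(4)[OF that] by (simp add: H_def grad_def vec_eq_iff)
      have "prob_space.variance \<mu> g \<le> (\<integral>y. \<tau> y \<bullet> H y \<partial>\<mu>)"
      proof (rule lim_H[OF continuous_compact_support_uniformly_continuous[where R = R, OF H_cont H_supp]])
        show "prob_space.variance (M k) g \<le> (\<integral>y. T k y \<bullet> H y \<partial>M k)" for k
          unfolding M_def T_def H[symmetric] using hyp g by simp
        show "(\<lambda>k. prob_space.variance (M k) g) \<longlonglongrightarrow> prob_space.variance \<mu> g"
          by (rule variance_weakly_converges[OF M prob_\<mu> conv_r R(1)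
                continuous_compact_support_uniformly_continuous(2)[where R = R, OF R(1,2)]])
      qed
      then show ?thesis unfolding H[symmetric] by simp
    qed

    have psd_stein: "sym_psd_stein_kernel \<mu> \<tau>" using stein \<tau>_psd by (simp add: sym_psd_stein_kernel_def)
    show ?thesis
    proof (intro conjI exI[of _ \<tau>] allI impI ballI centered W2 psd_stein \<tau>_i cov liminf)
      show "(\<integral>\<^sup>+ y. F (\<tau> y) \<partial>\<mu>) \<le> c"
        if "convex_ennreal_on sym_matrices F \<and> lower_semicontinuous_on sym_matrices F \<and>
          (SUP k. \<integral>\<^sup>+ y. F (\<tau>s k y) \<partial>\<mu>s k) \<le> c" for F c
        using that by (elim conjE) (rule part_F)
    qed (rule part_tr part_en part_wp; assumption)+
  qed
qed

end
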